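(* Let $N\geqslant 1$ be an integer, let $\Gamma$ be an abelian discrete group and let $\Lambda$ be a subgroup of $\Gamma$. Then there is an isomorphism of compact quantum groups $$H_{N}^{+}(\Gamma, \Lambda) \cong H_{N}^{+}(\Gamma/\Lambda)\,\widetilde{\times}\,\widehat{\Gamma}.$$
   Context: A CQG-algebra is a Hopf $*$-algebra spanned by the coefficients of its finite-dimensional unitary corepresentations; it is written $\mathcal{O}(\mathbb{G})$ and said to correspond to the compact quantum group $\mathbb{G}$. Compact quantum groups are isomorphic if their CQG-algebras are isomorphic as Hopf $*$-algebras. For a discrete group $\Gamma$, $\mathcal{O}(\widehat{\Gamma})=\mathbb{C}[\Gamma]$ with $\Delta(g)=g\otimes g$, $g^*=g^{-1}$. For a discrete group $\Gamma$, $\mathcal{O}(H_{N}^{+}(\Gamma))$ is the universal unital $*$-algebra generated by elements $a_{ij}(g)$, $1\leqslant i,j\leqslant N$, $g\in\Gamma$, with $a_{ij}(g)^*=a_{ij}(g^{-1})$ and relations $$a_{ij}(g)a_{ik}(h)=\delta_{jk}a_{ij}(gh),\quad a_{ji}(g)a_{ki}(h)=\delta_{jk}a_{ji}(gh),\quad \sum_{k=1}^{N}a_{ik}(e)=1=\sum_{k=1}^{N}a_{kj}(e),$$ a CQG-algebra with $\Delta(a_{ij}(g))=\sum_{k}a_{ik}(g)\otimes a_{kj}(g)$. For a subgroup $\Lambda<\Gamma$, $\mathcal{O}(H_{N}^{+}(\Gamma,\Lambda))$ is the quotient of $\mathcal{O}(H_{N}^{+}(\Gamma))$ by the Hopf $*$-ideal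 generated by the relations $\sum_{k=1}^{N}a_{ik}(g)=\sum_{k=1}^{N}a_{jk}(g)$ for all $1\leqslant i,j\leqslant N$ and $g\in\Lambda$. Glued direct product: for $\Gamma$ abelian, $\mathcal{O}(H_{N}^{+}(\Gamma/\Lambda)\widetilde{\times}\widehat{\Gamma})$ is the $*$-subalgebra of $\mathcal{O}(H_{N}^{+}(\Gamma/\Lambda))\otimes\mathcal{O}(\widehat{\Gamma})$ (tensor product Hopf $*$-algebra) generated by the elements $a_{ij}([g])\otimes g$ for all $g\in\Gamma$, $1\leqslant i,j\leqslant N$, where $[g]$ is the image of $g$ in $\Gamma/\Lambda$. It is a CQG-algebra for the restricted coproduct, and $H_{N}^{+}(\Gamma/\Lambda)\widetilde{\times}\widehat{\Gamma}$ is the corresponding compact quantum group. *)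

theory Defs
  imports Complex_Main "HOL-Algebra.Algebra" "HOL-Algebra.Algebraic_Closure_Type"
    "HOL-Library.Poly_Mapping"
begin

section \<open>Complex unital $*$-algebras\<close>

text \<open>Algebras are records with carriers, extending the ring and module records of HOL-Algebra.\<close>

abbreviation CC :: "complex ring"
  where "CC \<equiv> ring_of_type_algebra"

record 'a star_alg = "(complex, 'a) module" +
  star :: "'a \<Rightarrow> 'a"

definition complex_star_algebra :: "('a, 'm) star_alg_scheme \<Rightarrow> bool"
  where "complex_star_algebra A \<longleftrightarrow> ring A \<and> module CC A \<and>
    (\<forall>c. \<forall>x\<in>carrier A. \<forall>y\<in>carrier A.
       (c \<odot>\<^bsub>A\<^esub> x) \<otimes>\<^bsub>A\<^esub> y = c \<odot>\<^bsub>A\<^esub> (x \<otimes>\<^bsub>A\<^esub> y) \<and>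
       x \<otimes>\<^bsub>A\<^esub> (c \<odot>\<^bsub>A\<^esub> y) = c \<odot>\<^bsub>A\<^esub> (x \<otimes>\<^bsub>A\<^esub> y)) \<and>
    star A \<in> carrier A \<rightarrow> carrier A \<and>
    (\<forall>x\<in>carrier A. star A (star A x) = x) \<and>
    (\<forall>x\<in>carrier A. \<forall>y\<in>carrier A. star A (x \<oplus>\<^bsub>A\<^esub> y) = star A x \<oplus>\<^bsub>A\<^esub> star A y) \<and>
    (\<forall>c. \<forall>x\<in>carrier A. star A (c \<odot>\<^bsub>A\<^esub> x) = cnj c \<odot>\<^bsub>A\<^esub> star A x) \<and>
    (\<forall>x\<in>carrier A. \<forall>y\<in>carrier A. star A (x \<otimes>\<^bsub>A\<^esub> y) = star A y \<otimes>\<^bsub>A\<^esub> star A x)"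

definition lin_maps :: "('a, 'm) star_alg_scheme \<Rightarrow> ('b, 'n) star_alg_scheme \<Rightarrow> ('a \<Rightarrow> 'b) set"
  where "lin_maps A B = {f \<in> carrier A \<rightarrow> carrier B.
    (\<forall>x\<in>carrier A. \<forall>y\<in>carrier A. f (x \<oplus>\<^bsub>A\<^esub> y) = f x \<oplus>\<^bsub>B\<^esub> f y) \<and>
    (\<forall>c. \<forall>x\<in>carrier A. f (c \<odot>\<^bsub>A\<^esub> x) = c \<odot>\<^bsub>B\<^esub> f x)}"

definition star_homs :: "('a, 'm) star_alg_scheme \<Rightarrow> ('b, 'n) star_alg_scheme \<Rightarrow> ('a \<Rightarrow> 'b) set"
  where "star_homs A B = {f \<in> ring_hom A B \<inter> lin_maps A B.
    \<forall>x\<in>carrier A. f (star A x) = star B (f x)}"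

definition lin_span :: "('a, 'm) star_alg_scheme \<Rightarrow> 'a set \<Rightarrow> 'a set"
  where "lin_span A S = \<Inter>{U. submodule U CC A \<and> S \<subseteq> U}"

definition star_ideal :: "('a, 'm) star_alg_scheme \<Rightarrow> 'a set \<Rightarrow> bool"
  where "star_ideal A I \<longleftrightarrow> ideal I A \<and> (\<forall>x\<in>I. star A x \<in> I)"

definition star_ideal_gen :: "('a, 'm) star_alg_scheme \<Rightarrow> 'a set \<Rightarrow> 'a set"
  where "star_ideal_gen A S = \<Inter>{I. star_ideal A I \<and> S \<subseteq> I}"

definition quot_alg :: "('a, 'm) star_alg_scheme \<Rightarrow> 'a set \<Rightarrow> 'a set star_alg"
  where "quot_alg A I =
    \<lparr>carrier = carrier (A Quot I), monoid.mult = monoid.mult (A Quot I), one = one (A Quot I),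
     ring.zero = ring.zero (A Quot I), add = add (A Quot I),
     module.smult = (\<lambda>c K. \<Union>x\<in>K. I +>\<^bsub>A\<^esub> (c \<odot>\<^bsub>A\<^esub> x)),
     star = (\<lambda>K. \<Union>x\<in>K. I +>\<^bsub>A\<^esub> star A x)\<rparr>"

definition star_subalgebra :: "('a, 'm) star_alg_scheme \<Rightarrow> 'a set \<Rightarrow> bool"
  where "star_subalgebra A T \<longleftrightarrow> subring T A \<and> submodule T CC A \<and> (\<forall>x\<in>T. star A x \<in> T)"

definition star_subalgebra_gen :: "('a, 'm) star_alg_scheme \<Rightarrow> 'a set \<Rightarrow> 'a set"
  where "star_subalgebra_gen A S = \<Inter>{T. star_subalgebra A T \<and> S \<subseteq> T}"

text \<open>
  The algebra of a monoid \<open>M\<close>, with product bilinearly and involution antilinearly extended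
  from the product of \<open>M\<close> and an involutive anti-automorphism \<open>s\<close> of \<open>M\<close>. Instances: group
  algebras, free $*$-algebras (words), and the free vector space on a product of two algebras
  from which the tensor product is formed.
\<close>

definition monoid_alg :: "('a, 'm) monoid_scheme \<Rightarrow> ('a \<Rightarrow> 'a) \<Rightarrow> ('a \<Rightarrow>\<^sub>0 complex) star_alg"
  where "monoid_alg M s =
    \<lparr>carrier = {f. Poly_Mapping.keys f \<subseteq> carrier M},
     monoid.mult = (\<lambda>f g. \<Sum>a\<in>Poly_Mapping.keys f. \<Sum>b\<in>Poly_Mapping.keys g.
               Poly_Mapping.single (a \<otimes>\<^bsub>M\<^esub> b) (Poly_Mapping.lookup f a * Poly_Mapping.lookup g b)),
     one = Poly_Mapping.single \<one>\<^bsub>M\<^esub> 1,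
     ring.zero = 0,
     add = (+),
     module.smult = (\<lambda>c f. Poly_Mapping.map ((*) c) f),
     star = (\<lambda>f. \<Sum>a\<in>Poly_Mapping.keys f.
               Poly_Mapping.single (s a) (cnj (Poly_Mapping.lookup f a)))\<rparr>"

text \<open>
  Words in letters \<open>(x, False)\<close>, standing for \<open>x\<close>, and \<open>(x, True)\<close>, standing for the formal
  adjoint of \<open>x\<close>.
\<close>

definition word_monoid :: "'x set \<Rightarrow> ('x \<times> bool) list monoid"
  where "word_monoid V = \<lparr>carrier = lists (V \<times> UNIV), monoid.mult = (@), one = []\<rparr>"

definition free_star_alg :: "'x set \<Rightarrow> (('x \<times> bool) list \<Rightarrow>\<^sub>0 complex) star_alg"
  where "free_star_alg V = monoid_alg (word_monoid V) (\<lambda>w. rev (map (apsnd Not) w))"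

definition letter :: "'x \<Rightarrow> ('x \<times> bool) list \<Rightarrow>\<^sub>0 complex"
  where "letter x = Poly_Mapping.single [(x, False)] 1"


section \<open>Algebraic tensor products\<close>

definition pre_tensor :: "('a, 'm) star_alg_scheme \<Rightarrow> ('b, 'n) star_alg_scheme
    \<Rightarrow> ('a \<times> 'b \<Rightarrow>\<^sub>0 complex) star_alg"
  where "pre_tensor A B = monoid_alg (A \<times>\<times> B) (map_prod (star A) (star B))"

definition bilinear_relators :: "('a, 'm) star_alg_scheme \<Rightarrow> ('b, 'n) star_alg_scheme
    \<Rightarrow> ('a \<times> 'b \<Rightarrow>\<^sub>0 complex) set"
  where "bilinear_relators A B =
    {Poly_Mapping.single (a \<oplus>\<^bsub>A\<^esub> a', b) 1 - Poly_Mapping.single (a, b) 1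
       - Poly_Mapping.single (a', b) 1 | a a' b.
       a \<in> carrier A \<and> a' \<in> carrier A \<and> b \<in> carrier B} \<union>
    {Poly_Mapping.single (a, b \<oplus>\<^bsub>B\<^esub> b') 1 - Poly_Mapping.single (a, b) 1
       - Poly_Mapping.single (a, b') 1 | a b b'.
       a \<in> carrier A \<and> b \<in> carrier B \<and> b' \<in> carrier B} \<union>
    {Poly_Mapping.single (c \<odot>\<^bsub>A\<^esub> a, b) 1 - Poly_Mapping.single (a, b) c | a b c.
       a \<in> carrier A \<and> b \<in> carrier B} \<union>
    {Poly_Mapping.single (a, c \<odot>\<^bsub>B\<^esub> b) 1 - Poly_Mapping.single (a, b) c | a b c.
       a \<in> carrier A \<and> b \<in> carrier B}"

definition tensor_kernel :: "('a, 'm) star_alg_scheme \<Rightarrow> ('b, 'n) star_alg_scheme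
    \<Rightarrow> ('a \<times> 'b \<Rightarrow>\<^sub>0 complex) set"
  where "tensor_kernel A B = lin_span (pre_tensor A B) (bilinear_relators A B)"

text \<open>
  The linear span \<^const>\<open>tensor_kernel\<close> is automatically a $*$-ideal, because products of a
  relator with a pair, and adjoints of relators, are again relators (up to a scalar).
\<close>

definition tensor_alg :: "('a, 'm) star_alg_scheme \<Rightarrow> ('b, 'n) star_alg_scheme
    \<Rightarrow> ('a \<times> 'b \<Rightarrow>\<^sub>0 complex) set star_alg"
  where "tensor_alg A B = quot_alg (pre_tensor A B) (tensor_kernel A B)"

definition tens :: "('a, 'm) star_alg_scheme \<Rightarrow> ('b, 'n) star_alg_scheme
    \<Rightarrow> 'a \<Rightarrow> 'b \<Rightarrow> ('a \<times> 'b \<Rightarrow>\<^sub>0 complex) set"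
  where "tens A B a b = tensor_kernel A B +>\<^bsub>pre_tensor A B\<^esub> Poly_Mapping.single (a, b) 1"

text \<open>The linear map on the tensor product induced by a bilinear map \<open>\<beta>\<close>.\<close>

definition tensor_lift :: "('a, 'm) star_alg_scheme \<Rightarrow> ('b, 'n) star_alg_scheme
    \<Rightarrow> ('c, 'k) star_alg_scheme \<Rightarrow> ('a \<Rightarrow> 'b \<Rightarrow> 'c) \<Rightarrow> ('a \<times> 'b \<Rightarrow>\<^sub>0 complex) set \<Rightarrow> 'c"
  where "tensor_lift A B C \<beta> =
    (THE h. h \<in> lin_maps (tensor_alg A B) C \<inter> extensional (carrier (tensor_alg A B)) \<and>
       (\<forall>a\<in>carrier A. \<forall>b\<in>carrier B. h (tens A B a b) = \<beta> a b))"

definition tensor_map :: "('a, 'm) star_alg_scheme \<Rightarrow> ('b, 'n) star_alg_scheme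
    \<Rightarrow> ('c, 'k) star_alg_scheme \<Rightarrow> ('d, 'l) star_alg_scheme \<Rightarrow> ('a \<Rightarrow> 'c) \<Rightarrow> ('b \<Rightarrow> 'd)
    \<Rightarrow> ('a \<times> 'b \<Rightarrow>\<^sub>0 complex) set \<Rightarrow> ('c \<times> 'd \<Rightarrow>\<^sub>0 complex) set"
  where "tensor_map A B C D f g =
    tensor_lift A B (tensor_alg C D) (\<lambda>a b. tens C D (f a) (g b))"

definition tensor_assoc :: "('a, 'm) star_alg_scheme \<Rightarrow> ('b, 'n) star_alg_scheme
    \<Rightarrow> ('c, 'k) star_alg_scheme \<Rightarrow> (('a \<times> 'b \<Rightarrow>\<^sub>0 complex) set \<times> 'c \<Rightarrow>\<^sub>0 complex) set
    \<Rightarrow> ('a \<times> ('b \<times> 'c \<Rightarrow>\<^sub>0 complex) set \<Rightarrow>\<^sub>0 complex) set"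
  where "tensor_assoc A B C =
    (let P = tensor_alg A (tensor_alg B C) in
     tensor_lift (tensor_alg A B) C P
       (\<lambda>t c. tensor_lift A B P (\<lambda>a b. tens A (tensor_alg B C) a (tens B C b c)) t))"

text \<open>\<open>(a \<otimes> a') \<otimes> (b \<otimes> b') \<mapsto> (a \<otimes> b) \<otimes> (a' \<otimes> b')\<close>\<close>

definition middle_swap :: "('a, 'm) star_alg_scheme \<Rightarrow> ('b, 'n) star_alg_scheme
    \<Rightarrow> (('a \<times> 'a \<Rightarrow>\<^sub>0 complex) set \<times> ('b \<times> 'b \<Rightarrow>\<^sub>0 complex) set \<Rightarrow>\<^sub>0 complex) set
    \<Rightarrow> (('a \<times> 'b \<Rightarrow>\<^sub>0 complex) set \<times> ('a \<times> 'b \<Rightarrow>\<^sub>0 complex) set \<Rightarrow>\<^sub>0 complex) set"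
  where "middle_swap A B =
    (let AB = tensor_alg A B; P = tensor_alg AB AB in
     tensor_lift (tensor_alg A A) (tensor_alg B B) P
       (\<lambda>s t. tensor_lift A A P
          (\<lambda>a a'. tensor_lift B B P (\<lambda>b b'. tens AB AB (tens A B a b) (tens A B a' b')) t) s))"


section \<open>Hopf $*$-algebras and CQG-algebras\<close>

text \<open>
  Only the coproduct is recorded; counit and antipode are determined by it. Linear maps that are
  defined by a description are pinned down outside the carrier by \<^const>\<open>extensional\<close>.
\<close>

record 'a hopf_alg = "'a star_alg" +
  comult :: "'a \<Rightarrow> ('a \<times> 'a \<Rightarrow>\<^sub>0 complex) set"

definition with_comult :: "('a, 'm) star_alg_scheme \<Rightarrow> ('a \<Rightarrow> ('a \<times> 'a \<Rightarrow>\<^sub>0 complex) set)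
    \<Rightarrow> 'a hopf_alg"
  where "with_comult A \<Delta> =
    \<lparr>carrier = carrier A, monoid.mult = monoid.mult A, one = one A, ring.zero = ring.zero A,
     add = add A, module.smult = module.smult A, star = star A, comult = \<Delta>\<rparr>"

definition is_counit :: "('a, 'm) hopf_alg_scheme \<Rightarrow> ('a \<Rightarrow> complex) \<Rightarrow> bool"
  where "is_counit A \<epsilon> \<longleftrightarrow> \<epsilon> \<in> extensional (carrier A) \<and>
    (\<forall>x\<in>carrier A. \<forall>y\<in>carrier A. \<epsilon> (x \<oplus>\<^bsub>A\<^esub> y) = \<epsilon> x + \<epsilon> y) \<and>
    (\<forall>c. \<forall>x\<in>carrier A. \<epsilon> (c \<odot>\<^bsub>A\<^esub> x) = c * \<epsilon> x) \<and>
    (\<forall>x\<in>carrier A.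
       tensor_lift A A A (\<lambda>a b. \<epsilon> a \<odot>\<^bsub>A\<^esub> b) (comult A x) = x \<and>
       tensor_lift A A A (\<lambda>a b. \<epsilon> b \<odot>\<^bsub>A\<^esub> a) (comult A x) = x)"

definition counit :: "('a, 'm) hopf_alg_scheme \<Rightarrow> 'a \<Rightarrow> complex"
  where "counit A = (THE \<epsilon>. is_counit A \<epsilon>)"

definition is_antipode :: "('a, 'm) hopf_alg_scheme \<Rightarrow> ('a \<Rightarrow> 'a) \<Rightarrow> bool"
  where "is_antipode A S \<longleftrightarrow> S \<in> lin_maps A A \<inter> extensional (carrier A) \<and>
    (\<forall>x\<in>carrier A.
       tensor_lift A A A (\<lambda>a b. S a \<otimes>\<^bsub>A\<^esub> b) (comult A x) = counit A x \<odot>\<^bsub>A\<^esub> \<one>\<^bsub>A\<^esub> \<and>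
       tensor_lift A A A (\<lambda>a b. a \<otimes>\<^bsub>A\<^esub> S b) (comult A x) = counit A x \<odot>\<^bsub>A\<^esub> \<one>\<^bsub>A\<^esub>)"

definition antipode :: "('a, 'm) hopf_alg_scheme \<Rightarrow> 'a \<Rightarrow> 'a"
  where "antipode A = (THE S. is_antipode A S)"

definition hopf_star_algebra :: "('a, 'm) hopf_alg_scheme \<Rightarrow> bool"
  where "hopf_star_algebra A \<longleftrightarrow> complex_star_algebra A \<and>
    comult A \<in> star_homs A (tensor_alg A A) \<and>
    (\<forall>x\<in>carrier A.
       tensor_assoc A A A (tensor_map A A (tensor_alg A A) A (comult A) (\<lambda>y. y) (comult A x)) =
       tensor_map A A A (tensor_alg A A) (\<lambda>y. y) (comult A) (comult A x)) \<and>
    (\<exists>\<epsilon>. is_counit A \<epsilon> \<and> \<epsilon> \<one>\<^bsub>A\<^esub> = 1 \<and>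
       (\<forall>x\<in>carrier A. \<forall>y\<in>carrier A. \<epsilon> (x \<otimes>\<^bsub>A\<^esub> y) = \<epsilon> x * \<epsilon> y)) \<and>
    (\<exists>S. is_antipode A S)"

definition unitary_corep :: "('a, 'm) hopf_alg_scheme \<Rightarrow> nat \<Rightarrow> (nat \<Rightarrow> nat \<Rightarrow> 'a) \<Rightarrow> bool"
  where "unitary_corep A n u \<longleftrightarrow>
    (\<forall>i<n. \<forall>j<n. u i j \<in> carrier A \<and>
       comult A (u i j) = (\<Oplus>\<^bsub>tensor_alg A A\<^esub>k\<in>{..<n}. tens A A (u i k) (u k j)) \<and>
       counit A (u i j) = (if i = j then 1 else 0) \<and>
       (\<Oplus>\<^bsub>A\<^esub>k\<in>{..<n}. u i k \<otimes>\<^bsub>A\<^esub> star A (u j k)) = (if i = j then \<one>\<^bsub>A\<^esub> else \<zero>\<^bsub>A\<^esub>) \<and>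
       (\<Oplus>\<^bsub>A\<^esub>k\<in>{..<n}. star A (u k i) \<otimes>\<^bsub>A\<^esub> u k j) = (if i = j then \<one>\<^bsub>A\<^esub> else \<zero>\<^bsub>A\<^esub>))"

definition cqg_algebra :: "('a, 'm) hopf_alg_scheme \<Rightarrow> bool"
  where "cqg_algebra A \<longleftrightarrow> hopf_star_algebra A \<and>
    carrier A = lin_span A {u i j | n u i j. unitary_corep A n u \<and> i < n \<and> j < n}"

definition hopf_star_iso :: "('a, 'm) hopf_alg_scheme \<Rightarrow> ('b, 'n) hopf_alg_scheme
    \<Rightarrow> ('a \<Rightarrow> 'b) \<Rightarrow> bool"
  where "hopf_star_iso A B \<phi> \<longleftrightarrow> \<phi> \<in> star_homs A B \<and> bij_betw \<phi> (carrier A) (carrier B) \<and>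
    (\<forall>x\<in>carrier A. comult B (\<phi> x) = tensor_map A A B B \<phi> \<phi> (comult A x)) \<and>
    (\<forall>x\<in>carrier A. counit B (\<phi> x) = counit A x) \<and>
    (\<forall>x\<in>carrier A. antipode B (\<phi> x) = \<phi> (antipode A x))"

text \<open>
  A compact quantum group is represented by its CQG-algebra. That both records are CQG-algebras
  is part of the assertion that they define isomorphic compact quantum groups.
\<close>

definition cqg_isomorphic :: "('a, 'm) hopf_alg_scheme \<Rightarrow> ('b, 'n) hopf_alg_scheme \<Rightarrow> bool"
    (infix \<open>\<cong>\<^sub>C\<^sub>Q\<^sub>G\<close> 50)
  where "A \<cong>\<^sub>C\<^sub>Q\<^sub>G B \<longleftrightarrow> cqg_algebra A \<and> cqg_algebra B \<and> (\<exists>\<phi>. hopf_star_iso A B \<phi>)"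


section \<open>Constructions of Hopf $*$-algebras\<close>

definition hopf_tensor :: "('a, 'm) hopf_alg_scheme \<Rightarrow> ('b, 'n) hopf_alg_scheme
    \<Rightarrow> ('a \<times> 'b \<Rightarrow>\<^sub>0 complex) set hopf_alg"
  where "hopf_tensor A B = with_comult (tensor_alg A B)
    (\<lambda>z. middle_swap A B
      (tensor_map A B (tensor_alg A A) (tensor_alg B B) (comult A) (comult B) z))"

text \<open>
  The restricted coproduct takes values in the tensor square of the subalgebra, which embeds into
  the tensor square of the ambient algebra.
\<close>

definition hopf_sub :: "('a, 'm) hopf_alg_scheme \<Rightarrow> 'a set \<Rightarrow> 'a hopf_alg"
  where "hopf_sub A T = (let B = A\<lparr>carrier := T\<rparr> in with_comult B
    (\<lambda>x. THE t. t \<in> carrier (tensor_alg B B) \<and>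
       tensor_map B B A A (\<lambda>y. y) (\<lambda>y. y) t = comult A x))"

definition hopf_star_ideal :: "('a, 'm) hopf_alg_scheme \<Rightarrow> 'a set \<Rightarrow> bool"
  where "hopf_star_ideal A I \<longleftrightarrow> star_ideal A I \<and>
    (\<forall>x\<in>I. comult A x \<in> lin_span (tensor_alg A A)
       ({tens A A y z | y z. y \<in> I \<and> z \<in> carrier A} \<union>
        {tens A A y z | y z. y \<in> carrier A \<and> z \<in> I})) \<and>
    (\<forall>x\<in>I. counit A x = 0) \<and> (\<forall>x\<in>I. antipode A x \<in> I)"

text \<open>
  An intersection of Hopf $*$-ideals need not be a Hopf $*$-ideal. It is one (and the least one
  containing \<open>S\<close>) whenever the $*$-ideal generated by \<open>S\<close> is a Hopf $*$-ideal.
\<close>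

definition hopf_star_ideal_gen :: "('a, 'm) hopf_alg_scheme \<Rightarrow> 'a set \<Rightarrow> 'a set"
  where "hopf_star_ideal_gen A S = \<Inter>{I. hopf_star_ideal A I \<and> S \<subseteq> I}"

definition hopf_quot :: "('a, 'm) hopf_alg_scheme \<Rightarrow> 'a set \<Rightarrow> 'a set hopf_alg"
  where "hopf_quot A I = (let Q = quot_alg A I; \<pi> = (\<lambda>x. I +>\<^bsub>A\<^esub> x) in with_comult Q
    (\<lambda>K. the_elem ((\<lambda>x. tensor_map A A Q Q \<pi> \<pi> (comult A x)) ` K)))"


section \<open>The quantum groups\<close>

text \<open>$\mathbb{C}[\Gamma]$, the CQG-algebra of the dual of a discrete group.\<close>

definition dual_hopf :: "('g, 'm) monoid_scheme \<Rightarrow> ('g \<Rightarrow>\<^sub>0 complex) hopf_alg"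
  where "dual_hopf G = (let C = monoid_alg G (m_inv G); P = tensor_alg C C in with_comult C
    (\<lambda>f. \<Oplus>\<^bsub>P\<^esub>g\<in>Poly_Mapping.keys f. Poly_Mapping.lookup f g \<odot>\<^bsub>P\<^esub>
       tens C C (Poly_Mapping.single g 1) (Poly_Mapping.single g 1)))"

text \<open>The letter \<open>(i, j, g)\<close> stands for the generator $a_{ij}(g)$.\<close>

definition H_free :: "nat \<Rightarrow> ('g, 'm) monoid_scheme
    \<Rightarrow> (((nat \<times> nat \<times> 'g) \<times> bool) list \<Rightarrow>\<^sub>0 complex) star_alg"
  where "H_free N G = free_star_alg ({1..N} \<times> {1..N} \<times> carrier G)"

definition H_relators :: "nat \<Rightarrow> ('g, 'm) monoid_scheme
    \<Rightarrow> (((nat \<times> nat \<times> 'g) \<times> bool) list \<Rightarrow>\<^sub>0 complex) set"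
  where "H_relators N G = (let F = H_free N G in
    {star F (letter (i, j, g)) - letter (i, j, inv\<^bsub>G\<^esub> g) | i j g.
       i \<in> {1..N} \<and> j \<in> {1..N} \<and> g \<in> carrier G} \<union>
    {letter (i, j, g) \<otimes>\<^bsub>F\<^esub> letter (i, k, h) - (if j = k then letter (i, j, g \<otimes>\<^bsub>G\<^esub> h) else 0) | i j k g h.
       i \<in> {1..N} \<and> j \<in> {1..N} \<and> k \<in> {1..N} \<and> g \<in> carrier G \<and> h \<in> carrier G} \<union>
    {letter (j, i, g) \<otimes>\<^bsub>F\<^esub> letter (k, i, h) - (if j = k then letter (j, i, g \<otimes>\<^bsub>G\<^esub> h) else 0) | i j k g h.
       i \<in> {1..N} \<and> j \<in> {1..N} \<and> k \<in> {1..N} \<and> g \<in> carrier G \<and> h \<in> carrier G} \<union>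
    {(\<Sum>k\<in>{1..N}. letter (i, k, \<one>\<^bsub>G\<^esub>)) - \<one>\<^bsub>F\<^esub> | i. i \<in> {1..N}} \<union>
    {(\<Sum>k\<in>{1..N}. letter (k, j, \<one>\<^bsub>G\<^esub>)) - \<one>\<^bsub>F\<^esub> | j. j \<in> {1..N}})"

definition H_ideal :: "nat \<Rightarrow> ('g, 'm) monoid_scheme
    \<Rightarrow> (((nat \<times> nat \<times> 'g) \<times> bool) list \<Rightarrow>\<^sub>0 complex) set"
  where "H_ideal N G = star_ideal_gen (H_free N G) (H_relators N G)"

definition H_gen :: "nat \<Rightarrow> ('g, 'm) monoid_scheme \<Rightarrow> nat \<Rightarrow> nat \<Rightarrow> 'g
    \<Rightarrow> (((nat \<times> nat \<times> 'g) \<times> bool) list \<Rightarrow>\<^sub>0 complex) set"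
  where "H_gen N G i j g = H_ideal N G +>\<^bsub>H_free N G\<^esub> letter (i, j, g)"

text \<open>$\mathcal{O}(H_N^+(\Gamma))$\<close>

definition H_plus :: "nat \<Rightarrow> ('g, 'm) monoid_scheme
    \<Rightarrow> (((nat \<times> nat \<times> 'g) \<times> bool) list \<Rightarrow>\<^sub>0 complex) set hopf_alg"
  where "H_plus N G = (let A = quot_alg (H_free N G) (H_ideal N G); P = tensor_alg A A in
    with_comult A (THE \<Delta>. \<Delta> \<in> star_homs A P \<inter> extensional (carrier A) \<and>
      (\<forall>i\<in>{1..N}. \<forall>j\<in>{1..N}. \<forall>g\<in>carrier G.
         \<Delta> (H_gen N G i j g) =
           (\<Oplus>\<^bsub>P\<^esub>k\<in>{1..N}. tens A A (H_gen N G i k g) (H_gen N G k j g)))))"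

text \<open>$\mathcal{O}(H_N^+(\Gamma,\Lambda))$\<close>

definition H_plus_rel :: "nat \<Rightarrow> ('g, 'm) monoid_scheme \<Rightarrow> 'g set
    \<Rightarrow> (((nat \<times> nat \<times> 'g) \<times> bool) list \<Rightarrow>\<^sub>0 complex) set set hopf_alg"
  where "H_plus_rel N G L = (let A = H_plus N G in hopf_quot A (hopf_star_ideal_gen A
    {(\<Oplus>\<^bsub>A\<^esub>k\<in>{1..N}. H_gen N G i k g) \<ominus>\<^bsub>A\<^esub> (\<Oplus>\<^bsub>A\<^esub>k\<in>{1..N}. H_gen N G j k g) | i j g.
       i \<in> {1..N} \<and> j \<in> {1..N} \<and> g \<in> L}))"

text \<open>$\mathcal{O}(H_N^+(\Gamma/\Lambda)\,\widetilde{\times}\,\widehat{\Gamma})$\<close>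

definition glued_product :: "nat \<Rightarrow> ('g, 'm) monoid_scheme \<Rightarrow> 'g set
    \<Rightarrow> ((((nat \<times> nat \<times> 'g set) \<times> bool) list \<Rightarrow>\<^sub>0 complex) set \<times> ('g \<Rightarrow>\<^sub>0 complex)
         \<Rightarrow>\<^sub>0 complex) set hopf_alg"
  where "glued_product N G L =
    (let A = H_plus N (G Mod L); C = dual_hopf G; E = hopf_tensor A C in
     hopf_sub E (star_subalgebra_gen E
       {tens A C (H_gen N (G Mod L) i j (L #>\<^bsub>G\<^esub> g)) (Poly_Mapping.single g 1) | i j g.
          i \<in> {1..N} \<and> j \<in> {1..N} \<and> g \<in> carrier G}))"

end

theory Submission
  imports Defs
begin

text \<open>
  Write \<open>A\<close> for $\mathcal{O}(H_N^+(\Gamma,\Lambda))$ and, for $g \in \Lambda$, let \<open>row g\<close> be the row sum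
  $\sum_k a_{ik}(g)$ in \<open>A\<close>, which does not depend on $i$. The relations give
  $\mathrm{row}(g)\, a_{ij}(h) = a_{ij}(gh) = a_{ij}(h)\, \mathrm{row}(g)$, so the row sums form a central
  unitary representation of $\Lambda$. The homomorphism $\varphi : a_{ij}(g) \mapsto a_{ij}([g]) \otimes g$ maps
  \<open>A\<close> onto the glued product. To see that it is injective, let $D$ be the quotient of $A \otimes \mathbb{C}[\Gamma]$ in which
  \<open>row g\<close> is identified with $g$ for $g \in \Lambda$. In $D$ the element $a_{ij}(g) \otimes g^{-1}$ depends only on
  $[g]$, which yields a homomorphism from $\mathcal{O}(H_N^+(\Gamma/\Lambda))$ to $D$. Multiplying by the second
  leg and applying $x \otimes g \mapsto x\, \mathrm{row}(g)$ for $g \in \Lambda$, $x \otimes g \mapsto 0$ otherwise,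
  gives a linear left inverse of $\varphi$ on the whole tensor product; it also determines the restricted coproduct.

  The Hopf algebra axioms are linear identities, and the algebras involved are spanned by the entries of
  tensor products of the unitary matrices $(a_{ij}(g))_{ij}$. On such entries every axiom is immediate.
\<close>

section \<open>Complex star algebras and linear maps\<close>

text \<open>The map that sends g to row(g) on \<Lambda> and to 0 elsewhere is linear but in general
  not multiplicative. If D were defined by the ideal generated by the elements row(g) \<otimes>
  g^{-1} - 1, one would have to show separately that x \<otimes> c |-> x \<chi>(c) kills that ideal.
  The construction runs the other way: \<open>K0\<close> is the largest ideal inside the kernel of
  this evaluation, which therefore descends at once, and what has to be checked is that row(g)
  \<otimes> g^{-1} - 1 lies in \<open>K0\<close>. This holds because row(g) is central, C[\<Gamma>]
  is commutative and \<chi> is linear over C[\<Lambda>].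

  A left inverse on the image of \<open>\<phi>\<close> alone would not be enough. The coproduct of
  the glued product is a definite description, whose uniqueness needs the tensor square of the
  subalgebra to embed into that of the ambient algebra; a linear retraction of the whole ambient
  algebra gives this without bases or flatness. Tensor lifts, counits and antipodes are definite
  descriptions as well, so each existence proof is paired with one of uniqueness.\<close>

lemma CC_simps [simp]:
  "carrier CC = UNIV" "x \<oplus>\<^bsub>CC\<^esub> y = x + y" "x \<otimes>\<^bsub>CC\<^esub> y = x * y" "\<one>\<^bsub>CC\<^esub> = 1" "\<zero>\<^bsub>CC\<^esub> = 0"
  by (simp_all add: ring_of_type_algebra_def)

locale csa =
  fixes A :: "('a, 'm) star_alg_scheme" (structure)
  assumes csa: "complex_star_algebra A"

sublocale csa \<subseteq> ring A
  using csa by (simp add: complex_star_algebra_def)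

context csa
begin

lemma mod: "module CC A"
  using csa by (simp add: complex_star_algebra_def)

lemma smult_closed [simp, intro]: "x \<in> carrier A \<Longrightarrow> c \<odot> x \<in> carrier A"
  using module.smult_closed[OF mod] by simp

lemma smult_add: "x \<in> carrier A \<Longrightarrow> y \<in> carrier A \<Longrightarrow> c \<odot> (x \<oplus> y) = c \<odot> x \<oplus> c \<odot> y"
  using module.smult_r_distr[OF mod] by simp

lemma add_smult: "x \<in> carrier A \<Longrightarrow> (c + d) \<odot> x = c \<odot> x \<oplus> d \<odot> x"
  using module.smult_l_distr[OF mod] by simp

lemma smult_smult: "x \<in> carrier A \<Longrightarrow> c \<odot> (d \<odot> x) = (c * d) \<odot> x"
  using module.smult_assoc1[OF mod] by simp

lemma smult_1 [simp]: "x \<in> carrier A \<Longrightarrow> 1 \<odot> x = x"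
  using module.smult_one[OF mod] by simp

lemma smult_0 [simp]: "x \<in> carrier A \<Longrightarrow> 0 \<odot> x = \<zero>"
  using module.smult_l_null[OF mod] by simp

lemma smult_zero [simp]: "c \<odot> \<zero> = \<zero>"
  using module.smult_r_null[OF mod] by simp

lemma uminus_smult: "x \<in> carrier A \<Longrightarrow> \<ominus> x = (-1) \<odot> x"
  using add_smult[of x 1 "-1"] by (simp add: minus_equality a_comm)

lemma smult_mult_l: "x \<in> carrier A \<Longrightarrow> y \<in> carrier A \<Longrightarrow> (c \<odot> x) \<otimes> y = c \<odot> (x \<otimes> y)"
  and smult_mult_r: "x \<in> carrier A \<Longrightarrow> y \<in> carrier A \<Longrightarrow> x \<otimes> (c \<odot> y) = c \<odot> (x \<otimes> y)"
  and star_closed [simp, intro]: "x \<in> carrier A \<Longrightarrow> star A x \<in> carrier A"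
  and star_star [simp]: "x \<in> carrier A \<Longrightarrow> star A (star A x) = x"
  and star_add: "x \<in> carrier A \<Longrightarrow> y \<in> carrier A \<Longrightarrow> star A (x \<oplus> y) = star A x \<oplus> star A y"
  and star_smult: "x \<in> carrier A \<Longrightarrow> star A (c \<odot> x) = cnj c \<odot> star A x"
  and star_mult: "x \<in> carrier A \<Longrightarrow> y \<in> carrier A \<Longrightarrow> star A (x \<otimes> y) = star A y \<otimes> star A x"
  using csa by (auto simp add: complex_star_algebra_def)

lemma star_one [simp]: "star A \<one> = \<one>"
  using star_mult[of "star A \<one>" \<one>] by simp

lemma star_zero [simp]: "star A \<zero> = \<zero>"
  using star_smult[of \<zero> 0] by simp

lemma star_uminus: "x \<in> carrier A \<Longrightarrow> star A (\<ominus> x) = \<ominus> star A x"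
  by (simp add: uminus_smult star_smult)

text \<open>Negatives are multiples by -1, so the group part of the definition reduces to closure
  under sums and scalars.\<close>

lemma submodule_iff:
  "submodule U CC A \<longleftrightarrow> U \<subseteq> carrier A \<and> \<zero> \<in> U \<and> (\<forall>x\<in>U. \<forall>y\<in>U. x \<oplus> y \<in> U) \<and> (\<forall>c. \<forall>x\<in>U. c \<odot> x \<in> U)"
  (is "_ \<longleftrightarrow> ?R")
proof
  assume U: "submodule U CC A"
  note E = module.submoduleE[OF mod U]
  obtain x where "x \<in> U" using E(2) by auto
  then have "\<zero> \<in> U" using E(1) E(4)[of 0 x] by auto
  then show ?R using E by auto
next
  assume R: ?R
  show "submodule U CC A"
  proof (rule module.submoduleI[OF mod])
    show "\<ominus> a \<in> U" if "a \<in> U" for a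
      using R that uminus_smult[of a] by (auto simp: subset_iff)
  qed (use R in auto)
qed

lemma submodule_carrier: "submodule (carrier A) CC A"
  by (simp add: submodule_iff)

lemma finsum_smult:
  "finite S \<Longrightarrow> f \<in> S \<rightarrow> carrier A \<Longrightarrow> c \<odot> (\<Oplus>i\<in>S. f i) = (\<Oplus>i\<in>S. c \<odot> f i)"
  using module.finsum_smult_ldistr[OF mod] by simp

text \<open>Serves as the induction principle for spans: a property that cuts out a subspace holds
  on a span as soon as it holds on the spanning set. Most later arguments write down the subspace
  and apply this rule.\<close>

lemma lin_span_mono_submodule: "submodule U CC A \<Longrightarrow> S \<subseteq> U \<Longrightarrow> lin_span A S \<subseteq> U"
  by (auto simp: lin_span_def)

lemma lin_span_submodule:
  assumes "S \<subseteq> carrier A"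
  shows "submodule (lin_span A S) CC A"
  unfolding submodule_iff
proof (intro conjI ballI allI)
  show "lin_span A S \<subseteq> carrier A"
    using lin_span_mono_submodule[OF submodule_carrier assms] .
qed (auto simp: lin_span_def submodule_iff)

lemma lin_span_superset: "S \<subseteq> lin_span A S"
  by (auto simp: lin_span_def)

lemma idealI_smult:
  assumes "I \<subseteq> carrier A" "\<zero> \<in> I" "\<And>x y. x \<in> I \<Longrightarrow> y \<in> I \<Longrightarrow> x \<oplus> y \<in> I"
    "\<And>c x. x \<in> I \<Longrightarrow> c \<odot> x \<in> I"
    "\<And>x y. x \<in> I \<Longrightarrow> y \<in> carrier A \<Longrightarrow> y \<otimes> x \<in> I" "\<And>x y. x \<in> I \<Longrightarrow> y \<in> carrier A \<Longrightarrow> x \<otimes> y \<in> I"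
  shows "ideal I A"
proof -
  have "submodule I CC A" using assms by (auto simp: submodule_iff)
  then have "subgroup I (add_monoid A)" by (simp add: submodule_def)
  then show ?thesis
    by (rule idealI[OF ring_axioms]) (rule assms; assumption)+
qed

text \<open>A two-sided ideal of the ring is automatically a subspace, because a scalar multiple of
  \<open>x\<close> is the product of a multiple of the unit with \<open>x\<close>.\<close>

lemma ideal_facts:
  assumes "ideal I A"
  shows "I \<subseteq> carrier A" "\<zero> \<in> I" "x \<in> I \<Longrightarrow> y \<in> I \<Longrightarrow> x \<oplus> y \<in> I"
    "x \<in> I \<Longrightarrow> y \<in> I \<Longrightarrow> x \<ominus> y \<in> I"
    "x \<in> I \<Longrightarrow> c \<odot> x \<in> I"
    "x \<in> I \<Longrightarrow> y \<in> carrier A \<Longrightarrow> y \<otimes> x \<in> I" "x \<in> I \<Longrightarrow> y \<in> carrier A \<Longrightarrow> x \<otimes> y \<in> I"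
proof -
  interpret I: ideal I A by fact
  show 1: "I \<subseteq> carrier A" by (rule I.a_subset)
  show "\<zero> \<in> I" "x \<in> I \<Longrightarrow> y \<in> I \<Longrightarrow> x \<oplus> y \<in> I" by auto
  show "x \<in> I \<Longrightarrow> y \<in> I \<Longrightarrow> x \<ominus> y \<in> I"
    by (simp add: a_minus_def)
  show "x \<in> I \<Longrightarrow> y \<in> carrier A \<Longrightarrow> y \<otimes> x \<in> I" "x \<in> I \<Longrightarrow> y \<in> carrier A \<Longrightarrow> x \<otimes> y \<in> I"
    by (auto intro: I.I_l_closed I.I_r_closed)
  show "c \<odot> x \<in> I" if "x \<in> I"
  proof -
    have "c \<odot> x = (c \<odot> \<one>) \<otimes> x" using that 1 by (subst smult_mult_l) auto
    then show ?thesis using that by (simp add: I.I_l_closed)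
  qed
qed

end

lemma star_ideal_gen_least: "star_ideal A I \<Longrightarrow> S \<subseteq> I \<Longrightarrow> star_ideal_gen A S \<subseteq> I"
  by (auto simp: star_ideal_gen_def)

lemma star_ideal_gen_superset: "S \<subseteq> star_ideal_gen A S"
  by (auto simp: star_ideal_gen_def)

lemma (in csa) star_ideal_carrier: "star_ideal A (carrier A)"
  by (auto simp: star_ideal_def oneideal)

lemma (in csa) star_ideal_star_ideal_gen:
  assumes "S \<subseteq> carrier A"
  shows "star_ideal A (star_ideal_gen A S)"
proof -
  let ?J = "{I. star_ideal A I \<and> S \<subseteq> I}"
  have J: "carrier A \<in> ?J" using assms star_ideal_carrier by simp
  have id: "ideal I A" if "I \<in> ?J" for I using that by (simp add: star_ideal_def)
  have "ideal (\<Inter> ?J) A"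
  proof (rule idealI_smult)
    show "\<Inter> ?J \<subseteq> carrier A" using J by blast
    show "\<zero> \<in> \<Inter> ?J" using ideal_facts(2)[OF id] by blast
    show "x \<oplus> y \<in> \<Inter> ?J" if "x \<in> \<Inter> ?J" "y \<in> \<Inter> ?J" for x y
      using that ideal_facts(3)[OF id] by blast
    show "c \<odot> x \<in> \<Inter> ?J" if "x \<in> \<Inter> ?J" for c x
      using that ideal_facts(5)[OF id] by blast
    show "y \<otimes> x \<in> \<Inter> ?J" if "x \<in> \<Inter> ?J" "y \<in> carrier A" for x y
      using that ideal_facts(6)[OF id] by blast
    show "x \<otimes> y \<in> \<Inter> ?J" if "x \<in> \<Inter> ?J" "y \<in> carrier A" for x y
      using that ideal_facts(7)[OF id] by blast
  qed
  then show ?thesis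
    by (auto simp: star_ideal_def star_ideal_gen_def)
qed

lemma lin_mapsI:
  assumes "\<And>x. x \<in> carrier A \<Longrightarrow> f x \<in> carrier B"
    "\<And>x y. x \<in> carrier A \<Longrightarrow> y \<in> carrier A \<Longrightarrow> f (x \<oplus>\<^bsub>A\<^esub> y) = f x \<oplus>\<^bsub>B\<^esub> f y"
    "\<And>c x. x \<in> carrier A \<Longrightarrow> f (c \<odot>\<^bsub>A\<^esub> x) = c \<odot>\<^bsub>B\<^esub> f x"
  shows "f \<in> lin_maps A B"
  using assms by (auto simp: lin_maps_def)

lemma lin_mapsD:
  assumes "f \<in> lin_maps A B"
  shows "x \<in> carrier A \<Longrightarrow> f x \<in> carrier B"
    "x \<in> carrier A \<Longrightarrow> y \<in> carrier A \<Longrightarrow> f (x \<oplus>\<^bsub>A\<^esub> y) = f x \<oplus>\<^bsub>B\<^esub> f y"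
    "x \<in> carrier A \<Longrightarrow> f (c \<odot>\<^bsub>A\<^esub> x) = c \<odot>\<^bsub>B\<^esub> f x"
  using assms by (auto simp: lin_maps_def)

lemma lin_maps_zero:
  assumes "csa A" "csa B" "f \<in> lin_maps A B"
  shows "f \<zero>\<^bsub>A\<^esub> = \<zero>\<^bsub>B\<^esub>"
proof -
  interpret A: csa A by fact
  interpret B: csa B by fact
  have "f (0 \<odot>\<^bsub>A\<^esub> \<zero>\<^bsub>A\<^esub>) = 0 \<odot>\<^bsub>B\<^esub> f \<zero>\<^bsub>A\<^esub>"
    using assms(3) by (simp only: lin_mapsD A.zero_closed)
  then show ?thesis using assms(3) by (simp add: lin_mapsD)
qed

lemma lin_maps_minus:
  assumes "csa A" "csa B" "f \<in> lin_maps A B" "x \<in> carrier A" "y \<in> carrier A"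
  shows "f (x \<ominus>\<^bsub>A\<^esub> y) = f x \<ominus>\<^bsub>B\<^esub> f y"
proof -
  interpret A: csa A by fact
  interpret B: csa B by fact
  show ?thesis using assms(3-5)
    by (simp add: A.uminus_smult B.uminus_smult lin_mapsD[OF assms(3)] a_minus_def)
qed

lemma lin_maps_finsum:
  assumes "csa A" "csa B" "f \<in> lin_maps A B" "finite S" "\<And>i. i \<in> S \<Longrightarrow> g i \<in> carrier A"
  shows "f (\<Oplus>\<^bsub>A\<^esub>i\<in>S. g i) = (\<Oplus>\<^bsub>B\<^esub>i\<in>S. f (g i))"
proof -
  interpret A: csa A by fact
  interpret B: csa B by fact
  show ?thesis using assms(4,5)
  proof (induction S rule: finite_induct)
    case empty
    then show ?case using lin_maps_zero assms by simp
  next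
    case (insert x F)
    have "f (\<Oplus>\<^bsub>A\<^esub>i\<in>insert x F. g i) = f (g x) \<oplus>\<^bsub>B\<^esub> f (\<Oplus>\<^bsub>A\<^esub>i\<in>F. g i)"
    proof -
      have F: "g \<in> F \<rightarrow> carrier A" and x: "g x \<in> carrier A" using insert by auto
      show ?thesis
        using A.finsum_insert[OF insert(1,2) F x] lin_mapsD(2)[OF assms(3) x A.finsum_closed[OF F]] by simp
    qed
    also have "\<dots> = (\<Oplus>\<^bsub>B\<^esub>i\<in>insert x F. f (g i))"
      using insert lin_mapsD(1)[OF assms(3)] by (subst B.finsum_insert) auto
    finally show ?case .
  qed
qed

lemma lin_maps_comp: "f \<in> lin_maps A B \<Longrightarrow> g \<in> lin_maps B C \<Longrightarrow> (\<lambda>x. g (f x)) \<in> lin_maps A C"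
  by (rule lin_mapsI) (simp_all add: lin_mapsD)

lemma lin_maps_id: "(\<lambda>x. x) \<in> lin_maps A A"
  by (auto simp: lin_maps_def)

lemma star_homsI:
  assumes "f \<in> lin_maps A B"
    "\<And>x y. x \<in> carrier A \<Longrightarrow> y \<in> carrier A \<Longrightarrow> f (x \<otimes>\<^bsub>A\<^esub> y) = f x \<otimes>\<^bsub>B\<^esub> f y"
    "f \<one>\<^bsub>A\<^esub> = \<one>\<^bsub>B\<^esub>" "\<And>x. x \<in> carrier A \<Longrightarrow> f (star A x) = star B (f x)"
  shows "f \<in> star_homs A B"
  using assms by (auto simp: star_homs_def lin_maps_def ring_hom_def)

lemma star_homsD:
  assumes "f \<in> star_homs A B"
  shows "f \<in> lin_maps A B" "x \<in> carrier A \<Longrightarrow> f x \<in> carrier B"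
    "x \<in> carrier A \<Longrightarrow> y \<in> carrier A \<Longrightarrow> f (x \<oplus>\<^bsub>A\<^esub> y) = f x \<oplus>\<^bsub>B\<^esub> f y"
    "x \<in> carrier A \<Longrightarrow> f (c \<odot>\<^bsub>A\<^esub> x) = c \<odot>\<^bsub>B\<^esub> f x"
    "x \<in> carrier A \<Longrightarrow> y \<in> carrier A \<Longrightarrow> f (x \<otimes>\<^bsub>A\<^esub> y) = f x \<otimes>\<^bsub>B\<^esub> f y"
    "f \<one>\<^bsub>A\<^esub> = \<one>\<^bsub>B\<^esub>" "x \<in> carrier A \<Longrightarrow> f (star A x) = star B (f x)"
  using assms by (auto simp: star_homs_def lin_maps_def ring_hom_def)

lemma star_homs_comp: "f \<in> star_homs A B \<Longrightarrow> g \<in> star_homs B C \<Longrightarrow> (\<lambda>x. g (f x)) \<in> star_homs A C"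
  by (rule star_homsI) (auto simp: star_homsD(2-) intro: lin_maps_comp star_homsD(1))

text \<open>Together with \<open>star_ideal_gen_least\<close> this shows that a homomorphism killing
  a set of relators kills the whole star ideal generated by them.\<close>

lemma star_homs_kernel:
  assumes "csa A" "csa B" "f \<in> star_homs A B"
  shows "star_ideal A {x \<in> carrier A. f x = \<zero>\<^bsub>B\<^esub>}"
proof -
  interpret A: csa A by fact
  interpret B: csa B by fact
  show ?thesis unfolding star_ideal_def
    by (intro conjI A.idealI_smult)
      (auto simp: star_homsD[OF assms(3)] lin_maps_zero[OF assms(1,2) star_homsD(1)[OF assms(3)]])
qed

text \<open>Lets a condition of the form \<open>f x \<in> J\<close> be checked on the generators of
  a star ideal; it is applied to the coproduct and to the antipode.\<close>

lemma star_homs_preimage: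
  assumes "csa A" "csa B" "f \<in> star_homs A B" "star_ideal B J"
  shows "star_ideal A {x \<in> carrier A. f x \<in> J}"
proof -
  interpret A: csa A by fact
  interpret B: csa B by fact
  have J: "ideal J B" using assms(4) by (simp add: star_ideal_def)
  show ?thesis unfolding star_ideal_def
    using assms(4) B.ideal_facts[OF J]
    by (intro conjI A.idealI_smult)
      (auto simp: star_homsD[OF assms(3)] star_ideal_def
        lin_maps_zero[OF assms(1,2) star_homsD(1)[OF assms(3)]])
qed

text \<open>Additive inverses do not occur among the premises: additivity in the scalar and
  \<open>0 \<odot> x = \<zero>\<close> make \<open>(-1) \<odot> x\<close> the inverse of
  \<open>x\<close>. Later proofs address the premises by position through
  \<open>goal_cases\<close>.\<close>

lemma complex_star_algebraI:
  fixes A (structure)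
  assumes "\<And>x y. x \<in> carrier A \<Longrightarrow> y \<in> carrier A \<Longrightarrow> x \<oplus> y \<in> carrier A"
    "\<zero> \<in> carrier A" "\<one> \<in> carrier A"
    "\<And>x y. x \<in> carrier A \<Longrightarrow> y \<in> carrier A \<Longrightarrow> x \<otimes> y \<in> carrier A"
    "\<And>c x. x \<in> carrier A \<Longrightarrow> c \<odot> x \<in> carrier A"
    "\<And>x. x \<in> carrier A \<Longrightarrow> star A x \<in> carrier A"
    "\<And>x y z. x \<in> carrier A \<Longrightarrow> y \<in> carrier A \<Longrightarrow> z \<in> carrier A \<Longrightarrow> (x \<oplus> y) \<oplus> z = x \<oplus> (y \<oplus> z)"
    "\<And>x y. x \<in> carrier A \<Longrightarrow> y \<in> carrier A \<Longrightarrow> x \<oplus> y = y \<oplus> x"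
    "\<And>x. x \<in> carrier A \<Longrightarrow> \<zero> \<oplus> x = x"
    "\<And>x. x \<in> carrier A \<Longrightarrow> 0 \<odot> x = \<zero>"
    "\<And>x y z. x \<in> carrier A \<Longrightarrow> y \<in> carrier A \<Longrightarrow> z \<in> carrier A \<Longrightarrow> (x \<otimes> y) \<otimes> z = x \<otimes> (y \<otimes> z)"
    "\<And>x. x \<in> carrier A \<Longrightarrow> \<one> \<otimes> x = x" "\<And>x. x \<in> carrier A \<Longrightarrow> x \<otimes> \<one> = x"
    "\<And>x y z. x \<in> carrier A \<Longrightarrow> y \<in> carrier A \<Longrightarrow> z \<in> carrier A \<Longrightarrow> (x \<oplus> y) \<otimes> z = x \<otimes> z \<oplus> y \<otimes> z"
    "\<And>x y z. x \<in> carrier A \<Longrightarrow> y \<in> carrier A \<Longrightarrow> z \<in> carrier A \<Longrightarrow> z \<otimes> (x \<oplus> y) = z \<otimes> x \<oplus> z \<otimes> y"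
    "\<And>c x y. x \<in> carrier A \<Longrightarrow> y \<in> carrier A \<Longrightarrow> c \<odot> (x \<oplus> y) = c \<odot> x \<oplus> c \<odot> y"
    "\<And>c d x. x \<in> carrier A \<Longrightarrow> (c + d) \<odot> x = c \<odot> x \<oplus> d \<odot> x"
    "\<And>c d x. x \<in> carrier A \<Longrightarrow> (c * d) \<odot> x = c \<odot> (d \<odot> x)"
    "\<And>x. x \<in> carrier A \<Longrightarrow> 1 \<odot> x = x"
    "\<And>c x y. x \<in> carrier A \<Longrightarrow> y \<in> carrier A \<Longrightarrow> (c \<odot> x) \<otimes> y = c \<odot> (x \<otimes> y)"
    "\<And>c x y. x \<in> carrier A \<Longrightarrow> y \<in> carrier A \<Longrightarrow> x \<otimes> (c \<odot> y) = c \<odot> (x \<otimes> y)"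
    "\<And>x. x \<in> carrier A \<Longrightarrow> star A (star A x) = x"
    "\<And>x y. x \<in> carrier A \<Longrightarrow> y \<in> carrier A \<Longrightarrow> star A (x \<oplus> y) = star A x \<oplus> star A y"
    "\<And>c x. x \<in> carrier A \<Longrightarrow> star A (c \<odot> x) = cnj c \<odot> star A x"
    "\<And>x y. x \<in> carrier A \<Longrightarrow> y \<in> carrier A \<Longrightarrow> star A (x \<otimes> y) = star A y \<otimes> star A x"
  shows "complex_star_algebra A"
proof -
  have neg: "\<exists>y\<in>carrier A. y \<oplus> x = \<zero>" if x: "x \<in> carrier A" for x
  proof
    have "(-1 + 1) \<odot> x = (-1) \<odot> x \<oplus> 1 \<odot> x" by (rule assms(17)[OF x])
    then show "(-1) \<odot> x \<oplus> x = \<zero>" using assms(10,19) x by simp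
    show "(-1) \<odot> x \<in> carrier A" using x by (rule assms(5))
  qed
  have ab: "abelian_group A"
    by (rule abelian_groupI; (rule neg assms; assumption)?)
  have "ring A"
    by (rule ringI[OF ab monoidI]; rule assms; assumption)
  moreover have "module CC A"
    by (rule moduleI[OF cring_from_type_algebra ab]; unfold CC_simps; rule assms; assumption)
  ultimately show ?thesis
    unfolding complex_star_algebra_def
    apply -
    by (intro conjI ballI allI funcsetI; (assumption | (rule assms; assumption)))

qed

section \<open>Scalars, opposite algebras and subalgebras as star algebras\<close>

definition complex_alg :: "complex star_alg"
  where "complex_alg = \<lparr>carrier = UNIV, monoid.mult = (*), one = 1, ring.zero = 0, add = (+),
    module.smult = (*), star = cnj\<rparr>"

lemma complex_alg_simps [simp]:
  "carrier complex_alg = UNIV" "x \<otimes>\<^bsub>complex_alg\<^esub> y = x * y" "\<one>\<^bsub>complex_alg\<^esub> = 1"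
  "\<zero>\<^bsub>complex_alg\<^esub> = 0" "x \<oplus>\<^bsub>complex_alg\<^esub> y = x + y" "c \<odot>\<^bsub>complex_alg\<^esub> x = c * x"
  "star complex_alg x = cnj x"
  by (simp_all add: complex_alg_def)

lemma csa_complex_alg: "csa complex_alg"
  by (unfold_locales, rule complex_star_algebraI) (auto simp: algebra_simps)

text \<open>An antipode reverses products, so it is treated as a homomorphism into the opposite
  algebra and can be obtained from a universal property. The involution is kept unchanged: the
  antipodes here commute with it, as the adjoint of a generator has the same matrix indices.\<close>

definition op_alg :: "('a, 'm) star_alg_scheme \<Rightarrow> 'a star_alg"
  where "op_alg A = \<lparr>carrier = carrier A, monoid.mult = (\<lambda>x y. y \<otimes>\<^bsub>A\<^esub> x), one = \<one>\<^bsub>A\<^esub>,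
    ring.zero = \<zero>\<^bsub>A\<^esub>, add = add A, module.smult = module.smult A, star = star A\<rparr>"

lemma op_alg_simps [simp]:
  "carrier (op_alg A) = carrier A" "x \<otimes>\<^bsub>op_alg A\<^esub> y = y \<otimes>\<^bsub>A\<^esub> x" "\<one>\<^bsub>op_alg A\<^esub> = \<one>\<^bsub>A\<^esub>"
  "\<zero>\<^bsub>op_alg A\<^esub> = \<zero>\<^bsub>A\<^esub>" "add (op_alg A) = add A" "module.smult (op_alg A) = module.smult A"
  "star (op_alg A) = star A"
  by (simp_all add: op_alg_def)

lemma lin_maps_op_alg [simp]: "lin_maps A (op_alg B) = lin_maps A B" "lin_maps (op_alg A) B = lin_maps A B"
  by (simp_all add: lin_maps_def)

lemma finsum_op_alg [simp]: "finsum (op_alg A) f S = finsum A f S"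
  by (simp add: finsum_def finprod_def)

lemma csa_op_alg:
  assumes "csa A"
  shows "csa (op_alg A)"
proof -
  interpret csa A by fact
  show ?thesis
    by (unfold_locales, rule complex_star_algebraI)
      (auto simp: a_assoc a_comm a_lcomm m_assoc l_distr r_distr smult_add add_smult smult_smult
        smult_mult_l smult_mult_r star_add star_smult star_mult)
qed

lemma csa_subalgebra:
  assumes "csa A" "star_subalgebra A T"
  shows "csa (A\<lparr>carrier := T\<rparr>)"
proof -
  interpret csa A by fact
  have T: "T \<subseteq> carrier A" "\<zero>\<^bsub>A\<^esub> \<in> T" "\<one>\<^bsub>A\<^esub> \<in> T" "\<And>x y. x \<in> T \<Longrightarrow> y \<in> T \<Longrightarrow> x \<otimes>\<^bsub>A\<^esub> y \<in> T"
    "\<And>x y. x \<in> T \<Longrightarrow> y \<in> T \<Longrightarrow> x \<oplus>\<^bsub>A\<^esub> y \<in> T" "\<And>c x. x \<in> T \<Longrightarrow> c \<odot>\<^bsub>A\<^esub> x \<in> T" "\<And>x. x \<in> T \<Longrightarrow> star A x \<in> T"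
    using assms(2) subringE[of T A] by (auto simp: star_subalgebra_def submodule_iff)
  have T': "x \<in> T \<Longrightarrow> x \<in> carrier A" for x using T(1) by auto
  show ?thesis
    by (unfold_locales, rule complex_star_algebraI)
      (auto simp: T T' a_assoc m_assoc l_distr r_distr smult_add add_smult smult_smult
        smult_mult_l smult_mult_r star_add star_smult star_mult intro!: a_comm)
qed

section \<open>Monoid algebras\<close>

lemma poly_mapping_sum_single:
  fixes f :: "'a \<Rightarrow>\<^sub>0 complex"
  shows "(\<Sum>a\<in>Poly_Mapping.keys f. Poly_Mapping.single a (Poly_Mapping.lookup f a)) = f"
  by (rule poly_mapping_eqI)
    (simp add: lookup_sum lookup_single when_def sum.delta in_keys_iff)

text \<open>The coefficient in the \<open>single\<close> case is arbitrary, so scalar multiples need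
  no case of their own. The support bounds on both summands are kept in the \<open>add\<close> case
  to make closure facts available there.\<close>

lemma poly_mapping_carrier_induct [consumes 1, case_names zero single add]:
  fixes f :: "'a \<Rightarrow>\<^sub>0 complex"
  assumes f: "Poly_Mapping.keys f \<subseteq> C" and zero: "P 0"
    and single: "\<And>a c. a \<in> C \<Longrightarrow> P (Poly_Mapping.single a c)"
    and add: "\<And>f g. Poly_Mapping.keys f \<subseteq> C \<Longrightarrow> Poly_Mapping.keys g \<subseteq> C \<Longrightarrow> P f \<Longrightarrow> P g \<Longrightarrow> P (f + g)"
  shows "P f"
proof -
  have "finite F \<Longrightarrow> F \<subseteq> C \<Longrightarrow> Poly_Mapping.keys (\<Sum>a\<in>F. Poly_Mapping.single a (h a)) \<subseteq> C \<and>
      P (\<Sum>a\<in>F. Poly_Mapping.single a (h a))" for F and h :: "'a \<Rightarrow> complex"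
  proof (induction F rule: finite_induct)
    case empty
    then show ?case using zero by simp
  next
    case (insert x F)
    have "Poly_Mapping.keys (Poly_Mapping.single x (h x)) \<subseteq> C" using insert by simp
    moreover have "Poly_Mapping.keys (\<Sum>a\<in>F. Poly_Mapping.single a (h a)) \<subseteq> C"
      "P (\<Sum>a\<in>F. Poly_Mapping.single a (h a))" "P (Poly_Mapping.single x (h x))"
      using insert single by auto
    ultimately show ?case
      using insert(1,2) add keys_add[of "Poly_Mapping.single x (h x)" "\<Sum>a\<in>F. Poly_Mapping.single a (h a)"]
      by (simp add: subset_iff) blast
  qed
  from this[of "Poly_Mapping.keys f" "Poly_Mapping.lookup f"] f show ?thesis
    by (simp add: poly_mapping_sum_single)
qed

lemma lookup_map_mult: "Poly_Mapping.lookup (Poly_Mapping.map ((*) c) f) a = c * Poly_Mapping.lookup f a"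
  for c :: complex
  by (simp add: Poly_Mapping.map.rep_eq when_def)

lemma map_mult_add: "Poly_Mapping.map ((*) c) (f + g) = Poly_Mapping.map ((*) c) f + Poly_Mapping.map ((*) c) g"
  and map_mult_diff: "Poly_Mapping.map ((*) c) (f - g) = Poly_Mapping.map ((*) c) f - Poly_Mapping.map ((*) c) g"
  and map_add_mult: "Poly_Mapping.map ((*) (c + d)) f = Poly_Mapping.map ((*) c) f + Poly_Mapping.map ((*) d) f"
  and map_mult_mult: "Poly_Mapping.map ((*) (c * d)) f = Poly_Mapping.map ((*) c) (Poly_Mapping.map ((*) d) f)"
  and map_mult_0: "Poly_Mapping.map ((*) 0) f = 0"
  and map_mult_zero: "Poly_Mapping.map ((*) c) 0 = 0"
  and map_mult_1: "Poly_Mapping.map ((*) 1) f = f"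
  and map_mult_uminus: "Poly_Mapping.map ((*) (-1)) f = - f"
  for c d :: complex
  by (auto intro!: poly_mapping_eqI simp: lookup_map_mult lookup_add lookup_minus algebra_simps)

lemma keys_map_mult: "Poly_Mapping.keys (Poly_Mapping.map ((*) c) f) \<subseteq> Poly_Mapping.keys f"
  for c :: complex
  by (auto simp: in_keys_iff lookup_map_mult)

lemma carrier_monoid_alg [simp]: "f \<in> carrier (monoid_alg M s) \<longleftrightarrow> Poly_Mapping.keys f \<subseteq> carrier M"
  by (simp add: monoid_alg_def)

lemma monoid_alg_simps [simp]:
  "\<zero>\<^bsub>monoid_alg M s\<^esub> = 0" "x \<oplus>\<^bsub>monoid_alg M s\<^esub> y = x + y"
  "\<one>\<^bsub>monoid_alg M s\<^esub> = Poly_Mapping.single \<one>\<^bsub>M\<^esub> 1"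
  "c \<odot>\<^bsub>monoid_alg M s\<^esub> x = Poly_Mapping.map ((*) c) x"
  by (simp_all add: monoid_alg_def)

text \<open>The finite index sets may exceed the supports. Two elements and their sum can then be
  expanded over one common index set, which makes additivity a termwise matter.\<close>

lemma monoid_alg_mult:
  assumes "finite S" "finite T" "Poly_Mapping.keys f \<subseteq> S" "Poly_Mapping.keys g \<subseteq> T"
  shows "f \<otimes>\<^bsub>monoid_alg M s\<^esub> g = (\<Sum>a\<in>S. \<Sum>b\<in>T.
    Poly_Mapping.single (a \<otimes>\<^bsub>M\<^esub> b) (Poly_Mapping.lookup f a * Poly_Mapping.lookup g b))"
proof -
  have "f \<otimes>\<^bsub>monoid_alg M s\<^esub> g = (\<Sum>a\<in>Poly_Mapping.keys f. \<Sum>b\<in>T.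
    Poly_Mapping.single (a \<otimes>\<^bsub>M\<^esub> b) (Poly_Mapping.lookup f a * Poly_Mapping.lookup g b))"
    using assms by (simp add: monoid_alg_def) (intro sum.cong refl sum.mono_neutral_left, auto simp: in_keys_iff)
  also have "\<dots> = (\<Sum>a\<in>S. \<Sum>b\<in>T.
    Poly_Mapping.single (a \<otimes>\<^bsub>M\<^esub> b) (Poly_Mapping.lookup f a * Poly_Mapping.lookup g b))"
    using assms by (intro sum.mono_neutral_left) (auto simp: in_keys_iff)
  finally show ?thesis .
qed

lemma monoid_alg_star:
  assumes "finite S" "Poly_Mapping.keys f \<subseteq> S"
  shows "star (monoid_alg M s) f = (\<Sum>a\<in>S. Poly_Mapping.single (s a) (cnj (Poly_Mapping.lookup f a)))"
  using assms by (simp add: monoid_alg_def) (intro sum.mono_neutral_left, auto simp: in_keys_iff)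

lemma monoid_alg_mult_single [simp]:
  "Poly_Mapping.single a c \<otimes>\<^bsub>monoid_alg M s\<^esub> Poly_Mapping.single b d = Poly_Mapping.single (a \<otimes>\<^bsub>M\<^esub> b) (c * d)"
  by (subst monoid_alg_mult[of "{a}" "{b}"]) auto

lemma monoid_alg_star_single [simp]:
  "star (monoid_alg M s) (Poly_Mapping.single a c) = Poly_Mapping.single (s a) (cnj c)"
  by (subst monoid_alg_star[of "{a}"]) auto

lemma monoid_alg_add_mult: "(f + g) \<otimes>\<^bsub>monoid_alg M s\<^esub> h = f \<otimes>\<^bsub>monoid_alg M s\<^esub> h + g \<otimes>\<^bsub>monoid_alg M s\<^esub> h"
proof -
  let ?S = "Poly_Mapping.keys f \<union> Poly_Mapping.keys g"
  let ?T = "Poly_Mapping.keys h"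
  note m = monoid_alg_mult[of ?S ?T _ h M s]
  show ?thesis
    using keys_add[of f g]
    by (simp add: m lookup_add single_add ring_distribs sum.distrib)
qed

lemma monoid_alg_mult_add: "h \<otimes>\<^bsub>monoid_alg M s\<^esub> (f + g) = h \<otimes>\<^bsub>monoid_alg M s\<^esub> f + h \<otimes>\<^bsub>monoid_alg M s\<^esub> g"
proof -
  let ?S = "Poly_Mapping.keys f \<union> Poly_Mapping.keys g"
  let ?T = "Poly_Mapping.keys h"
  note m = monoid_alg_mult[of ?T ?S h _ M s]
  show ?thesis
    using keys_add[of f g]
    by (simp add: m lookup_add single_add ring_distribs sum.distrib)
qed

lemma monoid_alg_diff_mult: "(f - g) \<otimes>\<^bsub>monoid_alg M s\<^esub> h = f \<otimes>\<^bsub>monoid_alg M s\<^esub> h - g \<otimes>\<^bsub>monoid_alg M s\<^esub> h"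
  using monoid_alg_add_mult[of M s "f - g" g h] by simp

lemma monoid_alg_mult_diff: "h \<otimes>\<^bsub>monoid_alg M s\<^esub> (f - g) = h \<otimes>\<^bsub>monoid_alg M s\<^esub> f - h \<otimes>\<^bsub>monoid_alg M s\<^esub> g"
  using monoid_alg_mult_add[of M s h "f - g" g] by simp

lemma monoid_alg_star_add: "star (monoid_alg M s) (f + g) = star (monoid_alg M s) f + star (monoid_alg M s) g"
proof -
  let ?S = "Poly_Mapping.keys f \<union> Poly_Mapping.keys g"
  note m = monoid_alg_star[of ?S _ M s]
  show ?thesis
    using keys_add[of f g] by (simp add: m lookup_add single_add sum.distrib)
qed

lemma monoid_alg_star_diff: "star (monoid_alg M s) (f - g) = star (monoid_alg M s) f - star (monoid_alg M s) g"
  using monoid_alg_star_add[of M s "f - g" g] by simp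

lemma monoid_alg_mult_zero [simp]: "0 \<otimes>\<^bsub>monoid_alg M s\<^esub> f = 0" "f \<otimes>\<^bsub>monoid_alg M s\<^esub> 0 = 0"
  "star (monoid_alg M s) 0 = 0"
  by (simp_all add: monoid_alg_def)

locale star_monoid = monoid M for M :: "('a, 'm) monoid_scheme" (structure) +
  fixes s :: "'a \<Rightarrow> 'a"
  assumes s_closed [simp]: "a \<in> carrier M \<Longrightarrow> s a \<in> carrier M"
    and s_s [simp]: "a \<in> carrier M \<Longrightarrow> s (s a) = a"
    and s_mult: "a \<in> carrier M \<Longrightarrow> b \<in> carrier M \<Longrightarrow> s (a \<otimes> b) = s b \<otimes> s a"
begin

abbreviation "MA \<equiv> monoid_alg M s"

lemma keys_mult_subset:
  assumes "Poly_Mapping.keys f \<subseteq> carrier M" "Poly_Mapping.keys g \<subseteq> carrier M"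
  shows "Poly_Mapping.keys (f \<otimes>\<^bsub>MA\<^esub> g) \<subseteq> carrier M"
proof -
  have g: "Poly_Mapping.keys (Poly_Mapping.single a c \<otimes>\<^bsub>MA\<^esub> g) \<subseteq> carrier M" if "a \<in> carrier M" for a c
    using assms(2)
  proof (induction g rule: poly_mapping_carrier_induct)
    case (add f g)
    then show ?case unfolding monoid_alg_mult_add
      using keys_add[of "Poly_Mapping.single a c \<otimes>\<^bsub>MA\<^esub> f" "Poly_Mapping.single a c \<otimes>\<^bsub>MA\<^esub> g"] by blast
  qed (use that in auto)
  show ?thesis using assms(1)
  proof (induction f rule: poly_mapping_carrier_induct)
    case (add f h)
    then show ?case unfolding monoid_alg_add_mult
      using keys_add[of "f \<otimes>\<^bsub>MA\<^esub> g" "h \<otimes>\<^bsub>MA\<^esub> g"] by blast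
  qed (use g in auto)
qed

lemma keys_star_subset:
  assumes "Poly_Mapping.keys f \<subseteq> carrier M"
  shows "Poly_Mapping.keys (star MA f) \<subseteq> carrier M"
  using assms
proof (induction f rule: poly_mapping_carrier_induct)
  case (add f g)
  then show ?case unfolding monoid_alg_star_add
    using keys_add[of "star MA f" "star MA g"] by blast
qed auto

text \<open>The numbered cases are the premises of \<open>complex_star_algebraI\<close>. Each
  multilinear identity is reduced to basis elements one variable at a time, starting with the last
  factor.\<close>

lemma csa_monoid_alg: "csa MA"
proof (unfold_locales, rule complex_star_algebraI, goal_cases)
  case (1 x y)
  then show ?case using keys_add[of x y] by auto
next
  case (4 x y)
  then show ?case using keys_mult_subset by simp
next
  case (5 c x)
  then show ?case using keys_map_mult[of c x] by auto
next
  case (6 x)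
  then show ?case using keys_star_subset by simp
next
  case (11 x y z)
  have 1: "(Poly_Mapping.single a c \<otimes>\<^bsub>MA\<^esub> Poly_Mapping.single b d) \<otimes>\<^bsub>MA\<^esub> z =
      Poly_Mapping.single a c \<otimes>\<^bsub>MA\<^esub> (Poly_Mapping.single b d \<otimes>\<^bsub>MA\<^esub> z)"
    if "a \<in> carrier M" "b \<in> carrier M" for a b c d
    using 11(3)[simplified]
    by (induction z rule: poly_mapping_carrier_induct) (use that in \<open>simp_all add: m_assoc mult.assoc monoid_alg_mult_add\<close>)
  have 2: "(Poly_Mapping.single a c \<otimes>\<^bsub>MA\<^esub> y) \<otimes>\<^bsub>MA\<^esub> z = Poly_Mapping.single a c \<otimes>\<^bsub>MA\<^esub> (y \<otimes>\<^bsub>MA\<^esub> z)"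
    if "a \<in> carrier M" for a c
    using 11(2)[simplified]
    by (induction y rule: poly_mapping_carrier_induct)
      (use that 1 in \<open>simp_all add: monoid_alg_mult_add monoid_alg_add_mult\<close>)
  show ?case
    using 11(1)[simplified]
    by (induction x rule: poly_mapping_carrier_induct) (use 2 in \<open>simp_all add: monoid_alg_add_mult\<close>)
next
  case (12 x)
  then have "Poly_Mapping.keys x \<subseteq> carrier M" by simp
  then show ?case
    by (induction x rule: poly_mapping_carrier_induct) (simp_all add: monoid_alg_mult_add)
next
  case (13 x)
  then have "Poly_Mapping.keys x \<subseteq> carrier M" by simp
  then show ?case
    by (induction x rule: poly_mapping_carrier_induct) (simp_all add: monoid_alg_add_mult)
next
  case (20 c x y)
  have 1: "(c \<odot>\<^bsub>MA\<^esub> Poly_Mapping.single a d) \<otimes>\<^bsub>MA\<^esub> y = c \<odot>\<^bsub>MA\<^esub> (Poly_Mapping.single a d \<otimes>\<^bsub>MA\<^esub> y)"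
    if "a \<in> carrier M" for a d
    using 20(2)[simplified]
    by (induction y rule: poly_mapping_carrier_induct)
      (use that in \<open>simp_all add: monoid_alg_mult_add map_mult_add map_mult_zero algebra_simps\<close>)
  show ?case
    using 20(1)[simplified]
    by (induction x rule: poly_mapping_carrier_induct)
      (use 1 in \<open>simp_all add: monoid_alg_add_mult map_mult_add map_mult_zero\<close>)
next
  case (21 c x y)
  have 1: "Poly_Mapping.single a d \<otimes>\<^bsub>MA\<^esub> (c \<odot>\<^bsub>MA\<^esub> y) = c \<odot>\<^bsub>MA\<^esub> (Poly_Mapping.single a d \<otimes>\<^bsub>MA\<^esub> y)"
    if "a \<in> carrier M" for a d
    using 21(2)[simplified]
    by (induction y rule: poly_mapping_carrier_induct)
      (use that in \<open>simp_all add: monoid_alg_mult_add map_mult_add map_mult_zero algebra_simps\<close>)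
  show ?case
    using 21(1)[simplified]
    by (induction x rule: poly_mapping_carrier_induct)
      (use 1 in \<open>simp_all add: monoid_alg_add_mult map_mult_add map_mult_zero\<close>)
next
  case (22 x)
  then have "Poly_Mapping.keys x \<subseteq> carrier M" by simp
  then show ?case
    by (induction x rule: poly_mapping_carrier_induct) (simp_all add: monoid_alg_star_add)
next
  case (24 c x)
  then have "Poly_Mapping.keys x \<subseteq> carrier M" by simp
  then show ?case
    by (induction x rule: poly_mapping_carrier_induct) (simp_all add: monoid_alg_star_add map_mult_add map_mult_zero)
next
  case (25 x y)
  have 1: "star MA (Poly_Mapping.single a d \<otimes>\<^bsub>MA\<^esub> y) = star MA y \<otimes>\<^bsub>MA\<^esub> star MA (Poly_Mapping.single a d)"
    if "a \<in> carrier M" for a d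
    using 25(2)[simplified]
    by (induction y rule: poly_mapping_carrier_induct)
      (use that in \<open>simp_all add: monoid_alg_mult_add monoid_alg_add_mult monoid_alg_star_add s_mult algebra_simps\<close>)
  show ?case
    using 25(1)[simplified]
    by (induction x rule: poly_mapping_carrier_induct)
      (use 1 in \<open>simp_all add: monoid_alg_mult_add monoid_alg_add_mult monoid_alg_star_add\<close>)
qed (auto simp: monoid_alg_mult_add monoid_alg_add_mult monoid_alg_star_add
      map_mult_0 map_mult_1 map_mult_add map_add_mult map_mult_mult algebra_simps)

lemma minus_monoid_alg:
  assumes "Poly_Mapping.keys f \<subseteq> carrier M" "Poly_Mapping.keys g \<subseteq> carrier M"
  shows "f \<ominus>\<^bsub>MA\<^esub> g = f - g"
  using assms csa.uminus_smult[OF csa_monoid_alg, of g] by (simp add: a_minus_def map_mult_uminus)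

end

section \<open>Linear and multiplicative extension from a basis\<close>

definition lin_ext :: "('b, 'n) star_alg_scheme \<Rightarrow> ('a \<Rightarrow> 'b) \<Rightarrow> ('a \<Rightarrow>\<^sub>0 complex) \<Rightarrow> 'b"
  where "lin_ext B v f = (\<Oplus>\<^bsub>B\<^esub>a\<in>Poly_Mapping.keys f. Poly_Mapping.lookup f a \<odot>\<^bsub>B\<^esub> v a)"

lemma lin_ext_superset:
  assumes "csa B" "v \<in> S \<rightarrow> carrier B" "finite S" "Poly_Mapping.keys f \<subseteq> S"
  shows "lin_ext B v f = (\<Oplus>\<^bsub>B\<^esub>a\<in>S. Poly_Mapping.lookup f a \<odot>\<^bsub>B\<^esub> v a)"
proof -
  interpret B: csa B by fact
  show ?thesis unfolding lin_ext_def
    using assms(2-) by (intro B.add.finprod_mono_neutral_cong_left) (auto simp: in_keys_iff Pi_iff)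
qed

lemma lin_ext_lin:
  assumes B: "csa B" and v: "v \<in> carrier M \<rightarrow> carrier B"
  shows "lin_ext B v \<in> lin_maps (monoid_alg M s) B"
proof (rule lin_mapsI)
  interpret B: csa B by fact
  note sup = lin_ext_superset[OF B]
  have v': "v \<in> S \<rightarrow> carrier B" if "S \<subseteq> carrier M" for S using v that by auto
  show "lin_ext B v f \<in> carrier B" if "f \<in> carrier (monoid_alg M s)" for f
    unfolding lin_ext_def using v'[of "Poly_Mapping.keys f"] that by (intro B.finsum_closed) auto
  show "lin_ext B v (f \<oplus>\<^bsub>monoid_alg M s\<^esub> g) = lin_ext B v f \<oplus>\<^bsub>B\<^esub> lin_ext B v g"
    if "f \<in> carrier (monoid_alg M s)" "g \<in> carrier (monoid_alg M s)" for f g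
  proof -
    let ?S = "Poly_Mapping.keys f \<union> Poly_Mapping.keys g"
    have S: "v \<in> ?S \<rightarrow> carrier B" using v' that by auto
    have "lin_ext B v (f + g) = (\<Oplus>\<^bsub>B\<^esub>a\<in>?S. Poly_Mapping.lookup (f + g) a \<odot>\<^bsub>B\<^esub> v a)"
      using S keys_add[of f g] by (intro sup) auto
    also have "\<dots> = (\<Oplus>\<^bsub>B\<^esub>a\<in>?S. Poly_Mapping.lookup f a \<odot>\<^bsub>B\<^esub> v a \<oplus>\<^bsub>B\<^esub> Poly_Mapping.lookup g a \<odot>\<^bsub>B\<^esub> v a)"
      using S by (intro B.finsum_cong') (auto simp: lookup_add B.add_smult Pi_iff)
    also have "\<dots> = (\<Oplus>\<^bsub>B\<^esub>a\<in>?S. Poly_Mapping.lookup f a \<odot>\<^bsub>B\<^esub> v a) \<oplus>\<^bsub>B\<^esub> (\<Oplus>\<^bsub>B\<^esub>a\<in>?S. Poly_Mapping.lookup g a \<odot>\<^bsub>B\<^esub> v a)"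
      using S by (intro B.finsum_addf) (auto simp: Pi_iff)
    also have "\<dots> = lin_ext B v f \<oplus>\<^bsub>B\<^esub> lin_ext B v g"
      using S by (subst (1 2) sup[of v ?S]) auto
    finally show ?thesis by simp
  qed
  show "lin_ext B v (c \<odot>\<^bsub>monoid_alg M s\<^esub> f) = c \<odot>\<^bsub>B\<^esub> lin_ext B v f"
    if "f \<in> carrier (monoid_alg M s)" for c f
  proof -
    let ?S = "Poly_Mapping.keys f"
    have S: "v \<in> ?S \<rightarrow> carrier B" using v' that by auto
    have "lin_ext B v (Poly_Mapping.map ((*) c) f) = (\<Oplus>\<^bsub>B\<^esub>a\<in>?S. Poly_Mapping.lookup (Poly_Mapping.map ((*) c) f) a \<odot>\<^bsub>B\<^esub> v a)"
      using S keys_map_mult[of c f] by (intro sup) auto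
    also have "\<dots> = (\<Oplus>\<^bsub>B\<^esub>a\<in>?S. c \<odot>\<^bsub>B\<^esub> (Poly_Mapping.lookup f a \<odot>\<^bsub>B\<^esub> v a))"
      using S by (intro B.finsum_cong') (auto simp: lookup_map_mult B.smult_smult Pi_iff)
    also have "\<dots> = c \<odot>\<^bsub>B\<^esub> lin_ext B v f"
      unfolding lin_ext_def using S by (intro B.finsum_smult[symmetric]) (auto simp: Pi_iff)
    finally show ?thesis by simp
  qed
qed

lemma lin_ext_single:
  assumes "csa B" "v a \<in> carrier B"
  shows "lin_ext B v (Poly_Mapping.single a c) = c \<odot>\<^bsub>B\<^esub> v a"
proof -
  interpret B: csa B by fact
  show ?thesis
    using assms by (subst lin_ext_superset[of B v "{a}"]) (auto simp: B.finsum_insert[of "{}"])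
qed

text \<open>Universal property of the monoid algebra. The identities for products and adjoints are
  additive in each variable, so they only have to be compared on basis elements.\<close>

lemma (in star_monoid) lin_ext_star_hom:
  assumes B: "csa B" and v: "v \<in> carrier M \<rightarrow> carrier B" and v1: "v \<one> = \<one>\<^bsub>B\<^esub>"
    and vm: "\<And>a b. a \<in> carrier M \<Longrightarrow> b \<in> carrier M \<Longrightarrow> v (a \<otimes> b) = v a \<otimes>\<^bsub>B\<^esub> v b"
    and vs: "\<And>a. a \<in> carrier M \<Longrightarrow> v (s a) = star B (v a)"
  shows "lin_ext B v \<in> star_homs MA B"
proof (rule star_homsI)
  interpret B: csa B by fact
  interpret MA: csa MA by (rule csa_monoid_alg)
  note lin = lin_ext_lin[OF B v, of s]
  note D = lin_mapsD[OF lin] and Z = lin_maps_zero[OF csa_monoid_alg B lin]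
  note D' = D[unfolded monoid_alg_simps] Z[unfolded monoid_alg_simps]
  have vc: "a \<in> carrier M \<Longrightarrow> v a \<in> carrier B" for a using v by auto
  note S = lin_ext_single[OF B, of v]
  show "lin_ext B v \<in> lin_maps MA B" by (rule lin)
  show "lin_ext B v \<one>\<^bsub>MA\<^esub> = \<one>\<^bsub>B\<^esub>" using S vc v1 by simp
  show "lin_ext B v (f \<otimes>\<^bsub>MA\<^esub> g) = lin_ext B v f \<otimes>\<^bsub>B\<^esub> lin_ext B v g"
    if f: "f \<in> carrier MA" and g: "g \<in> carrier MA" for f g
  proof -
    have g': "Poly_Mapping.keys g \<subseteq> carrier M" and f': "Poly_Mapping.keys f \<subseteq> carrier M" using f g by auto
    have 1: "lin_ext B v (Poly_Mapping.single a c \<otimes>\<^bsub>MA\<^esub> g) = lin_ext B v (Poly_Mapping.single a c) \<otimes>\<^bsub>B\<^esub> lin_ext B v g"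
      if a: "a \<in> carrier M" for a c
      using g'
    proof (induction g rule: poly_mapping_carrier_induct)
      case (single b d)
      then show ?case using a by (simp add: S vc vm B.smult_mult_l B.smult_mult_r B.smult_smult mult.commute)
    next
      case (add g h)
      then show ?case using a D'(1)[of "Poly_Mapping.single a c"] D'(1)[of g] D'(1)[of h]
          keys_mult_subset[of "Poly_Mapping.single a c" g] keys_mult_subset[of "Poly_Mapping.single a c" h]
        by (simp add: monoid_alg_mult_add D'(2) B.r_distr)
    next
      case zero
      show ?case using a D'(1)[of "Poly_Mapping.single a c"] by (simp add: D'(4))
    qed
    show ?thesis using f'
    proof (induction f rule: poly_mapping_carrier_induct)
      case (single b d)
      then show ?case using 1 by simp
    next
      case (add f h)
      then show ?case using D'(1)[of h] D'(1)[of g] D'(1)[of f] g' keys_mult_subset[of _ g]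
        by (simp add: monoid_alg_add_mult D'(2) B.l_distr)
    next
      case zero
      show ?case using g' D'(1)[of g] by (simp add: D'(4))
    qed
  qed
  show "lin_ext B v (star MA f) = star B (lin_ext B v f)" if "f \<in> carrier MA" for f
  proof -
    have "Poly_Mapping.keys f \<subseteq> carrier M" using that by simp
    then show ?thesis
    proof (induction f rule: poly_mapping_carrier_induct)
      case (add f g)
      then show ?case using D'(1)[of f] D'(1)[of g] keys_star_subset[of f] keys_star_subset[of g]
        by (simp add: monoid_alg_star_add D'(2) B.star_add)
    next
      case zero
      show ?case by (simp add: D'(4))
    qed (simp add: S vc vs B.star_smult)
  qed
qed

section \<open>Quotients by star ideals\<close>

locale csa_ideal = csa A for A :: "('a, 'm) star_alg_scheme" (structure) +
  fixes I
  assumes star_ideal: "star_ideal A I"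

sublocale csa_ideal \<subseteq> ideal I A
  using star_ideal by (simp add: star_ideal_def)

context csa_ideal
begin

abbreviation "Q \<equiv> quot_alg A I"

lemma coset_eq_iff:
  assumes "x \<in> carrier A" "y \<in> carrier A"
  shows "I +> x = I +> y \<longleftrightarrow> x \<ominus> y \<in> I"
  using assms a_rcos_module_minus[OF ring_axioms assms(2,1)] a_repr_independence'[of x y]
    a_repr_independenceD[of x y] by auto

lemma carrier_quot: "carrier Q = (\<lambda>x. I +> x) ` carrier A"
  by (auto simp: quot_alg_def FactRing_def A_RCOSETS_def')

lemma coset_closed [simp, intro]: "x \<in> carrier A \<Longrightarrow> I +> x \<in> carrier Q"
  by (auto simp: carrier_quot)

lemma coset_mem: "x \<in> I +> a \<Longrightarrow> a \<in> carrier A \<Longrightarrow> x \<in> carrier A \<and> I +> x = I +> a"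
  using a_repr_independence'[of x a] a_elemrcos_carrier by auto

lemma quot_add: "x \<in> carrier A \<Longrightarrow> y \<in> carrier A \<Longrightarrow> (I +> x) \<oplus>\<^bsub>Q\<^esub> (I +> y) = I +> (x \<oplus> y)"
  by (simp add: quot_alg_def FactRing_def a_rcos_sum)

lemma quot_mult: "x \<in> carrier A \<Longrightarrow> y \<in> carrier A \<Longrightarrow> (I +> x) \<otimes>\<^bsub>Q\<^esub> (I +> y) = I +> (x \<otimes> y)"
  by (simp add: quot_alg_def FactRing_def rcoset_mult_add)

lemma quot_one: "\<one>\<^bsub>Q\<^esub> = I +> \<one>"
  by (simp add: quot_alg_def FactRing_def)

lemma quot_zero: "\<zero>\<^bsub>Q\<^esub> = I +> \<zero>"
  using a_rcos_const[of \<zero>] by (simp add: quot_alg_def FactRing_def)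

text \<open>In \<open>quot_alg\<close>, scalar multiples and adjoints are unions over all
  representatives of a coset. If all representatives give the same set, the union collapses to the
  value at one of them.\<close>

lemma UN_coset:
  assumes "\<And>x. x \<in> carrier A \<Longrightarrow> I +> x = I +> a \<Longrightarrow> F x = F a" "a \<in> carrier A"
  shows "(\<Union>x\<in>I +> a. F x) = F a"
proof -
  have "F x = F a" if "x \<in> I +> a" for x using coset_mem[OF that assms(2)] assms(1) by auto
  moreover have "a \<in> I +> a" using assms(2) by (rule a_rcos_self)
  ultimately show ?thesis by blast
qed

lemma quot_smult:
  assumes a: "a \<in> carrier A"
  shows "c \<odot>\<^bsub>Q\<^esub> (I +> a) = I +> (c \<odot> a)"
proof -
  have "I +> (c \<odot> x) = I +> (c \<odot> a)" if x: "x \<in> carrier A" "I +> x = I +> a" for x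
  proof -
    have "x \<ominus> a \<in> I" using x a coset_eq_iff by blast
    then have "c \<odot> (x \<ominus> a) \<in> I" by (rule ideal_facts(5)[OF ideal_axioms])
    then have "c \<odot> x \<ominus> c \<odot> a \<in> I" using x a
      by (simp add: a_minus_def smult_add uminus_smult smult_smult mult.commute)
    then show ?thesis using x a by (subst coset_eq_iff) auto
  qed
  then show ?thesis using UN_coset[OF _ a, of "\<lambda>x. I +> (c \<odot> x)"] by (simp add: quot_alg_def)
qed

lemma quot_star:
  assumes a: "a \<in> carrier A"
  shows "star Q (I +> a) = I +> star A a"
proof -
  have "I +> star A x = I +> star A a" if x: "x \<in> carrier A" "I +> x = I +> a" for x
  proof -
    have "x \<ominus> a \<in> I" using x a coset_eq_iff by blast
    then have "star A (x \<ominus> a) \<in> I" using star_ideal by (simp add: star_ideal_def)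
    then have "star A x \<ominus> star A a \<in> I" using x a
      by (simp add: a_minus_def star_add star_uminus)
    then show ?thesis using x a by (subst coset_eq_iff) auto
  qed
  then show ?thesis using UN_coset[OF _ a, of "\<lambda>x. I +> star A x"] by (simp add: quot_alg_def)
qed

lemmas quot_simps = quot_add quot_mult quot_one quot_zero quot_smult quot_star

lemma csa_quot: "csa Q"
proof -
  show ?thesis
  proof (unfold_locales, rule complex_star_algebraI, goal_cases)
    case (8 x y)
    then show ?case by (auto simp: carrier_quot quot_add a_comm)
  qed (auto simp: carrier_quot quot_simps m_assoc a_assoc l_distr r_distr smult_add add_smult smult_smult
      smult_mult_l smult_mult_r star_add star_smult star_mult)
qed

lemma proj_star_hom: "(\<lambda>x. I +> x) \<in> star_homs A Q"
  by (rule star_homsI) (auto intro!: lin_mapsI simp: quot_simps)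

lemma proj_zero_iff: "x \<in> carrier A \<Longrightarrow> I +> x = \<zero>\<^bsub>Q\<^esub> \<longleftrightarrow> x \<in> I"
  by (simp add: quot_zero coset_eq_iff a_minus_def)

text \<open>A linear map vanishing on the ideal is constant on cosets, so \<open>the_elem\<close> of
  the image of a coset is the induced map. The coproduct of \<open>hopf_quot\<close> is written in
  the same form.\<close>

lemma quot_lift_eq:
  assumes "csa B" "f \<in> lin_maps A B" "\<And>x. x \<in> I \<Longrightarrow> f x = \<zero>\<^bsub>B\<^esub>" "a \<in> carrier A"
  shows "the_elem (f ` (I +> a)) = f a"
proof -
  interpret B: csa B by fact
  note D = lin_mapsD[OF assms(2)]
  have "f x = f a" if "x \<in> I +> a" for x
  proof -
    have x: "x \<in> carrier A" "x \<ominus> a \<in> I" using coset_mem[OF that assms(4)] coset_eq_iff assms(4) by auto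
    then have "f x \<ominus>\<^bsub>B\<^esub> f a = \<zero>\<^bsub>B\<^esub>"
      using lin_maps_minus[OF csa_axioms assms(1,2), of x a] assms(3,4) by simp
    then show ?thesis using x assms(4) D(1) by simp
  qed
  then have "f ` (I +> a) = {f a}" using a_rcos_self[OF assms(4)] by blast
  then show ?thesis by simp
qed

lemma quot_lift_lin:
  assumes "csa B" "f \<in> lin_maps A B" "\<And>x. x \<in> I \<Longrightarrow> f x = \<zero>\<^bsub>B\<^esub>"
  shows "(\<lambda>K. the_elem (f ` K)) \<in> lin_maps Q B"
  by (rule lin_mapsI)
    (auto simp: carrier_quot quot_simps quot_lift_eq[OF assms] lin_mapsD[OF assms(2)])

lemma quot_lift_star_hom:
  assumes "csa B" "f \<in> star_homs A B" "\<And>x. x \<in> I \<Longrightarrow> f x = \<zero>\<^bsub>B\<^esub>"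
  shows "(\<lambda>K. the_elem (f ` K)) \<in> star_homs Q B"
proof -
  note lin = star_homsD(1)[OF assms(2)]
  note eq = quot_lift_eq[OF assms(1) lin assms(3)]
  show ?thesis
    by (rule star_homsI[OF quot_lift_lin[OF assms(1) lin assms(3)]])
      (auto simp: carrier_quot quot_simps eq star_homsD[OF assms(2)])
qed

end

section \<open>Tensor products\<close>

definition bilin :: "('a, 'm) star_alg_scheme \<Rightarrow> ('b, 'n) star_alg_scheme \<Rightarrow> ('c, 'k) star_alg_scheme
    \<Rightarrow> ('a \<Rightarrow> 'b \<Rightarrow> 'c) \<Rightarrow> bool"
  where "bilin A B C \<beta> \<longleftrightarrow> (\<forall>a\<in>carrier A. \<beta> a \<in> lin_maps B C) \<and> (\<forall>b\<in>carrier B. (\<lambda>a. \<beta> a b) \<in> lin_maps A C)"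

lemma bilinI:
  assumes "\<And>a. a \<in> carrier A \<Longrightarrow> \<beta> a \<in> lin_maps B C"
    "\<And>b. b \<in> carrier B \<Longrightarrow> (\<lambda>a. \<beta> a b) \<in> lin_maps A C"
  shows "bilin A B C \<beta>"
  using assms by (auto simp: bilin_def)

lemma bilinD:
  assumes "bilin A B C \<beta>"
  shows "a \<in> carrier A \<Longrightarrow> \<beta> a \<in> lin_maps B C" "b \<in> carrier B \<Longrightarrow> (\<lambda>a. \<beta> a b) \<in> lin_maps A C"
    "a \<in> carrier A \<Longrightarrow> b \<in> carrier B \<Longrightarrow> \<beta> a b \<in> carrier C"
    "a \<in> carrier A \<Longrightarrow> a' \<in> carrier A \<Longrightarrow> b \<in> carrier B \<Longrightarrow> \<beta> (a \<oplus>\<^bsub>A\<^esub> a') b = \<beta> a b \<oplus>\<^bsub>C\<^esub> \<beta> a' b"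
    "a \<in> carrier A \<Longrightarrow> b \<in> carrier B \<Longrightarrow> b' \<in> carrier B \<Longrightarrow> \<beta> a (b \<oplus>\<^bsub>B\<^esub> b') = \<beta> a b \<oplus>\<^bsub>C\<^esub> \<beta> a b'"
    "a \<in> carrier A \<Longrightarrow> b \<in> carrier B \<Longrightarrow> \<beta> (c \<odot>\<^bsub>A\<^esub> a) b = c \<odot>\<^bsub>C\<^esub> \<beta> a b"
    "a \<in> carrier A \<Longrightarrow> b \<in> carrier B \<Longrightarrow> \<beta> a (c \<odot>\<^bsub>B\<^esub> b) = c \<odot>\<^bsub>C\<^esub> \<beta> a b"
  using assms by (auto simp: bilin_def lin_maps_def)

locale csa_pair = A: csa A + B: csa B for A :: "('a, 'm) star_alg_scheme" and B :: "('b, 'n) star_alg_scheme"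

context csa_pair
begin

interpretation star_monoid "A \<times>\<times> B" "map_prod (star A) (star B)"
proof (intro star_monoid.intro star_monoid_axioms.intro)
  show "Group.monoid (A \<times>\<times> B)"
    by (rule DirProd_monoid) (rule A.monoid_axioms B.monoid_axioms)+
qed (auto simp: A.star_mult B.star_mult)

abbreviation "P \<equiv> pre_tensor A B"
abbreviation "K \<equiv> tensor_kernel A B"

lemma MA_P: "MA = P"
  by (simp add: pre_tensor_def)

lemma csa_P: "csa P"
  using csa_monoid_alg by (simp add: MA_P)

lemma single_P [simp]: "a \<in> carrier A \<Longrightarrow> b \<in> carrier B \<Longrightarrow> Poly_Mapping.single (a, b) c \<in> carrier P"
  by (simp add: pre_tensor_def)

lemma diff_P: "f \<in> carrier P \<Longrightarrow> g \<in> carrier P \<Longrightarrow> f - g \<in> carrier P"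
  using keys_diff[of f g] by (auto simp: pre_tensor_def)

lemma bilinear_relators_closed: "bilinear_relators A B \<subseteq> carrier P"
  unfolding bilinear_relators_def by (auto intro!: diff_P)

lemma submodule_K: "submodule K CC P"
  unfolding tensor_kernel_def by (rule csa.lin_span_submodule[OF csa_P bilinear_relators_closed])

lemma K_closed: "K \<subseteq> carrier P" "0 \<in> K" "x \<in> K \<Longrightarrow> y \<in> K \<Longrightarrow> x + y \<in> K"
  "x \<in> K \<Longrightarrow> Poly_Mapping.map ((*) c) x \<in> K" "x \<in> K \<Longrightarrow> y \<in> K \<Longrightarrow> x - y \<in> K"
proof -
  note S = submodule_K[unfolded csa.submodule_iff[OF csa_P]]
  show 1: "K \<subseteq> carrier P" using S by blast
  show 2: "0 \<in> K" using S by (simp add: pre_tensor_def)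
  show 3: "x \<in> K \<Longrightarrow> y \<in> K \<Longrightarrow> x + y \<in> K" for x y using S by (simp add: pre_tensor_def)
  show 4: "x \<in> K \<Longrightarrow> Poly_Mapping.map ((*) c) x \<in> K" for x c using S by (simp add: pre_tensor_def)
  show "x \<in> K \<Longrightarrow> y \<in> K \<Longrightarrow> x - y \<in> K"
    using 3[of x "Poly_Mapping.map ((*) (-1)) y"] 4[of y "-1"] by (simp add: map_mult_uminus)
qed

text \<open>The relators have leading coefficient 1; these scaled forms appear when a relator is
  multiplied by a basis element with coefficient \<open>c\<close>.\<close>

lemma K_relators:
  "a \<in> carrier A \<Longrightarrow> a' \<in> carrier A \<Longrightarrow> b \<in> carrier B \<Longrightarrow>
    Poly_Mapping.single (a \<oplus>\<^bsub>A\<^esub> a', b) c - Poly_Mapping.single (a, b) c - Poly_Mapping.single (a', b) c \<in> K"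
  "a \<in> carrier A \<Longrightarrow> b \<in> carrier B \<Longrightarrow> b' \<in> carrier B \<Longrightarrow>
    Poly_Mapping.single (a, b \<oplus>\<^bsub>B\<^esub> b') c - Poly_Mapping.single (a, b) c - Poly_Mapping.single (a, b') c \<in> K"
  "a \<in> carrier A \<Longrightarrow> b \<in> carrier B \<Longrightarrow>
    Poly_Mapping.single (d \<odot>\<^bsub>A\<^esub> a, b) c - Poly_Mapping.single (a, b) (c * d) \<in> K"
  "a \<in> carrier A \<Longrightarrow> b \<in> carrier B \<Longrightarrow>
    Poly_Mapping.single (a, d \<odot>\<^bsub>B\<^esub> b) c - Poly_Mapping.single (a, b) (c * d) \<in> K"
proof -
  have *: "Poly_Mapping.map ((*) c) r \<in> K" if "r \<in> bilinear_relators A B" for r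
    using that csa.lin_span_superset[OF csa_P] K_closed(4) unfolding tensor_kernel_def by blast
  show "Poly_Mapping.single (a \<oplus>\<^bsub>A\<^esub> a', b) c - Poly_Mapping.single (a, b) c - Poly_Mapping.single (a', b) c \<in> K"
    if "a \<in> carrier A" "a' \<in> carrier A" "b \<in> carrier B"
    using *[of "Poly_Mapping.single (a \<oplus>\<^bsub>A\<^esub> a', b) 1 - Poly_Mapping.single (a, b) 1 - Poly_Mapping.single (a', b) 1"]
      that by (simp add: map_mult_diff bilinear_relators_def) blast
  show "Poly_Mapping.single (a, b \<oplus>\<^bsub>B\<^esub> b') c - Poly_Mapping.single (a, b) c - Poly_Mapping.single (a, b') c \<in> K"
    if "a \<in> carrier A" "b' \<in> carrier B" "b \<in> carrier B"
    using *[of "Poly_Mapping.single (a, b \<oplus>\<^bsub>B\<^esub> b') 1 - Poly_Mapping.single (a, b) 1 - Poly_Mapping.single (a, b') 1"]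
      that by (simp add: map_mult_diff bilinear_relators_def) blast
  show "Poly_Mapping.single (d \<odot>\<^bsub>A\<^esub> a, b) c - Poly_Mapping.single (a, b) (c * d) \<in> K"
    if "a \<in> carrier A" "b \<in> carrier B"
    using *[of "Poly_Mapping.single (d \<odot>\<^bsub>A\<^esub> a, b) 1 - Poly_Mapping.single (a, b) d"]
      that by (simp add: map_mult_diff bilinear_relators_def) blast
  show "Poly_Mapping.single (a, d \<odot>\<^bsub>B\<^esub> b) c - Poly_Mapping.single (a, b) (c * d) \<in> K"
    if "a \<in> carrier A" "b \<in> carrier B"
    using *[of "Poly_Mapping.single (a, d \<odot>\<^bsub>B\<^esub> b) 1 - Poly_Mapping.single (a, b) d"]
      that by (simp add: map_mult_diff bilinear_relators_def) blast
qed

lemma bilinear_relators_cases [consumes 1, case_names add_l add_r smult_l smult_r]: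
  assumes "r \<in> bilinear_relators A B"
  obtains a a' b where "r = Poly_Mapping.single (a \<oplus>\<^bsub>A\<^esub> a', b) 1 - Poly_Mapping.single (a, b) 1 - Poly_Mapping.single (a', b) 1"
      "a \<in> carrier A" "a' \<in> carrier A" "b \<in> carrier B"
    | a b b' where "r = Poly_Mapping.single (a, b \<oplus>\<^bsub>B\<^esub> b') 1 - Poly_Mapping.single (a, b) 1 - Poly_Mapping.single (a, b') 1"
      "a \<in> carrier A" "b \<in> carrier B" "b' \<in> carrier B"
    | a b d where "r = Poly_Mapping.single (d \<odot>\<^bsub>A\<^esub> a, b) 1 - Poly_Mapping.single (a, b) d" "a \<in> carrier A" "b \<in> carrier B"
    | a b d where "r = Poly_Mapping.single (a, d \<odot>\<^bsub>B\<^esub> b) 1 - Poly_Mapping.single (a, b) d" "a \<in> carrier A" "b \<in> carrier B"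
  using assms unfolding bilinear_relators_def by auto

lemma K_single_mult:
  assumes r: "r \<in> bilinear_relators A B" and p: "p \<in> carrier A" "q \<in> carrier B"
  shows "Poly_Mapping.single (p, q) c \<otimes>\<^bsub>MA\<^esub> r \<in> K" "r \<otimes>\<^bsub>MA\<^esub> Poly_Mapping.single (p, q) c \<in> K"
    "star MA r \<in> K"
proof -
  note K = K_relators K_relators(3)[of _ _ _ 1, simplified] K_relators(4)[of _ _ _ 1, simplified]
    K_relators(3,4)[unfolded mult.commute[of c]]
  note simps = monoid_alg_mult_diff monoid_alg_diff_mult monoid_alg_star_diff A.r_distr A.l_distr B.r_distr B.l_distr
    A.smult_mult_l A.smult_mult_r B.smult_mult_l B.smult_mult_r A.star_add B.star_add A.star_smult B.star_smult
  have "Poly_Mapping.single (p, q) c \<otimes>\<^bsub>MA\<^esub> r \<in> K \<and> r \<otimes>\<^bsub>MA\<^esub> Poly_Mapping.single (p, q) c \<in> K \<and> star MA r \<in> K"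
    using r by (cases rule: bilinear_relators_cases) (simp_all add: simps p K mult.commute[of _ c])
  then show "Poly_Mapping.single (p, q) c \<otimes>\<^bsub>MA\<^esub> r \<in> K" "r \<otimes>\<^bsub>MA\<^esub> Poly_Mapping.single (p, q) c \<in> K"
    "star MA r \<in> K" by auto
qed

text \<open>\<open>?U\<close> collects the elements whose adjoint and whose one-sided multiples all
  lie in \<open>K\<close>. It is a subspace because \<open>K\<close> is one, so only the relators
  have to be tested, and these only against basis elements.\<close>

lemma star_ideal_K: "star_ideal P K"
proof -
  interpret P: csa P by (rule csa_P)
  let ?U = "{x \<in> carrier P. star P x \<in> K \<and> (\<forall>w\<in>carrier P. w \<otimes>\<^bsub>P\<^esub> x \<in> K \<and> x \<otimes>\<^bsub>P\<^esub> w \<in> K)}"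
  have "K \<subseteq> ?U"
  proof (rule P.lin_span_mono_submodule[of _ "bilinear_relators A B", folded tensor_kernel_def])
    note S = submodule_K[unfolded P.submodule_iff]
    show "submodule ?U CC P"
      unfolding P.submodule_iff
      using S by (auto simp: P.l_distr P.r_distr P.smult_mult_l P.smult_mult_r P.star_add P.star_smult)
    show "bilinear_relators A B \<subseteq> ?U"
    proof
      fix r assume r: "r \<in> bilinear_relators A B"
      have rP: "r \<in> carrier P" using r bilinear_relators_closed by blast
      have "w \<otimes>\<^bsub>MA\<^esub> r \<in> K \<and> r \<otimes>\<^bsub>MA\<^esub> w \<in> K" if "w \<in> carrier MA" for w
      proof -
        have "Poly_Mapping.keys w \<subseteq> carrier (A \<times>\<times> B)" using that by simp
        then show ?thesis
          by (induction w rule: poly_mapping_carrier_induct)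
            (auto simp: monoid_alg_add_mult monoid_alg_mult_add K_closed K_single_mult[OF r])
      qed
      then show "r \<in> ?U" using rP K_single_mult(3)[OF r A.zero_closed B.zero_closed]
        by (simp add: MA_P)
    qed
  qed
  then show ?thesis
    unfolding star_ideal_def
    by (intro conjI P.idealI_smult)
      (use submodule_K[unfolded P.submodule_iff] in \<open>auto simp: subset_iff\<close>)
qed

interpretation PK: csa_ideal P K
  by (intro csa_ideal.intro csa_P csa_ideal_axioms.intro star_ideal_K)

abbreviation "T \<equiv> tensor_alg A B"
abbreviation "tn \<equiv> tens A B"

lemma Q_T: "quot_alg P K = T"
  by (simp add: tensor_alg_def)

lemma csa_tensor: "csa T"
  using PK.csa_quot by (simp add: Q_T)

lemma minus_P: "x \<in> carrier P \<Longrightarrow> y \<in> carrier P \<Longrightarrow> x \<ominus>\<^bsub>P\<^esub> y = x - y"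
  using minus_monoid_alg[of x y] by (simp add: pre_tensor_def)

lemma add_P: "x \<oplus>\<^bsub>P\<^esub> y = x + y"
  by (simp add: pre_tensor_def)

lemma tens_closed [simp, intro]: "a \<in> carrier A \<Longrightarrow> b \<in> carrier B \<Longrightarrow> tn a b \<in> carrier T"
  unfolding tens_def tensor_alg_def by (rule PK.coset_closed) simp

lemma tens_smult:
  assumes "a \<in> carrier A" "b \<in> carrier B"
  shows "c \<odot>\<^bsub>T\<^esub> tn a b = K +>\<^bsub>P\<^esub> Poly_Mapping.single (a, b) c"
proof -
  have "c \<odot>\<^bsub>P\<^esub> Poly_Mapping.single (a, b) 1 = Poly_Mapping.single (a, b) c"
    by (simp add: pre_tensor_def)
  then show ?thesis
    unfolding tens_def tensor_alg_def using assms by (subst PK.quot_smult) auto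
qed

lemma tens_bilin: "bilin A B T tn"
proof (intro bilinI lin_mapsI)
  show "tn a (c \<odot>\<^bsub>B\<^esub> b) = c \<odot>\<^bsub>T\<^esub> tn a b" if "a \<in> carrier A" "b \<in> carrier B" for a b c
    unfolding tens_smult[OF that] unfolding tens_def using that K_relators(4)[of a b c 1]
    by (subst PK.coset_eq_iff) (auto simp: minus_P)
  show "tn (c \<odot>\<^bsub>A\<^esub> a) b = c \<odot>\<^bsub>T\<^esub> tn a b" if "b \<in> carrier B" "a \<in> carrier A" for a b c
    unfolding tens_smult[OF that(2,1)] unfolding tens_def using that K_relators(3)[of a b c 1]
    by (subst PK.coset_eq_iff) (auto simp: minus_P)
  show "tn a (b \<oplus>\<^bsub>B\<^esub> b') = tn a b \<oplus>\<^bsub>T\<^esub> tn a b'"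
    if "a \<in> carrier A" "b \<in> carrier B" "b' \<in> carrier B" for a b b'
    unfolding tens_def tensor_alg_def using that K_relators(2)[of a b b' 1]
    by (subst PK.quot_add, simp, simp, subst PK.coset_eq_iff)
      (auto simp: minus_P PK.a_closed diff_diff_eq add_P[symmetric])
  show "tn (a \<oplus>\<^bsub>A\<^esub> a') b = tn a b \<oplus>\<^bsub>T\<^esub> tn a' b"
    if "b \<in> carrier B" "a \<in> carrier A" "a' \<in> carrier A" for a b a'
    unfolding tens_def tensor_alg_def using that K_relators(1)[of a a' b 1]
    by (subst PK.quot_add, simp, simp, subst PK.coset_eq_iff)
      (auto simp: minus_P PK.a_closed diff_diff_eq add_P[symmetric])
qed auto

lemmas tens_smult_l = bilinD(6)[OF tens_bilin]
lemma tens_mult: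
  assumes "a \<in> carrier A" "b \<in> carrier B" "a' \<in> carrier A" "b' \<in> carrier B"
  shows "tn a b \<otimes>\<^bsub>T\<^esub> tn a' b' = tn (a \<otimes>\<^bsub>A\<^esub> a') (b \<otimes>\<^bsub>B\<^esub> b')"
  unfolding tens_def tensor_alg_def using assms
  by (subst PK.quot_mult, simp, simp) (simp add: pre_tensor_def)

lemma tens_star:
  assumes "a \<in> carrier A" "b \<in> carrier B"
  shows "star T (tn a b) = tn (star A a) (star B b)"
  unfolding tens_def tensor_alg_def using assms
  by (subst PK.quot_star, simp) (simp add: pre_tensor_def)

lemma tens_one: "\<one>\<^bsub>T\<^esub> = tn \<one>\<^bsub>A\<^esub> \<one>\<^bsub>B\<^esub>"
  unfolding tens_def tensor_alg_def
  by (subst PK.quot_one) (simp add: pre_tensor_def)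

lemma tens_zero_l: "b \<in> carrier B \<Longrightarrow> tn \<zero>\<^bsub>A\<^esub> b = \<zero>\<^bsub>T\<^esub>"
  using lin_maps_zero[OF A.csa_axioms csa_tensor bilinD(2)[OF tens_bilin]] .

lemma tens_zero_r: "a \<in> carrier A \<Longrightarrow> tn a \<zero>\<^bsub>B\<^esub> = \<zero>\<^bsub>T\<^esub>"
  using lin_maps_zero[OF B.csa_axioms csa_tensor bilinD(1)[OF tens_bilin]] .

text \<open>A scalar is absorbed into the first leg and zero is the elementary tensor of two zeros,
  so elementary tensors and sums are the only cases.\<close>

lemma tens_induct [consumes 1, case_names tens add]:
  assumes z: "z \<in> carrier T" and t: "\<And>a b. a \<in> carrier A \<Longrightarrow> b \<in> carrier B \<Longrightarrow> Pr (tn a b)"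
    and add: "\<And>x y. x \<in> carrier T \<Longrightarrow> y \<in> carrier T \<Longrightarrow> Pr x \<Longrightarrow> Pr y \<Longrightarrow> Pr (x \<oplus>\<^bsub>T\<^esub> y)"
  shows "Pr z"
proof -
  have c: "K +>\<^bsub>P\<^esub> f \<in> carrier T" if "Poly_Mapping.keys f \<subseteq> carrier (A \<times>\<times> B)" for f
    unfolding tensor_alg_def using that by (intro PK.coset_closed) (simp add: pre_tensor_def)
  obtain f where f: "f \<in> carrier P" and zf: "z = K +>\<^bsub>P\<^esub> f"
    using z unfolding tensor_alg_def PK.carrier_quot by auto
  have "Poly_Mapping.keys f \<subseteq> carrier (A \<times>\<times> B)" using f by (simp add: pre_tensor_def)
  then show ?thesis unfolding zf
  proof (induction f rule: poly_mapping_carrier_induct)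
    case zero
    have "Pr (tn \<zero>\<^bsub>A\<^esub> \<zero>\<^bsub>B\<^esub>)" by (intro t) auto
    moreover have "tn \<zero>\<^bsub>A\<^esub> \<zero>\<^bsub>B\<^esub> = K +>\<^bsub>P\<^esub> 0"
      using tens_zero_l[of "\<zero>\<^bsub>B\<^esub>"] PK.quot_zero unfolding tensor_alg_def by (simp add: pre_tensor_def)
    ultimately show ?case by simp
  next
    case (single ab c)
    obtain a b where ab: "ab = (a, b)" "a \<in> carrier A" "b \<in> carrier B" using single by (cases ab) auto
    have "Pr (tn (c \<odot>\<^bsub>A\<^esub> a) b)" using ab by (intro t) auto
    then show ?case using ab by (simp add: tens_smult_l tens_smult)
  next
    case (add f g)
    have "K +>\<^bsub>P\<^esub> (f + g) = (K +>\<^bsub>P\<^esub> f) \<oplus>\<^bsub>T\<^esub> (K +>\<^bsub>P\<^esub> g)"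
      unfolding tensor_alg_def using add(1,2)
      by (subst PK.quot_add) (auto simp: pre_tensor_def)
    then show ?case using assms(3)[OF c c] add by simp
  qed
qed

lemma lin_maps_tens_eq:
  assumes C: "csa C" and F: "F \<in> lin_maps T C" and G: "G \<in> lin_maps T C"
    and "\<And>a b. a \<in> carrier A \<Longrightarrow> b \<in> carrier B \<Longrightarrow> F (tn a b) = G (tn a b)" and "z \<in> carrier T"
  shows "F z = G z"
  using assms(5)
  by (induction z rule: tens_induct) (auto simp: assms(4) lin_mapsD[OF F] lin_mapsD[OF G])

text \<open>The linear extension to the free vector space kills the bilinear relators and therefore
  descends. Elementary tensors span the tensor product and extensionality fixes the values off the
  carrier, so the description in the definition has exactly one solution.\<close>

lemma tensor_lift:
  assumes C: "csa C" and \<beta>: "bilin A B C \<beta>"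
  shows "tensor_lift A B C \<beta> \<in> lin_maps T C"
    and "a \<in> carrier A \<Longrightarrow> b \<in> carrier B \<Longrightarrow> tensor_lift A B C \<beta> (tn a b) = \<beta> a b"
    and "tensor_lift A B C \<beta> \<in> extensional (carrier T)"
proof -
  interpret C: csa C by fact
  define f where "f = lin_ext C (\<lambda>(a, b). \<beta> a b)"
  have f: "f \<in> lin_maps P C"
    unfolding f_def pre_tensor_def by (rule lin_ext_lin[OF C]) (auto simp: bilinD[OF \<beta>])
  have fs: "f (Poly_Mapping.single (a, b) c) = c \<odot>\<^bsub>C\<^esub> \<beta> a b" if "a \<in> carrier A" "b \<in> carrier B" for a b c
    unfolding f_def using that by (subst lin_ext_single[OF C]) (auto simp: bilinD[OF \<beta>])
  have fd: "f (x - y) = f x \<ominus>\<^bsub>C\<^esub> f y" if "x \<in> carrier P" "y \<in> carrier P" for x y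
    using lin_maps_minus[OF csa_P C f, of x y] that by (simp add: minus_P)
  have canc: "(x \<oplus>\<^bsub>C\<^esub> y) \<ominus>\<^bsub>C\<^esub> x \<ominus>\<^bsub>C\<^esub> y = \<zero>\<^bsub>C\<^esub>" if "x \<in> carrier C" "y \<in> carrier C" for x y
    using that by (simp add: a_minus_def C.a_assoc[of "x \<oplus>\<^bsub>C\<^esub> y"] C.minus_add[symmetric] C.r_neg)
  have "K \<subseteq> {x \<in> carrier P. f x = \<zero>\<^bsub>C\<^esub>}"
    unfolding tensor_kernel_def
  proof (rule csa.lin_span_mono_submodule[OF csa_P])
    show "submodule {x \<in> carrier P. f x = \<zero>\<^bsub>C\<^esub>} CC P"
      unfolding PK.submodule_iff
      by (auto simp: lin_mapsD[OF f] lin_maps_zero[OF csa_P C f])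
    show "bilinear_relators A B \<subseteq> {x \<in> carrier P. f x = \<zero>\<^bsub>C\<^esub>}"
      unfolding bilinear_relators_def
      by (auto simp: fd diff_P fs bilinD[OF \<beta>] canc)
  qed
  then have fK: "f x = \<zero>\<^bsub>C\<^esub>" if "x \<in> K" for x using that by blast
  define g where "g = (\<lambda>Y. the_elem (f ` Y))"
  have g: "g \<in> lin_maps T C"
    unfolding g_def tensor_alg_def by (rule PK.quot_lift_lin[OF C f fK])
  have gt: "g (tn a b) = \<beta> a b" if "a \<in> carrier A" "b \<in> carrier B" for a b
    unfolding g_def tens_def using that PK.quot_lift_eq[OF C f fK, of "Poly_Mapping.single (a, b) 1"]
    by (simp add: fs bilinD[OF \<beta>])
  define h where "h = restrict g (carrier T)"
  interpret T: csa T by (rule csa_tensor)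
  have h: "h \<in> lin_maps T C"
    using g by (auto simp: h_def lin_maps_def)
  have ht: "\<forall>a\<in>carrier A. \<forall>b\<in>carrier B. h (tn a b) = \<beta> a b"
    using gt by (auto simp: h_def)
  have "tensor_lift A B C \<beta> = h"
    unfolding tensor_lift_def
  proof (rule the_equality)
    show "h \<in> lin_maps T C \<inter> extensional (carrier T) \<and> (\<forall>a\<in>carrier A. \<forall>b\<in>carrier B. h (tn a b) = \<beta> a b)"
      using h ht by (simp add: h_def)
    fix k assume k: "k \<in> lin_maps T C \<inter> extensional (carrier T) \<and> (\<forall>a\<in>carrier A. \<forall>b\<in>carrier B. k (tn a b) = \<beta> a b)"
    show "k = h"
    proof (rule extensionalityI)
      show "k \<in> extensional (carrier T)" using k by simp
      show "h \<in> extensional (carrier T)" by (simp add: h_def)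
      show "k z = h z" if "z \<in> carrier T" for z
      proof (rule lin_maps_tens_eq[OF C _ h _ that])
        show "k \<in> lin_maps T C" using k by simp
        show "k (tn a b) = h (tn a b)" if "a \<in> carrier A" "b \<in> carrier B" for a b
          using k ht that by simp
      qed
    qed
  qed
  then show "tensor_lift A B C \<beta> \<in> lin_maps T C"
    "a \<in> carrier A \<Longrightarrow> b \<in> carrier B \<Longrightarrow> tensor_lift A B C \<beta> (tn a b) = \<beta> a b"
    "tensor_lift A B C \<beta> \<in> extensional (carrier T)"
    using h ht by (auto simp: h_def)
qed

end

section \<open>Maps between tensor products\<close>

lemmas csa_pairI = csa_pair.intro

lemma bilin_comp:
  assumes "bilin A B C \<beta>" "f \<in> lin_maps A' A" "g \<in> lin_maps B' B" "h \<in> lin_maps C C'"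
  shows "bilin A' B' C' (\<lambda>a b. h (\<beta> (f a) (g b)))"
proof (intro bilinI)
  show "(\<lambda>b. h (\<beta> (f a) (g b))) \<in> lin_maps B' C'" if "a \<in> carrier A'" for a
    using that assms(2)
    by (intro lin_maps_comp[OF _ assms(4)] lin_maps_comp[OF assms(3)] bilinD(1)[OF assms(1)]) (simp add: lin_mapsD)
  show "(\<lambda>a. h (\<beta> (f a) (g b))) \<in> lin_maps A' C'" if "b \<in> carrier B'" for b
    using that assms(3)
    by (intro lin_maps_comp[OF _ assms(4)] lin_maps_comp[OF assms(2)] bilinD(2)[OF assms(1)]) (simp add: lin_mapsD)
qed

lemma
  assumes A: "csa A" and B: "csa B" and C: "csa C" and D: "csa D"
    and f: "f \<in> lin_maps A C" and g: "g \<in> lin_maps B D"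
  shows tensor_map_lin: "tensor_map A B C D f g \<in> lin_maps (tensor_alg A B) (tensor_alg C D)"
    and tensor_map_tens: "a \<in> carrier A \<Longrightarrow> b \<in> carrier B \<Longrightarrow> tensor_map A B C D f g (tens A B a b) = tens C D (f a) (g b)"
proof -
  interpret AB: csa_pair A B by (intro csa_pairI A B)
  interpret CD: csa_pair C D by (intro csa_pairI C D)
  have "bilin A B (tensor_alg C D) (\<lambda>a b. tens C D (f a) (g b))"
    using bilin_comp[OF CD.tens_bilin f g lin_maps_id] .
  note L = AB.tensor_lift[OF CD.csa_tensor this]
  show "tensor_map A B C D f g \<in> lin_maps (tensor_alg A B) (tensor_alg C D)"
    "a \<in> carrier A \<Longrightarrow> b \<in> carrier B \<Longrightarrow> tensor_map A B C D f g (tens A B a b) = tens C D (f a) (g b)"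
    unfolding tensor_map_def using L by auto
qed

text \<open>Both sides of the product rule are additive in each factor, so the factors are reduced
  to elementary tensors one after the other.\<close>

lemma tensor_map_star_hom:
  assumes A: "csa A" and B: "csa B" and C: "csa C" and D: "csa D"
    and f: "f \<in> star_homs A C" and g: "g \<in> star_homs B D"
  shows "tensor_map A B C D f g \<in> star_homs (tensor_alg A B) (tensor_alg C D)"
proof -
  interpret AB: csa_pair A B by (intro csa_pairI A B)
  interpret CD: csa_pair C D by (intro csa_pairI C D)
  interpret T: csa "tensor_alg A B" by (rule AB.csa_tensor)
  interpret T': csa "tensor_alg C D" by (rule CD.csa_tensor)
  let ?m = "tensor_map A B C D f g"
  note lin = tensor_map_lin[OF A B C D star_homsD(1)[OF f] star_homsD(1)[OF g]]
  note t = tensor_map_tens[OF A B C D star_homsD(1)[OF f] star_homsD(1)[OF g]]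
  note F = star_homsD[OF f] and G = star_homsD[OF g] and M = lin_mapsD[OF lin]
  show ?thesis
  proof (rule star_homsI[OF lin])
    show "?m \<one>\<^bsub>tensor_alg A B\<^esub> = \<one>\<^bsub>tensor_alg C D\<^esub>"
      by (simp add: AB.tens_one CD.tens_one t F G)
    show "?m (star (tensor_alg A B) x) = star (tensor_alg C D) (?m x)" if "x \<in> carrier (tensor_alg A B)" for x
      using that
      by (induction x rule: AB.tens_induct) (simp_all add: t F G AB.tens_star CD.tens_star T.star_add T'.star_add M)
    show "?m (x \<otimes>\<^bsub>tensor_alg A B\<^esub> y) = ?m x \<otimes>\<^bsub>tensor_alg C D\<^esub> ?m y"
      if x: "x \<in> carrier (tensor_alg A B)" and y: "y \<in> carrier (tensor_alg A B)" for x y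
    proof -
      have "?m (tens A B a b \<otimes>\<^bsub>tensor_alg A B\<^esub> y) = ?m (tens A B a b) \<otimes>\<^bsub>tensor_alg C D\<^esub> ?m y"
        if "a \<in> carrier A" "b \<in> carrier B" for a b
        using y that
        by (induction y rule: AB.tens_induct)
          (simp_all add: t F G AB.tens_mult CD.tens_mult M T.r_distr T'.r_distr)
      note 1 = this
      show ?thesis using x y
        by (induction x rule: AB.tens_induct) (simp_all add: 1 M T.l_distr T'.l_distr)
    qed
  qed
qed

text \<open>The associator and the middle swap are lifts of maps that are themselves lifts. This
  supplies linearity of the outer map in the argument that enters the inner lift as a
  parameter.\<close>

lemma tensor_lift_lin_param:
  assumes A: "csa A" and B: "csa B" and Z: "csa Z"
    and b: "\<And>d. d \<in> carrier D \<Longrightarrow> bilin A B Z (\<tau> d)"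
    and l: "\<And>a b. a \<in> carrier A \<Longrightarrow> b \<in> carrier B \<Longrightarrow> (\<lambda>d. \<tau> d a b) \<in> lin_maps D Z"
    and D: "csa D" and t: "t \<in> carrier (tensor_alg A B)"
  shows "(\<lambda>d. tensor_lift A B Z (\<tau> d) t) \<in> lin_maps D Z"
proof -
  interpret AB: csa_pair A B by (intro csa_pairI A B)
  interpret Z: csa Z by (rule Z)
  interpret D: csa D by (rule D)
  note L = AB.tensor_lift[OF Z b]
  note c = lin_mapsD(1)[OF L(1)]
  have add: "tensor_lift A B Z (\<tau> (d \<oplus>\<^bsub>D\<^esub> e)) t = tensor_lift A B Z (\<tau> d) t \<oplus>\<^bsub>Z\<^esub> tensor_lift A B Z (\<tau> e) t"
    if de: "d \<in> carrier D" "e \<in> carrier D" for d e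
    using t
  proof (induction t rule: AB.tens_induct)
    case (tens a b)
    then show ?case using de lin_mapsD(2)[OF l] by (simp add: L(2))
  next
    case (add x y)
    then show ?case using de by (simp add: lin_mapsD(2)[OF L(1)] c Z.a_ac)
  qed
  have smult: "tensor_lift A B Z (\<tau> (k \<odot>\<^bsub>D\<^esub> d)) t = k \<odot>\<^bsub>Z\<^esub> tensor_lift A B Z (\<tau> d) t"
    if d: "d \<in> carrier D" for d k
    using t
  proof (induction t rule: AB.tens_induct)
    case (tens a b)
    then show ?case using d lin_mapsD(3)[OF l] by (simp add: L(2))
  next
    case (add x y)
    then show ?case using d by (simp add: lin_mapsD(2)[OF L(1)] c Z.smult_add)
  qed
  show ?thesis
    by (rule lin_mapsI) (use add smult c t in auto)
qed

lemma
  assumes A: "csa A" and B: "csa B" and C: "csa C"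
  defines "Z \<equiv> tensor_alg A (tensor_alg B C)"
  shows tensor_assoc_lin: "tensor_assoc A B C \<in> lin_maps (tensor_alg (tensor_alg A B) C) Z"
    and tensor_assoc_tens: "a \<in> carrier A \<Longrightarrow> b \<in> carrier B \<Longrightarrow> c \<in> carrier C \<Longrightarrow>
      tensor_assoc A B C (tens (tensor_alg A B) C (tens A B a b) c) = tens A (tensor_alg B C) a (tens B C b c)"
proof -
  interpret AB: csa_pair A B by (intro csa_pairI A B)
  interpret BC: csa_pair B C by (intro csa_pairI B C)
  interpret ABC: csa_pair A "tensor_alg B C" by (intro csa_pairI A BC.csa_tensor)
  interpret AB_C: csa_pair "tensor_alg A B" C by (intro csa_pairI C AB.csa_tensor)
  have Z: "csa Z" unfolding Z_def by (rule ABC.csa_tensor)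
  let ?\<tau> = "\<lambda>c a b. tens A (tensor_alg B C) a (tens B C b c)"
  have b: "bilin A B Z (?\<tau> c)" if "c \<in> carrier C" for c
    using bilin_comp[OF ABC.tens_bilin lin_maps_id bilinD(2)[OF BC.tens_bilin that] lin_maps_id]
    unfolding Z_def .
  have l: "(\<lambda>c. ?\<tau> c a b) \<in> lin_maps C Z" if "a \<in> carrier A" "b \<in> carrier B" for a b
    using lin_maps_comp[OF bilinD(1)[OF BC.tens_bilin that(2)] bilinD(1)[OF ABC.tens_bilin that(1)]]
    unfolding Z_def .
  note L = AB.tensor_lift[OF Z b]
  have "bilin (tensor_alg A B) C Z (\<lambda>t c. tensor_lift A B Z (?\<tau> c) t)"
    by (intro bilinI L(1) tensor_lift_lin_param[OF A B Z b l C])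
  note M = AB_C.tensor_lift[OF Z this]
  have eq: "tensor_assoc A B C = tensor_lift (tensor_alg A B) C Z (\<lambda>t c. tensor_lift A B Z (?\<tau> c) t)"
    unfolding tensor_assoc_def Z_def by (simp add: Let_def)
  show "tensor_assoc A B C \<in> lin_maps (tensor_alg (tensor_alg A B) C) Z"
    unfolding eq by (rule M(1))
  show "tensor_assoc A B C (tens (tensor_alg A B) C (tens A B a b) c) = tens A (tensor_alg B C) a (tens B C b c)"
    if "a \<in> carrier A" "b \<in> carrier B" "c \<in> carrier C"
    unfolding eq using that by (simp add: M(2) L(2))
qed

lemma
  assumes A: "csa A" and B: "csa B"
  defines "AB \<equiv> tensor_alg A B"
  defines "Z \<equiv> tensor_alg AB AB"
  shows middle_swap_lin: "middle_swap A B \<in> lin_maps (tensor_alg (tensor_alg A A) (tensor_alg B B)) Z"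
    and middle_swap_tens: "a \<in> carrier A \<Longrightarrow> a' \<in> carrier A \<Longrightarrow> b \<in> carrier B \<Longrightarrow> b' \<in> carrier B \<Longrightarrow>
      middle_swap A B (tens (tensor_alg A A) (tensor_alg B B) (tens A A a a') (tens B B b b')) =
      tens AB AB (tens A B a b) (tens A B a' b')"
proof -
  interpret AA: csa_pair A A by (intro csa_pairI A)
  interpret BB: csa_pair B B by (intro csa_pairI B)
  interpret AB: csa_pair A B by (intro csa_pairI A B)
  interpret Z: csa_pair AB AB unfolding AB_def by (intro csa_pairI AB.csa_tensor)
  interpret W: csa_pair "tensor_alg A A" "tensor_alg B B" by (intro csa_pairI AA.csa_tensor BB.csa_tensor)
  have Z: "csa Z" unfolding Z_def by (rule Z.csa_tensor)
  let ?\<tau> = "\<lambda>a a' b b'. tens AB AB (tens A B a b) (tens A B a' b')"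
  note t1 = bilinD(1)[OF AB.tens_bilin, folded AB_def] and t2 = bilinD(2)[OF AB.tens_bilin, folded AB_def]
  have 1: "bilin B B Z (?\<tau> a a')" if "a \<in> carrier A" "a' \<in> carrier A" for a a'
    using bilin_comp[OF Z.tens_bilin t1[OF that(1)] t1[OF that(2)] lin_maps_id] unfolding Z_def .
  have 2: "bilin A A Z (\<lambda>a a'. ?\<tau> a a' b b')" if "b \<in> carrier B" "b' \<in> carrier B" for b b'
    using bilin_comp[OF Z.tens_bilin t2[OF that(1)] t2[OF that(2)] lin_maps_id] unfolding Z_def .
  note L = BB.tensor_lift[OF Z 1]
  have 3: "bilin A A Z (\<lambda>a a'. tensor_lift B B Z (?\<tau> a a') t)" if t: "t \<in> carrier (tensor_alg B B)" for t
  proof (intro bilinI)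
    show "(\<lambda>a'. tensor_lift B B Z (?\<tau> a a') t) \<in> lin_maps A Z" if "a \<in> carrier A" for a
      by (rule tensor_lift_lin_param[OF B B Z 1[OF that] bilinD(1)[OF 2 that] A t])
    show "(\<lambda>a. tensor_lift B B Z (?\<tau> a a') t) \<in> lin_maps A Z" if "a' \<in> carrier A" for a'
      by (rule tensor_lift_lin_param[OF B B Z 1[OF _ that] bilinD(2)[OF 2 that] A t])
  qed
  note M = AA.tensor_lift[OF Z 3]
  have "bilin (tensor_alg A A) (tensor_alg B B) Z
      (\<lambda>s t. tensor_lift A A Z (\<lambda>a a'. tensor_lift B B Z (?\<tau> a a') t) s)"
    by (intro bilinI M(1) tensor_lift_lin_param[OF A A Z 3 _ BB.csa_tensor] L(1))
  note N = W.tensor_lift[OF Z this]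
  have eq: "middle_swap A B = tensor_lift (tensor_alg A A) (tensor_alg B B) Z
      (\<lambda>s t. tensor_lift A A Z (\<lambda>a a'. tensor_lift B B Z (?\<tau> a a') t) s)"
    unfolding middle_swap_def Z_def AB_def by (simp add: Let_def)
  show "middle_swap A B \<in> lin_maps (tensor_alg (tensor_alg A A) (tensor_alg B B)) Z"
    unfolding eq by (rule N(1))
  show "middle_swap A B (tens (tensor_alg A A) (tensor_alg B B) (tens A A a a') (tens B B b b')) =
      tens AB AB (tens A B a b) (tens A B a' b')"
    if "a \<in> carrier A" "a' \<in> carrier A" "b \<in> carrier B" "b' \<in> carrier B"
    unfolding eq using that by (simp add: N(2) M(2) L(2))
qed


section \<open>Algebras generated by unitary matrices\<close>

context abelian_monoid
begin

lemma finsum_swap: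
  assumes "finite S" "finite T" "\<And>i j. i \<in> S \<Longrightarrow> j \<in> T \<Longrightarrow> f i j \<in> carrier G"
  shows "(\<Oplus>i\<in>S. \<Oplus>j\<in>T. f i j) = (\<Oplus>j\<in>T. \<Oplus>i\<in>S. f i j)"
  using assms(1,3)
proof (induction S rule: finite_induct)
  case empty
  then show ?case by simp
next
  case (insert x F)
  have "(\<Oplus>j\<in>T. \<Oplus>i\<in>insert x F. f i j) = (\<Oplus>j\<in>T. f x j \<oplus> (\<Oplus>i\<in>F. f i j))"
    using insert by (intro finsum_cong') (auto intro!: finsum_insert finsum_closed)
  also have "\<dots> = (\<Oplus>j\<in>T. f x j) \<oplus> (\<Oplus>j\<in>T. \<Oplus>i\<in>F. f i j)"
    using insert by (intro finsum_addf) (auto intro!: finsum_closed)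
  also have "\<dots> = (\<Oplus>i\<in>insert x F. \<Oplus>j\<in>T. f i j)"
    using insert by (subst finsum_insert) (auto intro!: finsum_closed)
  finally show ?case by simp
qed

lemma finsum_delta:
  assumes "finite S" "i \<in> S" "f i \<in> carrier G"
  shows "(\<Oplus>j\<in>S. if j = i then f j else \<zero>) = f i"
proof -
  have "(\<Oplus>j\<in>S. if j = i then f j else \<zero>) = (\<Oplus>j\<in>{i}. f j)"
    using assms by (intro add.finprod_mono_neutral_cong_right) auto
  then show ?thesis using assms by (simp add: finsum_insert[of "{}"])
qed

lemma finsum_delta':
  assumes "finite S" "i \<in> S" "f i \<in> carrier G"
  shows "(\<Oplus>j\<in>S. if i = j then f j else \<zero>) = f i"
  using finsum_delta[of S i f] assms by (simp add: eq_commute)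

text \<open>Splits an index below \<open>N * n\<close> into its leading digit and the rest. The
  digit is shifted by one because generators are indexed from 1, whereas entries of a
  corepresentation are indexed from 0.\<close>

lemma finsum_div_mod:
  fixes N n :: nat
  assumes "\<And>k l. k \<in> {1..N} \<Longrightarrow> l < n \<Longrightarrow> f k l \<in> carrier G"
  shows "(\<Oplus>p\<in>{..<N * n}. f (p div n + 1) (p mod n)) = (\<Oplus>k\<in>{1..N}. \<Oplus>l\<in>{..<n}. f k l)"
proof (cases "n = 0")
  case True
  then show ?thesis by simp
next
  case False
  show ?thesis using assms
  proof (induction N)
    case 0
    then show ?case by simp
  next
    case (Suc N)
    let ?f = "\<lambda>p. f (p div n + 1) (p mod n)"
    have cl: "?f p \<in> carrier G" if "p < Suc N * n" for p
      using that False by (intro Suc.prems) (auto simp: less_mult_imp_div_less Suc_le_eq simp del: mult_Suc)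
    have U: "{..<Suc N * n} = {..<N * n} \<union> {N * n..<N * n + n}" by auto
    have "(\<Oplus>p\<in>{..<Suc N * n}. ?f p) = (\<Oplus>p\<in>{..<N * n}. ?f p) \<oplus> (\<Oplus>p\<in>{N * n..<N * n + n}. ?f p)"
      unfolding U using cl by (intro finsum_Un_disjoint) auto
    also have "(\<Oplus>p\<in>{N * n..<N * n + n}. ?f p) = (\<Oplus>l\<in>{..<n}. ?f (N * n + l))"
    proof -
      have im: "{N * n..<N * n + n} = (\<lambda>l. N * n + l) ` {..<n}"
        using image_add_atLeastLessThan[of "N * n" 0 n] by (simp add: atLeast0LessThan add.commute)
      show ?thesis unfolding im using Suc.prems
        by (intro finsum_reindex) (auto simp: inj_on_def)
    qed
    also have "\<dots> = (\<Oplus>l\<in>{..<n}. f (Suc N) l)"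
      using Suc.prems by (intro finsum_cong') auto
    also have "(\<Oplus>p\<in>{..<N * n}. ?f p) = (\<Oplus>k\<in>{1..N}. \<Oplus>l\<in>{..<n}. f k l)"
      by (rule Suc.IH) (use Suc.prems in simp)
    also have "(\<Oplus>k\<in>{1..N}. \<Oplus>l\<in>{..<n}. f k l) \<oplus> (\<Oplus>l\<in>{..<n}. f (Suc N) l) =
        (\<Oplus>k\<in>insert (Suc N) {1..N}. \<Oplus>l\<in>{..<n}. f k l)"
      using Suc.prems by (subst finsum_insert) (auto intro!: finsum_closed a_comm)
    also have "insert (Suc N) {1..N} = {1..Suc N}" by auto
    finally show ?case .
  qed
qed

end


section \<open>Spanning a generated algebra by products of generators\<close>

inductive_set products :: "('a, 'm) monoid_scheme \<Rightarrow> 'a set \<Rightarrow> 'a set" for A S where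
  one: "\<one>\<^bsub>A\<^esub> \<in> products A S"
| mult: "s \<in> S \<Longrightarrow> w \<in> products A S \<Longrightarrow> s \<otimes>\<^bsub>A\<^esub> w \<in> products A S"

lemma (in csa) products_closed:
  assumes "S \<subseteq> carrier A"
  shows "w \<in> products A S \<Longrightarrow> w \<in> carrier A"
  by (induction rule: products.induct) (use assms in auto)

lemma (in csa) products_mult:
  assumes "S \<subseteq> carrier A" "v \<in> products A S" "w \<in> products A S"
  shows "v \<otimes> w \<in> products A S"
  using assms(2)
proof (induction rule: products.induct)
  case one
  then show ?case using assms products_closed by simp
next
  case (mult s v)
  have c: "s \<in> carrier A" "v \<in> carrier A" "w \<in> carrier A"
    using mult assms products_closed[OF assms(1)] by auto
  have "s \<otimes> (v \<otimes> w) \<in> products A S"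
    by (rule products.mult[OF mult(1) mult(3)])
  then show ?case using c by (simp add: m_assoc)
qed

text \<open>Closure under multiplication passes from products to their span in one factor at a time,
  each time through a subspace. Words without adjoints are enough because \<open>S\<close> is closed
  under the involution.\<close>

lemma (in csa) star_subalgebra_span_products:
  assumes S: "S \<subseteq> carrier A" and star: "\<And>s. s \<in> S \<Longrightarrow> star A s \<in> S"
  shows "star_subalgebra A (lin_span A (products A S))"
proof -
  let ?W = "products A S" and ?L = "lin_span A (products A S)"
  have W: "?W \<subseteq> carrier A" using products_closed[OF S] by auto
  note sub = lin_span_submodule[OF W]
  note L = sub[unfolded submodule_iff]
  have WL: "w \<in> ?W \<Longrightarrow> w \<in> ?L" for w using lin_span_superset by auto
  have starW: "star A w \<in> ?W" if "w \<in> ?W" for w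
    using that
  proof (induction rule: products.induct)
    case one
    then show ?case by (simp add: products.one)
  next
    case (mult s w)
    have "star A s \<otimes> \<one> \<in> ?W" by (rule products.mult[OF star[OF mult(1)] products.one])
    then have "star A s \<in> ?W" using mult S by (simp add: subset_iff)
    then show ?case using mult S W by (subst star_mult) (auto intro: products_mult[OF S])
  qed
  have "?L \<subseteq> {x \<in> carrier A. \<forall>w\<in>?W. w \<otimes> x \<in> ?L}"
  proof (rule lin_span_mono_submodule)
    show "submodule {x \<in> carrier A. \<forall>w\<in>?W. w \<otimes> x \<in> ?L} CC A"
      unfolding submodule_iff using L W by (auto simp: subset_iff r_distr smult_mult_r)
    show "?W \<subseteq> {x \<in> carrier A. \<forall>w\<in>?W. w \<otimes> x \<in> ?L}"
      using products_mult[OF S] WL W by blast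
  qed
  then have 1: "w \<otimes> x \<in> ?L" if "w \<in> ?W" "x \<in> ?L" for w x using that by blast
  have "?L \<subseteq> {x \<in> carrier A. \<forall>y\<in>?L. x \<otimes> y \<in> ?L}"
  proof (rule lin_span_mono_submodule)
    show "submodule {x \<in> carrier A. \<forall>y\<in>?L. x \<otimes> y \<in> ?L} CC A"
      unfolding submodule_iff using L by (auto simp: subset_iff l_distr smult_mult_l)
    show "?W \<subseteq> {x \<in> carrier A. \<forall>y\<in>?L. x \<otimes> y \<in> ?L}"
      using 1 W by blast
  qed
  then have 2: "x \<otimes> y \<in> ?L" if "x \<in> ?L" "y \<in> ?L" for x y using that by blast
  have "?L \<subseteq> {x \<in> carrier A. star A x \<in> ?L}"
  proof (rule lin_span_mono_submodule)
    show "submodule {x \<in> carrier A. star A x \<in> ?L} CC A"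
      unfolding submodule_iff using L by (auto simp: star_add star_smult)
    show "?W \<subseteq> {x \<in> carrier A. star A x \<in> ?L}"
      using starW W WL by blast
  qed
  then have 3: "star A x \<in> ?L" if "x \<in> ?L" for x using that by blast
  have "subring ?L A"
    by (rule subringI) (use L 2 WL[OF products.one] module.submoduleE(3)[OF mod sub] in auto)
  then show ?thesis unfolding star_subalgebra_def using sub 3 by blast
qed

text \<open>Phrased with subalgebras instead of words: an equalizer, a preimage or a commutant that
  is a star subalgebra and contains \<open>S\<close> is then the whole algebra.\<close>

definition generates :: "('a, 'm) star_alg_scheme \<Rightarrow> 'a set \<Rightarrow> bool"
  where "generates A S \<longleftrightarrow> S \<subseteq> carrier A \<and> (\<forall>T. star_subalgebra A T \<and> S \<subseteq> T \<longrightarrow> carrier A \<subseteq> T)"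

lemma (in csa) generates_span:
  assumes "generates A S" "\<And>s. s \<in> S \<Longrightarrow> star A s \<in> S"
  shows "carrier A = lin_span A (products A S)"
proof -
  have S: "S \<subseteq> carrier A" using assms by (simp add: generates_def)
  note sub = star_subalgebra_span_products[OF S assms(2)]
  have "S \<subseteq> lin_span A (products A S)"
  proof
    fix s assume s: "s \<in> S"
    have "s \<otimes> \<one> \<in> products A S" by (rule products.mult[OF s products.one])
    then show "s \<in> lin_span A (products A S)" using lin_span_superset s S by (auto simp: subset_iff)
  qed
  then have "carrier A \<subseteq> lin_span A (products A S)" using assms(1) sub by (simp add: generates_def)
  moreover have "lin_span A (products A S) \<subseteq> carrier A"
    using products_closed[OF S] by (intro lin_span_mono_submodule submodule_carrier) auto
  ultimately show ?thesis by blast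
qed

text \<open>
  The matrix \<open>mat gs\<close> is the tensor product of the matrices \<open>u g\<close> for \<open>g\<close> in the list \<open>gs\<close>. Its rows
  and columns, indexed by \<open>p < N ^ length gs\<close>, are read off the base \<open>N\<close> digits of \<open>p\<close>.
\<close>

fun mat :: "('a, 'm) monoid_scheme \<Rightarrow> nat \<Rightarrow> ('x \<Rightarrow> nat \<Rightarrow> nat \<Rightarrow> 'a) \<Rightarrow> 'x list \<Rightarrow> nat \<Rightarrow> nat \<Rightarrow> 'a" where
  "mat A N u [] p q = \<one>\<^bsub>A\<^esub>"
| "mat A N u (g # gs) p q = u g (p div N ^ length gs + 1) (q div N ^ length gs + 1) \<otimes>\<^bsub>A\<^esub>
     mat A N u gs (p mod N ^ length gs) (q mod N ^ length gs)"

lemma div_mod_less: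
  fixes p N n :: nat
  assumes "p < N * n"
  shows "p div n + 1 \<in> {1..N}" "p mod n < n"
proof -
  have "0 < n" using assms by (cases n) auto
  then show "p mod n < n" by simp
  show "p div n + 1 \<in> {1..N}" using assms less_mult_imp_div_less[OF assms] by auto
qed

text \<open>Prepending the generator \<open>u g i j\<close> to a word prepends the digit
  \<open>i - 1\<close> to the row index and the digit \<open>j - 1\<close> to the column
  index.\<close>

lemma products_mat:
  assumes "w \<in> products A {u g i j | g i j. g \<in> G \<and> i \<in> {1..N} \<and> j \<in> {1..N}}"
  shows "\<exists>gs p q. set gs \<subseteq> G \<and> p < N ^ length gs \<and> q < N ^ length gs \<and> w = mat A N u gs p q"
  using assms
proof (induction rule: products.induct)
  case one
  show ?case by (rule exI[of _ "[]"]) auto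
next
  case (mult s w)
  obtain g i j where s: "s = u g i j" "g \<in> G" "i \<in> {1..N}" "j \<in> {1..N}" using mult by auto
  obtain gs p q where w: "set gs \<subseteq> G" "p < N ^ length gs" "q < N ^ length gs" "w = mat A N u gs p q"
    using mult by auto
  let ?n = "N ^ length gs"
  have lt: "(k - 1) * ?n + r < N * ?n" if "k \<in> {1..N}" "r < ?n" for k r
  proof -
    have "(k - 1) * ?n + r < (k - 1) * ?n + ?n" using that by simp
    also have "\<dots> = k * ?n" using that by (cases k) auto
    also have "\<dots> \<le> N * ?n" using that by simp
    finally show ?thesis .
  qed
  have d: "((k - 1) * ?n + r) div ?n + 1 = k" "((k - 1) * ?n + r) mod ?n = r" if "k \<in> {1..N}" "r < ?n" for k r
    using that by auto
  show ?case
    using s w lt d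
    by (intro exI[of _ "g # gs"] exI[of _ "(i - 1) * ?n + p"] exI[of _ "(j - 1) * ?n + q"]) simp
qed

lemma lin_maps_smult_fun:
  assumes "csa B" "\<epsilon> \<in> lin_maps A complex_alg" "b \<in> carrier B"
  shows "(\<lambda>a. \<epsilon> a \<odot>\<^bsub>B\<^esub> b) \<in> lin_maps A B"
proof -
  interpret B: csa B by fact
  show ?thesis
    using assms by (intro lin_mapsI) (auto simp: lin_mapsD[OF assms(2)] B.add_smult B.smult_smult)
qed

lemma (in csa) lin_maps_smult: "(\<lambda>x. c \<odot> x) \<in> lin_maps A A"
  by (rule lin_mapsI) (auto simp: smult_add smult_smult mult.commute)

lemma (in csa) lin_maps_mult: "a \<in> carrier A \<Longrightarrow> (\<lambda>x. a \<otimes> x) \<in> lin_maps A A" "a \<in> carrier A \<Longrightarrow> (\<lambda>x. x \<otimes> a) \<in> lin_maps A A"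
  by (rule lin_mapsI; simp add: r_distr l_distr smult_mult_l smult_mult_r)+

lemma (in csa) bilin_mult: "bilin A A A (\<otimes>)"
  by (intro bilinI lin_maps_mult)

lemma (in csa) finsum_mult_finsum:
  assumes "finite K" "finite L" "\<And>k. k \<in> K \<Longrightarrow> f k \<in> carrier A" "\<And>l. l \<in> L \<Longrightarrow> h l \<in> carrier A"
  shows "(\<Oplus>k\<in>K. f k) \<otimes> (\<Oplus>l\<in>L. h l) = (\<Oplus>k\<in>K. \<Oplus>l\<in>L. f k \<otimes> h l)"
proof -
  have "(\<Oplus>k\<in>K. f k) \<otimes> (\<Oplus>l\<in>L. h l) = (\<Oplus>k\<in>K. f k \<otimes> (\<Oplus>l\<in>L. h l))"
    using assms by (intro finsum_ldistr) (auto intro!: finsum_closed)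
  also have "\<dots> = (\<Oplus>k\<in>K. \<Oplus>l\<in>L. f k \<otimes> h l)"
    using assms by (intro finsum_cong' finsum_rdistr) (auto intro!: finsum_closed)
  finally show ?thesis .
qed

text \<open>Working criterion for CQG-algebras: unitary matrices whose entries generate, a coproduct
  of matrix form, and candidates for counit and antipode prescribed on the entries. Coassociativity
  and the counit and antipode identities are consequences of the matrix form. The candidates may
  take any values off the carrier, since a universal property supplies them.\<close>

locale matrix_hopf = csa A for A :: "('a, 'm) hopf_alg_scheme" (structure) +
  fixes N :: nat and G :: "'x set" and u :: "'x \<Rightarrow> nat \<Rightarrow> nat \<Rightarrow> 'a" and ginv :: "'x \<Rightarrow> 'x"
    and \<epsilon> :: "'a \<Rightarrow> complex" and S :: "'a \<Rightarrow> 'a"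
  assumes comult_hom: "comult A \<in> star_homs A (tensor_alg A A)"
    and u_closed [simp]: "g \<in> G \<Longrightarrow> i \<in> {1..N} \<Longrightarrow> j \<in> {1..N} \<Longrightarrow> u g i j \<in> carrier A"
    and comult_u: "g \<in> G \<Longrightarrow> i \<in> {1..N} \<Longrightarrow> j \<in> {1..N} \<Longrightarrow>
      comult A (u g i j) = (\<Oplus>\<^bsub>tensor_alg A A\<^esub>k\<in>{1..N}. tens A A (u g i k) (u g k j))"
    and ginv: "g \<in> G \<Longrightarrow> ginv g \<in> G"
    and star_u: "g \<in> G \<Longrightarrow> i \<in> {1..N} \<Longrightarrow> j \<in> {1..N} \<Longrightarrow> star A (u g i j) = u (ginv g) i j"
    and unitary1: "g \<in> G \<Longrightarrow> i \<in> {1..N} \<Longrightarrow> j \<in> {1..N} \<Longrightarrow>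
      (\<Oplus>k\<in>{1..N}. u g i k \<otimes> star A (u g j k)) = (if i = j then \<one> else \<zero>)"
    and unitary2: "g \<in> G \<Longrightarrow> i \<in> {1..N} \<Longrightarrow> j \<in> {1..N} \<Longrightarrow>
      (\<Oplus>k\<in>{1..N}. star A (u g k i) \<otimes> u g k j) = (if i = j then \<one> else \<zero>)"
    and generates: "generates A {u g i j | g i j. g \<in> G \<and> i \<in> {1..N} \<and> j \<in> {1..N}}"
    and \<epsilon>_hom: "\<epsilon> \<in> star_homs A complex_alg"
    and \<epsilon>_u: "g \<in> G \<Longrightarrow> i \<in> {1..N} \<Longrightarrow> j \<in> {1..N} \<Longrightarrow> \<epsilon> (u g i j) = (if i = j then 1 else 0)"
    and S_hom: "S \<in> star_homs A (op_alg A)"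
    and S_u: "g \<in> G \<Longrightarrow> i \<in> {1..N} \<Longrightarrow> j \<in> {1..N} \<Longrightarrow> S (u g i j) = star A (u g j i)"

sublocale matrix_hopf \<subseteq> AA: csa_pair A A
  by (intro csa_pairI csa_axioms)

sublocale matrix_hopf \<subseteq> T: csa "tensor_alg A A"
  by (rule AA.csa_tensor)

context matrix_hopf
begin

section \<open>Entries of tensor products of the generating matrices\<close>

abbreviation "U \<equiv> mat A N u"
abbreviation "msize gs \<equiv> N ^ length gs"
abbreviation "TA \<equiv> tensor_alg A A"
abbreviation "tA \<equiv> tens A A"

lemma U_closed [simp]: "set gs \<subseteq> G \<Longrightarrow> p < msize gs \<Longrightarrow> q < msize gs \<Longrightarrow> U gs p q \<in> carrier A"
proof (induction gs arbitrary: p q)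
  case (Cons g gs)
  then show ?case using div_mod_less[of p N "msize gs"] div_mod_less[of q N "msize gs"] by simp
qed simp

text \<open>A tensor product of corepresentations is a corepresentation: the sums for the first
  letter and for the tail multiply to a double sum, which \<open>finsum_div_mod\<close> turns into
  one sum over the indices of the larger matrix.\<close>

lemma comult_U:
  "set gs \<subseteq> G \<Longrightarrow> p < msize gs \<Longrightarrow> q < msize gs \<Longrightarrow>
    comult A (U gs p q) = (\<Oplus>\<^bsub>TA\<^esub>k\<in>{..<msize gs}. tA (U gs p k) (U gs k q))"
proof (induction gs arbitrary: p q)
  case Nil
  then show ?case by (simp add: star_homsD[OF comult_hom] AA.tens_one T.finsum_insert[of "{}"] lessThan_Suc)
next
  case (Cons g gs)
  let ?n = "msize gs"
  note p = div_mod_less[of p N ?n] and q = div_mod_less[of q N ?n]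
  let ?f = "\<lambda>k l. tA (u g (p div ?n + 1) k \<otimes> U gs (p mod ?n) l) (u g k (q div ?n + 1) \<otimes> U gs l (q mod ?n))"
  have pq: "p < N * ?n" "q < N * ?n" "g \<in> G" "set gs \<subseteq> G" using Cons.prems by auto
  have "comult A (U (g # gs) p q) = comult A (u g (p div ?n + 1) (q div ?n + 1)) \<otimes>\<^bsub>TA\<^esub> comult A (U gs (p mod ?n) (q mod ?n))"
    using p q pq by (simp add: star_homsD[OF comult_hom])
  also have "\<dots> = (\<Oplus>\<^bsub>TA\<^esub>k\<in>{1..N}. tA (u g (p div ?n + 1) k) (u g k (q div ?n + 1))) \<otimes>\<^bsub>TA\<^esub>
      (\<Oplus>\<^bsub>TA\<^esub>l\<in>{..<?n}. tA (U gs (p mod ?n) l) (U gs l (q mod ?n)))"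
    using p q pq Cons.IH[of "p mod ?n" "q mod ?n"] comult_u[of g "p div ?n + 1" "q div ?n + 1"] by simp
  also have "\<dots> = (\<Oplus>\<^bsub>TA\<^esub>k\<in>{1..N}. \<Oplus>\<^bsub>TA\<^esub>l\<in>{..<?n}. tA (u g (p div ?n + 1) k) (u g k (q div ?n + 1)) \<otimes>\<^bsub>TA\<^esub>
      tA (U gs (p mod ?n) l) (U gs l (q mod ?n)))"
    using p q pq by (intro T.finsum_mult_finsum) auto
  also have "\<dots> = (\<Oplus>\<^bsub>TA\<^esub>k\<in>{1..N}. \<Oplus>\<^bsub>TA\<^esub>l\<in>{..<?n}. ?f k l)"
    using p q pq by (intro T.finsum_cong' T.finsum_closed AA.tens_mult) auto
  also have "\<dots> = (\<Oplus>\<^bsub>TA\<^esub>r\<in>{..<N * ?n}. ?f (r div ?n + 1) (r mod ?n))"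
    using p q pq by (intro T.finsum_div_mod[symmetric]) auto
  finally show ?case by simp
qed

lemma \<epsilon>_U: "set gs \<subseteq> G \<Longrightarrow> p < msize gs \<Longrightarrow> q < msize gs \<Longrightarrow> \<epsilon> (U gs p q) = (if p = q then 1 else 0)"
proof (induction gs arbitrary: p q)
  case Nil
  then show ?case by (simp add: star_homsD[OF \<epsilon>_hom])
next
  case (Cons g gs)
  let ?n = "msize gs"
  have pq: "p < N * ?n" "q < N * ?n" "g \<in> G" "set gs \<subseteq> G" using Cons.prems by auto
  note p = div_mod_less[OF pq(1)] and q = div_mod_less[OF pq(2)]
  have "p = q \<longleftrightarrow> p div ?n + 1 = q div ?n + 1 \<and> p mod ?n = q mod ?n" by (metis add_right_cancel div_mult_mod_eq)
  then show ?case
    using p q pq Cons.IH[of "p mod ?n" "q mod ?n"] \<epsilon>_u[of g "p div ?n + 1" "q div ?n + 1"]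
    by (simp add: star_homsD[OF \<epsilon>_hom])
qed

text \<open>Both \<open>S\<close> and the involution reverse products, so the letters keep their
  order and only rows and columns are exchanged.\<close>

lemma S_U: "set gs \<subseteq> G \<Longrightarrow> p < msize gs \<Longrightarrow> q < msize gs \<Longrightarrow> S (U gs p q) = star A (U gs q p)"
proof (induction gs arbitrary: p q)
  case Nil
  then show ?case using star_homsD(6)[OF S_hom] by simp
next
  case (Cons g gs)
  let ?n = "msize gs"
  have pq: "p < N * ?n" "q < N * ?n" "g \<in> G" "set gs \<subseteq> G" using Cons.prems by auto
  note p = div_mod_less[OF pq(1)] and q = div_mod_less[OF pq(2)]
  show ?case
    using p q pq Cons.IH[of "p mod ?n" "q mod ?n"] S_u[of g "p div ?n + 1" "q div ?n + 1"]
    by (simp add: star_homsD[OF S_hom] star_mult)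
qed

text \<open>The tail factors meet in the middle of the product, so the sum over the tail index
  collapses first and the first letter afterwards.\<close>

lemma unitary1_U:
  "set gs \<subseteq> G \<Longrightarrow> p < msize gs \<Longrightarrow> q < msize gs \<Longrightarrow>
    (\<Oplus>k\<in>{..<msize gs}. U gs p k \<otimes> star A (U gs q k)) = (if p = q then \<one> else \<zero>)"
proof (induction gs arbitrary: p q)
  case Nil
  then show ?case by (simp add: finsum_insert[of "{}"] lessThan_Suc)
next
  case (Cons g gs)
  let ?n = "msize gs"
  have pq: "p < N * ?n" "q < N * ?n" "g \<in> G" "set gs \<subseteq> G" using Cons.prems by auto
  note p = div_mod_less[OF pq(1)] and q = div_mod_less[OF pq(2)]
  let ?p = "p div ?n + 1" and ?q = "q div ?n + 1" and ?r = "p mod ?n" and ?s = "q mod ?n"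
  let ?f = "\<lambda>k l. (u g ?p k \<otimes> U gs ?r l) \<otimes> star A (u g ?q k \<otimes> U gs ?s l)"
  have pe: "p = q \<longleftrightarrow> ?p = ?q \<and> ?r = ?s" by (metis add_right_cancel div_mult_mod_eq)
  have "(\<Oplus>k\<in>{..<msize (g # gs)}. U (g # gs) p k \<otimes> star A (U (g # gs) q k)) =
      (\<Oplus>k\<in>{..<N * ?n}. ?f (k div ?n + 1) (k mod ?n))" by simp
  also have "\<dots> = (\<Oplus>k\<in>{1..N}. \<Oplus>l\<in>{..<?n}. ?f k l)"
    using p q pq by (intro finsum_div_mod) auto
  also have "\<dots> = (\<Oplus>k\<in>{1..N}. (u g ?p k \<otimes> (if ?r = ?s then \<one> else \<zero>)) \<otimes> star A (u g ?q k))"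
  proof (intro finsum_cong' refl)
    fix k assume k: "k \<in> {1..N}"
    have "(\<Oplus>l\<in>{..<?n}. ?f k l) = (\<Oplus>l\<in>{..<?n}. (u g ?p k \<otimes> (U gs ?r l \<otimes> star A (U gs ?s l))) \<otimes> star A (u g ?q k))"
      using p q pq k by (intro finsum_cong') (auto simp: star_mult m_assoc)
    also have "\<dots> = (u g ?p k \<otimes> (\<Oplus>l\<in>{..<?n}. U gs ?r l \<otimes> star A (U gs ?s l))) \<otimes> star A (u g ?q k)"
      using p q pq k by (subst finsum_rdistr) (auto intro!: finsum_ldistr[symmetric])
    finally show "(\<Oplus>l\<in>{..<?n}. ?f k l) = (u g ?p k \<otimes> (if ?r = ?s then \<one> else \<zero>)) \<otimes> star A (u g ?q k)"
      using p q pq Cons.IH[of ?r ?s] by simp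
  qed (use p q pq in auto)
  also have "\<dots> = (if p = q then \<one> else \<zero>)"
  proof (cases "?r = ?s")
    case True
    then have "(\<Oplus>k\<in>{1..N}. (u g ?p k \<otimes> (if ?r = ?s then \<one> else \<zero>)) \<otimes> star A (u g ?q k)) =
      (\<Oplus>k\<in>{1..N}. u g ?p k \<otimes> star A (u g ?q k))"
      using p q pq by (intro finsum_cong') auto
    then show ?thesis using unitary1[OF pq(3) p(1) q(1)] pe True by simp
  next
    case False
    then have "(\<Oplus>k\<in>{1..N}. (u g ?p k \<otimes> (if ?r = ?s then \<one> else \<zero>)) \<otimes> star A (u g ?q k)) = (\<Oplus>k\<in>{1..N}. \<zero>)"
      using p q pq by (intro finsum_cong') auto
    then show ?thesis using pe False by simp
  qed
  finally show ?case .
qed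

lemma unitary2_U:
  "set gs \<subseteq> G \<Longrightarrow> p < msize gs \<Longrightarrow> q < msize gs \<Longrightarrow>
    (\<Oplus>k\<in>{..<msize gs}. star A (U gs k p) \<otimes> U gs k q) = (if p = q then \<one> else \<zero>)"
proof (induction gs arbitrary: p q)
  case Nil
  then show ?case by (simp add: finsum_insert[of "{}"] lessThan_Suc)
next
  case (Cons g gs)
  let ?n = "msize gs"
  have pq: "p < N * ?n" "q < N * ?n" "g \<in> G" "set gs \<subseteq> G" using Cons.prems by auto
  note p = div_mod_less[OF pq(1)] and q = div_mod_less[OF pq(2)]
  let ?p = "p div ?n + 1" and ?q = "q div ?n + 1" and ?r = "p mod ?n" and ?s = "q mod ?n"
  let ?f = "\<lambda>k l. star A (u g k ?p \<otimes> U gs l ?r) \<otimes> (u g k ?q \<otimes> U gs l ?s)"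
  have pe: "p = q \<longleftrightarrow> ?p = ?q \<and> ?r = ?s" by (metis add_right_cancel div_mult_mod_eq)
  have "(\<Oplus>k\<in>{..<msize (g # gs)}. star A (U (g # gs) k p) \<otimes> U (g # gs) k q) =
      (\<Oplus>k\<in>{..<N * ?n}. ?f (k div ?n + 1) (k mod ?n))" by simp
  also have "\<dots> = (\<Oplus>k\<in>{1..N}. \<Oplus>l\<in>{..<?n}. ?f k l)"
    using p q pq by (intro finsum_div_mod) auto
  \<comment> \<open>With the adjoint on the left it is the two entries of \<open>u g\<close> that
    meet in the middle, so the sum over their index has to become the inner one.\<close>
  also have "\<dots> = (\<Oplus>l\<in>{..<?n}. \<Oplus>k\<in>{1..N}. ?f k l)"
    using p q pq by (intro finsum_swap) auto
  also have "\<dots> = (\<Oplus>l\<in>{..<?n}. (star A (U gs l ?r) \<otimes> (if ?p = ?q then \<one> else \<zero>)) \<otimes> U gs l ?s)"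
  proof (intro finsum_cong' refl)
    fix l assume l: "l \<in> {..<?n}"
    have "(\<Oplus>k\<in>{1..N}. ?f k l) = (\<Oplus>k\<in>{1..N}. (star A (U gs l ?r) \<otimes> (star A (u g k ?p) \<otimes> u g k ?q)) \<otimes> U gs l ?s)"
      using p q pq l by (intro finsum_cong') (auto simp: star_mult m_assoc)
    also have "\<dots> = (star A (U gs l ?r) \<otimes> (\<Oplus>k\<in>{1..N}. star A (u g k ?p) \<otimes> u g k ?q)) \<otimes> U gs l ?s"
      using p q pq l by (subst finsum_rdistr) (auto intro!: finsum_ldistr[symmetric])
    finally show "(\<Oplus>k\<in>{1..N}. ?f k l) = (star A (U gs l ?r) \<otimes> (if ?p = ?q then \<one> else \<zero>)) \<otimes> U gs l ?s"
      using p q pq unitary2[OF pq(3) p(1) q(1)] by simp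
  qed (use p q pq in auto)
  also have "\<dots> = (if p = q then \<one> else \<zero>)"
  proof (cases "?p = ?q")
    case True
    then have "(\<Oplus>l\<in>{..<?n}. (star A (U gs l ?r) \<otimes> (if ?p = ?q then \<one> else \<zero>)) \<otimes> U gs l ?s) =
      (\<Oplus>l\<in>{..<?n}. star A (U gs l ?r) \<otimes> U gs l ?s)"
      using p q pq by (intro finsum_cong') auto
    then show ?thesis using Cons.IH[OF pq(4) p(2) q(2)] pe True by simp
  next
    case False
    then have "(\<Oplus>l\<in>{..<?n}. (star A (U gs l ?r) \<otimes> (if ?p = ?q then \<one> else \<zero>)) \<otimes> U gs l ?s) = (\<Oplus>l\<in>{..<?n}. \<zero>)"
      using p q pq by (intro finsum_cong') auto
    then show ?thesis using pe False by simp
  qed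
  finally show ?case .
qed

definition "entries = {U gs p q | gs p q. set gs \<subseteq> G \<and> p < msize gs \<and> q < msize gs}"

lemma entries_closed: "entries \<subseteq> carrier A"
  by (auto simp: entries_def)

lemma entries_span: "carrier A = lin_span A entries"
proof
  let ?gens = "{u g i j | g i j. g \<in> G \<and> i \<in> {1..N} \<and> j \<in> {1..N}}"
  have "carrier A = lin_span A (products A ?gens)"
    by (rule generates_span[OF generates]) (use star_u ginv in blast)
  moreover have "lin_span A (products A ?gens) \<subseteq> lin_span A entries"
  proof (rule lin_span_mono_submodule[OF lin_span_submodule[OF entries_closed]])
    have "products A ?gens \<subseteq> entries"
      using products_mat[of _ A u G N] unfolding entries_def by blast
    then show "products A ?gens \<subseteq> lin_span A entries" using lin_span_superset by blast
  qed
  ultimately show "carrier A \<subseteq> lin_span A entries" by simp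
  show "lin_span A entries \<subseteq> carrier A"
    by (rule lin_span_mono_submodule[OF submodule_carrier entries_closed])
qed

text \<open>The entries span linearly, so neither map has to be multiplicative. This matters because
  the Hopf axioms compare maps, such as those contracting a coproduct with an antipode, that are
  only linear.\<close>

lemma lin_maps_entries_eq:
  assumes C: "csa C" and F: "F \<in> lin_maps A C" and H: "H \<in> lin_maps A C"
    and eq: "\<And>gs p q. set gs \<subseteq> G \<Longrightarrow> p < msize gs \<Longrightarrow> q < msize gs \<Longrightarrow> F (U gs p q) = H (U gs p q)"
    and x: "x \<in> carrier A"
  shows "F x = H x"
proof -
  interpret C: csa C by (rule C)
  have "lin_span A entries \<subseteq> {x \<in> carrier A. F x = H x}"
  proof (rule lin_span_mono_submodule)
    show "submodule {x \<in> carrier A. F x = H x} CC A"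
      unfolding submodule_iff
      by (auto simp: lin_mapsD[OF F] lin_mapsD[OF H] lin_maps_zero[OF csa_axioms C F] lin_maps_zero[OF csa_axioms C H])
    show "entries \<subseteq> {x \<in> carrier A. F x = H x}"
      using eq entries_closed by (auto simp: entries_def)
  qed
  then show ?thesis using x entries_span by blast
qed

section \<open>Counit and antipode\<close>

lemmas comult_lin = star_homsD(1)[OF comult_hom]

lemma lift_comult_U:
  assumes C: "csa C" and \<beta>: "bilin A A C \<beta>" and gs: "set gs \<subseteq> G" "p < msize gs" "q < msize gs"
  shows "tensor_lift A A C \<beta> (comult A (U gs p q)) = (\<Oplus>\<^bsub>C\<^esub>k\<in>{..<msize gs}. \<beta> (U gs p k) (U gs k q))"
proof -
  interpret C: csa C by (rule C)
  note L = AA.tensor_lift[OF C \<beta>]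
  have "tensor_lift A A C \<beta> (comult A (U gs p q)) =
      (\<Oplus>\<^bsub>C\<^esub>k\<in>{..<msize gs}. tensor_lift A A C \<beta> (tA (U gs p k) (U gs k q)))"
    unfolding comult_U[OF gs] using gs by (intro lin_maps_finsum[OF T.csa_axioms C L(1)]) auto
  also have "\<dots> = (\<Oplus>\<^bsub>C\<^esub>k\<in>{..<msize gs}. \<beta> (U gs p k) (U gs k q))"
    using gs by (intro C.finsum_cong') (auto simp: L(2) bilinD[OF \<beta>])
  finally show ?thesis .
qed

text \<open>\<open>is_counit\<close> and \<open>is_antipode\<close> also fix the values off the
  carrier, which the given \<open>\<epsilon>\<close> and \<open>S\<close> need not respect.\<close>

definition "\<epsilon>' = restrict \<epsilon> (carrier A)"
definition "S' = restrict S (carrier A)"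

lemma \<epsilon>'_lin: "\<epsilon>' \<in> lin_maps A complex_alg"
  using star_homsD(1)[OF \<epsilon>_hom] by (auto simp: \<epsilon>'_def lin_maps_def)

lemma S'_lin: "S' \<in> lin_maps A A"
  using star_homsD(1)[OF S_hom] by (auto simp: S'_def lin_maps_def Pi_iff)

lemma \<epsilon>'_U: "set gs \<subseteq> G \<Longrightarrow> p < msize gs \<Longrightarrow> q < msize gs \<Longrightarrow> \<epsilon>' (U gs p q) = (if p = q then 1 else 0)"
  by (simp add: \<epsilon>'_def \<epsilon>_U)

lemma S'_U: "set gs \<subseteq> G \<Longrightarrow> p < msize gs \<Longrightarrow> q < msize gs \<Longrightarrow> S' (U gs p q) = star A (U gs q p)"
  by (simp add: S'_def S_U)

lemma bilin_counit:
  assumes "e \<in> lin_maps A complex_alg"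
  shows "bilin A A A (\<lambda>a b. e a \<odot> b)" "bilin A A A (\<lambda>a b. e b \<odot> a)"
  by (intro bilinI lin_maps_smult_fun[OF csa_axioms assms] lin_maps_smult; assumption)+

lemma is_counit_\<epsilon>': "is_counit A \<epsilon>'"
  unfolding is_counit_def
proof (intro conjI ballI allI)
  fix x assume x: "x \<in> carrier A"
  note b = bilin_counit[OF \<epsilon>'_lin]
  show "tensor_lift A A A (\<lambda>a b. \<epsilon>' a \<odot> b) (comult A x) = x"
  proof (rule lin_maps_entries_eq[OF csa_axioms lin_maps_comp[OF comult_lin AA.tensor_lift(1)[OF csa_axioms b(1)]] lin_maps_id _ x])
    fix gs p q assume gs: "set gs \<subseteq> G" "p < msize gs" "q < msize gs"
    have "tensor_lift A A A (\<lambda>a b. \<epsilon>' a \<odot> b) (comult A (U gs p q)) = (\<Oplus>k\<in>{..<msize gs}. \<epsilon>' (U gs p k) \<odot> U gs k q)"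
      by (rule lift_comult_U[OF csa_axioms b(1) gs])
    also have "\<dots> = (\<Oplus>k\<in>{..<msize gs}. if p = k then U gs k q else \<zero>)"
      using gs by (intro finsum_cong') (auto simp: \<epsilon>'_U)
    also have "\<dots> = U gs p q" using gs by (intro finsum_delta') auto
    finally show "tensor_lift A A A (\<lambda>a b. \<epsilon>' a \<odot> b) (comult A (U gs p q)) = U gs p q" .
  qed
  show "tensor_lift A A A (\<lambda>a b. \<epsilon>' b \<odot> a) (comult A x) = x"
  proof (rule lin_maps_entries_eq[OF csa_axioms lin_maps_comp[OF comult_lin AA.tensor_lift(1)[OF csa_axioms b(2)]] lin_maps_id _ x])
    fix gs p q assume gs: "set gs \<subseteq> G" "p < msize gs" "q < msize gs"
    have "tensor_lift A A A (\<lambda>a b. \<epsilon>' b \<odot> a) (comult A (U gs p q)) = (\<Oplus>k\<in>{..<msize gs}. \<epsilon>' (U gs k q) \<odot> U gs p k)"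
      by (rule lift_comult_U[OF csa_axioms b(2) gs])
    also have "\<dots> = (\<Oplus>k\<in>{..<msize gs}. if k = q then U gs p k else \<zero>)"
      using gs by (intro finsum_cong') (auto simp: \<epsilon>'_U)
    also have "\<dots> = U gs p q" using gs by (intro finsum_delta) auto
    finally show "tensor_lift A A A (\<lambda>a b. \<epsilon>' b \<odot> a) (comult A (U gs p q)) = U gs p q" .
  qed
qed (use lin_mapsD[OF \<epsilon>'_lin] in \<open>auto simp: \<epsilon>'_def\<close>)

text \<open>Apply \<open>e\<close> to the first leg and \<open>\<epsilon>'\<close> to the second leg
  of the coproduct of \<open>x\<close>. Contracting the first leg first leaves
  \<open>\<epsilon>' x\<close>; contracting the second leg first leaves \<open>e x\<close>.\<close>

lemma is_counit_unique:
  assumes "is_counit A e"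
  shows "e = \<epsilon>'"
proof (rule extensionalityI)
  show "e \<in> extensional (carrier A)" using assms by (simp add: is_counit_def)
  show "\<epsilon>' \<in> extensional (carrier A)" by (simp add: \<epsilon>'_def)
  fix x assume x: "x \<in> carrier A"
  have e: "e \<in> lin_maps A complex_alg" using assms by (auto simp: is_counit_def lin_maps_def)
  note L1 = AA.tensor_lift[OF csa_axioms bilin_counit(1)[OF e]]
  note L2 = AA.tensor_lift[OF csa_axioms bilin_counit(2)[OF \<epsilon>'_lin]]
  have "\<epsilon>' (tensor_lift A A A (\<lambda>a b. e a \<odot> b) z) = e (tensor_lift A A A (\<lambda>a b. \<epsilon>' b \<odot> a) z)"
    if "z \<in> carrier TA" for z
    by (rule AA.lin_maps_tens_eq[OF csa_complex_alg lin_maps_comp[OF L1(1) \<epsilon>'_lin] lin_maps_comp[OF L2(1) e] _ that])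
      (simp add: L1(2) L2(2) lin_mapsD(3)[OF e, unfolded complex_alg_simps] lin_mapsD(3)[OF \<epsilon>'_lin, unfolded complex_alg_simps])
  from this[OF lin_mapsD(1)[OF comult_lin x]] show "e x = \<epsilon>' x"
    using assms is_counit_\<epsilon>' x by (simp add: is_counit_def)
qed

lemma counit_eq: "counit A = \<epsilon>'"
  unfolding counit_def using is_counit_\<epsilon>' is_counit_unique by (rule the_equality)

lemma bilin_antipode:
  assumes "s \<in> lin_maps A A"
  shows "bilin A A A (\<lambda>a b. s a \<otimes> b)" "bilin A A A (\<lambda>a b. a \<otimes> s b)"
  using bilin_comp[OF bilin_mult assms lin_maps_id lin_maps_id] bilin_comp[OF bilin_mult lin_maps_id assms lin_maps_id]
  by auto

lemma is_antipode_S': "is_antipode A S'"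
  unfolding is_antipode_def counit_eq
proof (intro conjI ballI IntI)
  fix x assume x: "x \<in> carrier A"
  note b = bilin_antipode[OF S'_lin]
  note c = lin_maps_smult_fun[OF csa_axioms \<epsilon>'_lin one_closed]
  show "tensor_lift A A A (\<lambda>a b. S' a \<otimes> b) (comult A x) = \<epsilon>' x \<odot> \<one>"
  proof (rule lin_maps_entries_eq[OF csa_axioms lin_maps_comp[OF comult_lin AA.tensor_lift(1)[OF csa_axioms b(1)]] c _ x])
    fix gs p q assume gs: "set gs \<subseteq> G" "p < msize gs" "q < msize gs"
    have "tensor_lift A A A (\<lambda>a b. S' a \<otimes> b) (comult A (U gs p q)) = (\<Oplus>k\<in>{..<msize gs}. S' (U gs p k) \<otimes> U gs k q)"
      by (rule lift_comult_U[OF csa_axioms b(1) gs])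
    also have "\<dots> = (\<Oplus>k\<in>{..<msize gs}. star A (U gs k p) \<otimes> U gs k q)"
      using gs by (intro finsum_cong') (auto simp: S'_U)
    finally show "tensor_lift A A A (\<lambda>a b. S' a \<otimes> b) (comult A (U gs p q)) = \<epsilon>' (U gs p q) \<odot> \<one>"
      using gs by (simp add: unitary2_U \<epsilon>'_U)
  qed
  show "tensor_lift A A A (\<lambda>a b. a \<otimes> S' b) (comult A x) = \<epsilon>' x \<odot> \<one>"
  proof (rule lin_maps_entries_eq[OF csa_axioms lin_maps_comp[OF comult_lin AA.tensor_lift(1)[OF csa_axioms b(2)]] c _ x])
    fix gs p q assume gs: "set gs \<subseteq> G" "p < msize gs" "q < msize gs"
    have "tensor_lift A A A (\<lambda>a b. a \<otimes> S' b) (comult A (U gs p q)) = (\<Oplus>k\<in>{..<msize gs}. U gs p k \<otimes> S' (U gs k q))"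
      by (rule lift_comult_U[OF csa_axioms b(2) gs])
    also have "\<dots> = (\<Oplus>k\<in>{..<msize gs}. U gs p k \<otimes> star A (U gs q k))"
      using gs by (intro finsum_cong') (auto simp: S'_U)
    finally show "tensor_lift A A A (\<lambda>a b. a \<otimes> S' b) (comult A (U gs p q)) = \<epsilon>' (U gs p q) \<odot> \<one>"
      using gs by (simp add: unitary1_U \<epsilon>'_U)
  qed
qed (use S'_lin in \<open>auto simp: S'_def\<close>)

text \<open>A left inverse of the invertible matrix \<open>U gs\<close> is its adjoint, so antipodes agree on its entries.\<close>

lemma is_antipode_unique:
  assumes "is_antipode A s"
  shows "s = S'"
proof (rule extensionalityI)
  show "s \<in> extensional (carrier A)" using assms by (simp add: is_antipode_def)
  show "S' \<in> extensional (carrier A)" by (simp add: S'_def)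
  fix x assume x: "x \<in> carrier A"
  have s: "s \<in> lin_maps A A" using assms by (simp add: is_antipode_def)
  note sc = lin_mapsD(1)[OF s]
  show "s x = S' x"
  proof (rule lin_maps_entries_eq[OF csa_axioms s S'_lin _ x])
    fix gs p q assume gs: "set gs \<subseteq> G" "p < msize gs" "q < msize gs"
    let ?D = "{..<msize gs}"
    have inv: "(\<Oplus>k\<in>?D. s (U gs p k) \<otimes> U gs k j) = (if p = j then \<one> else \<zero>)" if j: "j < msize gs" for j
    proof -
      have "(\<Oplus>k\<in>?D. s (U gs p k) \<otimes> U gs k j) = tensor_lift A A A (\<lambda>a b. s a \<otimes> b) (comult A (U gs p j))"
        by (rule lift_comult_U[OF csa_axioms bilin_antipode(1)[OF s] gs(1,2) j, symmetric])
      also have "\<dots> = counit A (U gs p j) \<odot> \<one>"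
        using assms gs j by (simp add: is_antipode_def)
      finally show ?thesis using gs j by (simp add: counit_eq \<epsilon>'_U)
    qed
    \<comment> \<open>The \<open>p\<close>, \<open>q\<close> entry of the product of three matrices,
      \<open>s\<close> applied to \<open>U gs\<close>, \<open>U gs\<close> itself and its adjoint,
      is evaluated with both bracketings.\<close>
    have "(\<Oplus>j\<in>?D. (\<Oplus>k\<in>?D. s (U gs p k) \<otimes> U gs k j) \<otimes> star A (U gs q j)) =
        (\<Oplus>j\<in>?D. \<Oplus>k\<in>?D. s (U gs p k) \<otimes> (U gs k j \<otimes> star A (U gs q j)))"
      using gs by (intro finsum_cong') (auto simp: finsum_ldistr sc m_assoc intro!: finsum_closed finsum_cong')
    also have "\<dots> = (\<Oplus>k\<in>?D. \<Oplus>j\<in>?D. s (U gs p k) \<otimes> (U gs k j \<otimes> star A (U gs q j)))"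
      using gs by (intro finsum_swap) (auto simp: sc)
    also have "\<dots> = (\<Oplus>k\<in>?D. s (U gs p k) \<otimes> (\<Oplus>j\<in>?D. U gs k j \<otimes> star A (U gs q j)))"
      using gs by (intro finsum_cong') (auto simp: finsum_rdistr sc intro!: finsum_closed)
    also have "\<dots> = (\<Oplus>k\<in>?D. if k = q then s (U gs p k) else \<zero>)"
      using gs by (intro finsum_cong') (auto simp: unitary1_U sc)
    also have "\<dots> = s (U gs p q)" using gs sc by (intro finsum_delta) auto
    finally have "s (U gs p q) = (\<Oplus>j\<in>?D. (\<Oplus>k\<in>?D. s (U gs p k) \<otimes> U gs k j) \<otimes> star A (U gs q j))" ..
    also have "\<dots> = (\<Oplus>j\<in>?D. if p = j then star A (U gs q j) else \<zero>)"
      using gs by (intro finsum_cong') (auto simp: inv)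
    also have "\<dots> = star A (U gs q p)" using gs by (intro finsum_delta') auto
    finally show "s (U gs p q) = S' (U gs p q)" using gs by (simp add: S'_U)
  qed
qed

lemma antipode_eq: "antipode A = S'"
  unfolding antipode_def using is_antipode_S' is_antipode_unique by (rule the_equality)

text \<open>On the entry \<open>U gs p q\<close> both sides are the sum over \<open>k\<close> and
  \<open>l\<close> of the threefold tensors of \<open>U gs p l\<close>, \<open>U gs l k\<close> and
  \<open>U gs k q\<close>; they differ in the order of summation.\<close>

lemma coassoc:
  assumes x: "x \<in> carrier A"
  shows "tensor_assoc A A A (tensor_map A A TA A (comult A) (\<lambda>y. y) (comult A x)) =
    tensor_map A A A TA (\<lambda>y. y) (comult A) (comult A x)"
proof -
  interpret A_TA: csa_pair A TA by (intro csa_pairI csa_axioms T.csa_axioms)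
  interpret TA_A: csa_pair TA A by (intro csa_pairI csa_axioms T.csa_axioms)
  let ?Z = "tensor_alg A TA"
  interpret Z: csa ?Z by (rule A_TA.csa_tensor)
  interpret Y: csa "tensor_alg TA A" by (rule TA_A.csa_tensor)
  note c = csa_axioms and tc = T.csa_axioms and zc = Z.csa_axioms
  note m1 = tensor_map_lin[OF c c tc c comult_lin lin_maps_id] and m1t = tensor_map_tens[OF c c tc c comult_lin lin_maps_id]
  note m2 = tensor_map_lin[OF c c c tc lin_maps_id comult_lin] and m2t = tensor_map_tens[OF c c c tc lin_maps_id comult_lin]
  note as = tensor_assoc_lin[OF c c c] and ast = tensor_assoc_tens[OF c c c]
  show ?thesis
  proof (rule lin_maps_entries_eq[OF zc lin_maps_comp[OF comult_lin lin_maps_comp[OF m1 as]] lin_maps_comp[OF comult_lin m2] _ x])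
    fix gs p q assume gs: "set gs \<subseteq> G" "p < msize gs" "q < msize gs"
    let ?D = "{..<msize gs}"
    let ?t = "\<lambda>k l. tens A TA (U gs p l) (tA (U gs l k) (U gs k q))"
    have "tensor_assoc A A A (tensor_map A A TA A (comult A) (\<lambda>y. y) (comult A (U gs p q))) =
        (\<Oplus>\<^bsub>?Z\<^esub>k\<in>?D. tensor_assoc A A A (tensor_map A A TA A (comult A) (\<lambda>y. y) (tA (U gs p k) (U gs k q))))"
      unfolding comult_U[OF gs]
      using gs by (intro lin_maps_finsum[OF tc zc lin_maps_comp[OF m1 as]]) auto
    also have "\<dots> = (\<Oplus>\<^bsub>?Z\<^esub>k\<in>?D. \<Oplus>\<^bsub>?Z\<^esub>l\<in>?D. ?t k l)"
    proof (intro Z.finsum_cong' refl)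
      fix k assume k: "k \<in> ?D"
      have "tensor_assoc A A A (tensor_map A A TA A (comult A) (\<lambda>y. y) (tA (U gs p k) (U gs k q))) =
          tensor_assoc A A A (tens TA A (\<Oplus>\<^bsub>TA\<^esub>l\<in>?D. tA (U gs p l) (U gs l k)) (U gs k q))"
        using gs k by (simp add: m1t comult_U)
      also have "\<dots> = (\<Oplus>\<^bsub>?Z\<^esub>l\<in>?D. tensor_assoc A A A (tens TA A (tA (U gs p l) (U gs l k)) (U gs k q)))"
        using gs k
        by (intro lin_maps_finsum[OF tc zc lin_maps_comp[OF bilinD(2)[OF TA_A.tens_bilin] as]]) auto
      also have "\<dots> = (\<Oplus>\<^bsub>?Z\<^esub>l\<in>?D. ?t k l)"
        using gs k by (intro Z.finsum_cong') (auto simp: ast)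
      finally show "tensor_assoc A A A (tensor_map A A TA A (comult A) (\<lambda>y. y) (tA (U gs p k) (U gs k q))) =
        (\<Oplus>\<^bsub>?Z\<^esub>l\<in>?D. ?t k l)" .
    qed (use gs in \<open>auto intro!: Z.finsum_closed\<close>)
    also have "\<dots> = (\<Oplus>\<^bsub>?Z\<^esub>l\<in>?D. \<Oplus>\<^bsub>?Z\<^esub>k\<in>?D. ?t k l)"
      using gs by (intro Z.finsum_swap) auto
    also have "\<dots> = (\<Oplus>\<^bsub>?Z\<^esub>l\<in>?D. tensor_map A A A TA (\<lambda>y. y) (comult A) (tA (U gs p l) (U gs l q)))"
    proof (intro Z.finsum_cong' refl)
      fix l assume l: "l \<in> ?D"
      have "tensor_map A A A TA (\<lambda>y. y) (comult A) (tA (U gs p l) (U gs l q)) =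
          tens A TA (U gs p l) (\<Oplus>\<^bsub>TA\<^esub>k\<in>?D. tA (U gs l k) (U gs k q))"
        using gs l by (simp add: m2t comult_U)
      also have "\<dots> = (\<Oplus>\<^bsub>?Z\<^esub>k\<in>?D. ?t k l)"
        using gs l by (intro lin_maps_finsum[OF tc zc bilinD(1)[OF A_TA.tens_bilin]]) auto
      finally show "(\<Oplus>\<^bsub>?Z\<^esub>k\<in>?D. ?t k l) = tensor_map A A A TA (\<lambda>y. y) (comult A) (tA (U gs p l) (U gs l q))" ..
    qed (use gs in \<open>auto intro!: lin_mapsD(1)[OF m2]\<close>)
    also have "\<dots> = tensor_map A A A TA (\<lambda>y. y) (comult A) (comult A (U gs p q))"
      unfolding comult_U[OF gs]
      using gs by (intro lin_maps_finsum[OF tc zc m2, symmetric]) auto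
    finally show "tensor_assoc A A A (tensor_map A A TA A (comult A) (\<lambda>y. y) (comult A (U gs p q))) =
        tensor_map A A A TA (\<lambda>y. y) (comult A) (comult A (U gs p q))" .
  qed
qed

theorem hopf: "hopf_star_algebra A"
  unfolding hopf_star_algebra_def
proof (intro conjI ballI coassoc exI)
  show "complex_star_algebra A" by (rule csa)
  show "comult A \<in> star_homs A TA" by (rule comult_hom)
  show "is_counit A \<epsilon>'" by (rule is_counit_\<epsilon>')
  show "is_antipode A S'" by (rule is_antipode_S')
qed (simp_all add: \<epsilon>'_def star_homsD[OF \<epsilon>_hom])

lemma unitary_corep_U: "set gs \<subseteq> G \<Longrightarrow> unitary_corep A (msize gs) (U gs)"
  unfolding unitary_corep_def
  by (auto simp: comult_U counit_eq \<epsilon>'_U unitary1_U unitary2_U)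

text \<open>The entries of the unitary corepresentations \<open>U gs\<close> already span, so all
  coefficients together do.\<close>

theorem cqg: "cqg_algebra A"
proof -
  let ?C = "{v i j | n v i j. unitary_corep A n v \<and> i < n \<and> j < n}"
  have "lin_span A ?C \<subseteq> carrier A"
    by (rule lin_span_mono_submodule[OF submodule_carrier]) (auto simp: unitary_corep_def)
  moreover have "entries \<subseteq> ?C"
    unfolding entries_def using unitary_corep_U by blast
  then have "lin_span A entries \<subseteq> lin_span A ?C" unfolding lin_span_def by auto
  ultimately show ?thesis
    unfolding cqg_algebra_def using hopf entries_span by blast
qed

end

section \<open>Star subalgebras, star ideals and generating sets\<close>

lemma (in csa) star_subalgebra_iff:
  "star_subalgebra A T \<longleftrightarrow> T \<subseteq> carrier A \<and> \<zero> \<in> T \<and> \<one> \<in> T \<and> (\<forall>x\<in>T. \<forall>y\<in>T. x \<oplus> y \<in> T \<and> x \<otimes> y \<in> T) \<and>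
    (\<forall>c. \<forall>x\<in>T. c \<odot> x \<in> T) \<and> (\<forall>x\<in>T. star A x \<in> T)" (is "_ \<longleftrightarrow> ?R")
proof
  assume "star_subalgebra A T"
  then show ?R using subringE[of T A] by (auto simp: star_subalgebra_def submodule_iff)
next
  assume R: ?R
  then have s: "submodule T CC A" by (auto simp: submodule_iff)
  have "subring T A"
    by (rule subringI) (use R module.submoduleE(3)[OF mod s] in auto)
  then show "star_subalgebra A T" using R s by (auto simp: star_subalgebra_def)
qed

lemma (in csa) star_ideal_iff:
  "star_ideal A I \<longleftrightarrow> I \<subseteq> carrier A \<and> \<zero> \<in> I \<and> (\<forall>x\<in>I. \<forall>y\<in>I. x \<oplus> y \<in> I) \<and> (\<forall>c. \<forall>x\<in>I. c \<odot> x \<in> I) \<and>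
    (\<forall>x\<in>I. \<forall>y\<in>carrier A. y \<otimes> x \<in> I \<and> x \<otimes> y \<in> I) \<and> (\<forall>x\<in>I. star A x \<in> I)" (is "_ \<longleftrightarrow> ?R")
proof
  assume a: "star_ideal A I"
  then have i: "ideal I A" by (simp add: star_ideal_def)
  show ?R using a ideal_facts[OF i] by (auto simp: star_ideal_def)
next
  assume R: ?R
  have "ideal I A" by (rule idealI_smult) (use R in auto)
  then show "star_ideal A I" using R by (simp add: star_ideal_def)
qed

text \<open>The equalizer of two star homomorphisms is a star subalgebra.\<close>

lemma star_homs_generates_eq:
  assumes "csa A" "csa B" "generates A S" "f \<in> star_homs A B" "h \<in> star_homs A B"
    and "\<And>s. s \<in> S \<Longrightarrow> f s = h s" and "x \<in> carrier A"
  shows "f x = h x"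
proof -
  interpret A: csa A by fact
  interpret B: csa B by fact
  note z = lin_maps_zero[OF assms(1,2) star_homsD(1)]
  have "star_subalgebra A {x \<in> carrier A. f x = h x}"
    unfolding A.star_subalgebra_iff
    by (auto simp: star_homsD(2-)[OF assms(4)] star_homsD(2-)[OF assms(5)] z[OF assms(4)] z[OF assms(5)])
  then show ?thesis using assms(3,6,7) unfolding generates_def by blast
qed

lemma generates_image:
  assumes "csa A" "csa B" "generates A S" "f \<in> star_homs A B" "f ` carrier A = carrier B"
  shows "generates B (f ` S)"
  unfolding generates_def
proof (intro conjI allI impI)
  interpret A: csa A by fact
  interpret B: csa B by fact
  have S: "S \<subseteq> carrier A" using assms(3) by (simp add: generates_def)
  then show "f ` S \<subseteq> carrier B" using assms(5) by auto
  fix T assume T: "star_subalgebra B T \<and> f ` S \<subseteq> T"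
  note T' = conjunct1[OF T, unfolded B.star_subalgebra_iff]
  have "star_subalgebra A {x \<in> carrier A. f x \<in> T}"
    unfolding A.star_subalgebra_iff using T'
    by (auto simp: star_homsD(2-)[OF assms(4)] lin_maps_zero[OF assms(1,2) star_homsD(1)[OF assms(4)]])
  then have "carrier A \<subseteq> {x \<in> carrier A. f x \<in> T}"
    using assms(3) T S unfolding generates_def by blast
  then show "carrier B \<subseteq> T" unfolding assms(5)[symmetric] by blast
qed

section \<open>Changing the coproduct\<close>

text \<open>The tensor constructions never read the coproduct. The rewrite rules of this section let
  everything proved for a bare star algebra, including facts about the target of a coproduct, be
  used after the coproduct has been attached.\<close>

lemma with_comult_simps [simp]:
  "carrier (with_comult A \<Delta>) = carrier A" "monoid.mult (with_comult A \<Delta>) = monoid.mult A"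
  "\<one>\<^bsub>with_comult A \<Delta>\<^esub> = \<one>\<^bsub>A\<^esub>" "\<zero>\<^bsub>with_comult A \<Delta>\<^esub> = \<zero>\<^bsub>A\<^esub>"
  "add (with_comult A \<Delta>) = add A" "module.smult (with_comult A \<Delta>) = module.smult A"
  "star (with_comult A \<Delta>) = star A" "comult (with_comult A \<Delta>) = \<Delta>"
  by (simp_all add: with_comult_def)

lemma csa_with_comult:
  assumes "csa A"
  shows "csa (with_comult A \<Delta>)"
proof -
  interpret csa A by fact
  show ?thesis
    by (unfold_locales, rule complex_star_algebraI)
      (auto simp: a_assoc a_comm a_lcomm m_assoc l_distr r_distr smult_add add_smult smult_smult
        smult_mult_l smult_mult_r star_add star_smult star_mult)
qed

lemma lin_maps_with_comult [simp]: "lin_maps (with_comult A \<Delta>) B = lin_maps A B"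
  "lin_maps B (with_comult A \<Delta>) = lin_maps B A"
  by (simp_all add: lin_maps_def)

lemma star_homs_with_comult [simp]: "star_homs (with_comult A \<Delta>) B = star_homs A B"
  "star_homs B (with_comult A \<Delta>) = star_homs B A"
  by (simp_all add: star_homs_def ring_hom_def)

lemma finsum_with_comult [simp]: "finsum (with_comult A \<Delta>) f S = finsum A f S"
  by (simp add: finsum_def finprod_def)

lemma pre_tensor_with_comult [simp]: "pre_tensor (with_comult A \<Delta>) B = pre_tensor A B"
  "pre_tensor A (with_comult B \<Delta>') = pre_tensor A B"
  by (simp_all add: pre_tensor_def monoid_alg_def DirProd_def)

lemma tensor_kernel_with_comult [simp]: "tensor_kernel (with_comult A \<Delta>) B = tensor_kernel A B"
  "tensor_kernel A (with_comult B \<Delta>') = tensor_kernel A B"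
  by (simp_all add: tensor_kernel_def bilinear_relators_def)

lemma tensor_alg_with_comult [simp]: "tensor_alg (with_comult A \<Delta>) B = tensor_alg A B"
  "tensor_alg A (with_comult B \<Delta>') = tensor_alg A B"
  by (simp_all add: tensor_alg_def)

lemma tens_with_comult [simp]: "tens (with_comult A \<Delta>) B = tens A B"
  "tens A (with_comult B \<Delta>') = tens A B"
  by (simp_all add: tens_def fun_eq_iff)

lemma tensor_lift_with_comult [simp]: "tensor_lift (with_comult A \<Delta>) B C \<beta> = tensor_lift A B C \<beta>"
  "tensor_lift A (with_comult B \<Delta>1) C \<beta> = tensor_lift A B C \<beta>"
  "tensor_lift A B (with_comult C \<Delta>2) \<beta> = tensor_lift A B C \<beta>"
  by (simp_all add: tensor_lift_def)

lemma tensor_map_with_comult [simp]: "tensor_map (with_comult A \<Delta>) B C D f g = tensor_map A B C D f g"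
  "tensor_map A (with_comult B \<Delta>1) C D f g = tensor_map A B C D f g"
  "tensor_map A B (with_comult C \<Delta>2) D f g = tensor_map A B C D f g"
  "tensor_map A B C (with_comult D \<Delta>3) f g = tensor_map A B C D f g"
  by (simp_all add: tensor_map_def)

lemma star_homs_op_with_comult [simp]: "star_homs B (op_alg (with_comult A \<Delta>)) = star_homs B (op_alg A)"
  by (simp add: star_homs_def ring_hom_def)

lemma generates_with_comult:
  assumes "csa A"
  shows "generates (with_comult A \<Delta>) S \<longleftrightarrow> generates A S"
  by (simp add: generates_def csa.star_subalgebra_iff[OF assms] csa.star_subalgebra_iff[OF csa_with_comult[OF assms]])

section \<open>Families satisfying the relations of the free wreath product\<close>

text \<open>A family in an arbitrary star algebra that satisfies the defining relations. Coproduct,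
  counit and antipode of O(H_N^+(G)), and the map on it that leads to the left inverse of
  \<open>\<phi>\<close>, are all obtained by exhibiting such a family.\<close>

definition H_family :: "('b, 'k) star_alg_scheme \<Rightarrow> nat \<Rightarrow> ('g, 'm) monoid_scheme \<Rightarrow> (nat \<Rightarrow> nat \<Rightarrow> 'g \<Rightarrow> 'b) \<Rightarrow> bool"
  where "H_family B N G b \<longleftrightarrow>
    (\<forall>i\<in>{1..N}. \<forall>j\<in>{1..N}. \<forall>g\<in>carrier G. b i j g \<in> carrier B \<and> star B (b i j g) = b i j (inv\<^bsub>G\<^esub> g)) \<and>
    (\<forall>i\<in>{1..N}. \<forall>j\<in>{1..N}. \<forall>k\<in>{1..N}. \<forall>g\<in>carrier G. \<forall>h\<in>carrier G.
      b i j g \<otimes>\<^bsub>B\<^esub> b i k h = (if j = k then b i j (g \<otimes>\<^bsub>G\<^esub> h) else \<zero>\<^bsub>B\<^esub>) \<and>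
      b j i g \<otimes>\<^bsub>B\<^esub> b k i h = (if j = k then b j i (g \<otimes>\<^bsub>G\<^esub> h) else \<zero>\<^bsub>B\<^esub>)) \<and>
    (\<forall>i\<in>{1..N}. (\<Oplus>\<^bsub>B\<^esub>k\<in>{1..N}. b i k \<one>\<^bsub>G\<^esub>) = \<one>\<^bsub>B\<^esub> \<and> (\<Oplus>\<^bsub>B\<^esub>k\<in>{1..N}. b k i \<one>\<^bsub>G\<^esub>) = \<one>\<^bsub>B\<^esub>)"

lemma H_familyI:
  assumes "\<And>i j g. i \<in> {1..N} \<Longrightarrow> j \<in> {1..N} \<Longrightarrow> g \<in> carrier G \<Longrightarrow> b i j g \<in> carrier B"
    "\<And>i j g. i \<in> {1..N} \<Longrightarrow> j \<in> {1..N} \<Longrightarrow> g \<in> carrier G \<Longrightarrow> star B (b i j g) = b i j (inv\<^bsub>G\<^esub> g)"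
    "\<And>i j k g h. i \<in> {1..N} \<Longrightarrow> j \<in> {1..N} \<Longrightarrow> k \<in> {1..N} \<Longrightarrow> g \<in> carrier G \<Longrightarrow> h \<in> carrier G \<Longrightarrow>
      b i j g \<otimes>\<^bsub>B\<^esub> b i k h = (if j = k then b i j (g \<otimes>\<^bsub>G\<^esub> h) else \<zero>\<^bsub>B\<^esub>)"
    "\<And>i j k g h. i \<in> {1..N} \<Longrightarrow> j \<in> {1..N} \<Longrightarrow> k \<in> {1..N} \<Longrightarrow> g \<in> carrier G \<Longrightarrow> h \<in> carrier G \<Longrightarrow>
      b j i g \<otimes>\<^bsub>B\<^esub> b k i h = (if j = k then b j i (g \<otimes>\<^bsub>G\<^esub> h) else \<zero>\<^bsub>B\<^esub>)"
    "\<And>i. i \<in> {1..N} \<Longrightarrow> (\<Oplus>\<^bsub>B\<^esub>k\<in>{1..N}. b i k \<one>\<^bsub>G\<^esub>) = \<one>\<^bsub>B\<^esub>"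
    "\<And>i. i \<in> {1..N} \<Longrightarrow> (\<Oplus>\<^bsub>B\<^esub>k\<in>{1..N}. b k i \<one>\<^bsub>G\<^esub>) = \<one>\<^bsub>B\<^esub>"
  shows "H_family B N G b"
  unfolding H_family_def by (intro conjI ballI; rule assms; assumption)

lemma H_familyD:
  assumes "H_family B N G b"
  shows "i \<in> {1..N} \<Longrightarrow> j \<in> {1..N} \<Longrightarrow> g \<in> carrier G \<Longrightarrow> b i j g \<in> carrier B"
    "i \<in> {1..N} \<Longrightarrow> j \<in> {1..N} \<Longrightarrow> g \<in> carrier G \<Longrightarrow> star B (b i j g) = b i j (inv\<^bsub>G\<^esub> g)"
    "i \<in> {1..N} \<Longrightarrow> j \<in> {1..N} \<Longrightarrow> k \<in> {1..N} \<Longrightarrow> g \<in> carrier G \<Longrightarrow> h \<in> carrier G \<Longrightarrow>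
      b i j g \<otimes>\<^bsub>B\<^esub> b i k h = (if j = k then b i j (g \<otimes>\<^bsub>G\<^esub> h) else \<zero>\<^bsub>B\<^esub>)"
    "i \<in> {1..N} \<Longrightarrow> j \<in> {1..N} \<Longrightarrow> k \<in> {1..N} \<Longrightarrow> g \<in> carrier G \<Longrightarrow> h \<in> carrier G \<Longrightarrow>
      b j i g \<otimes>\<^bsub>B\<^esub> b k i h = (if j = k then b j i (g \<otimes>\<^bsub>G\<^esub> h) else \<zero>\<^bsub>B\<^esub>)"
    "i \<in> {1..N} \<Longrightarrow> (\<Oplus>\<^bsub>B\<^esub>k\<in>{1..N}. b i k \<one>\<^bsub>G\<^esub>) = \<one>\<^bsub>B\<^esub>"
    "i \<in> {1..N} \<Longrightarrow> (\<Oplus>\<^bsub>B\<^esub>k\<in>{1..N}. b k i \<one>\<^bsub>G\<^esub>) = \<one>\<^bsub>B\<^esub>"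
  using assms unfolding H_family_def by (simp_all del: One_nat_def atLeastAtMost_iff)

lemma H_family_image:
  assumes "csa A" "csa B" "group G" "H_family A N G a" "f \<in> star_homs A B"
  shows "H_family B N G (\<lambda>i j g. f (a i j g))"
proof -
  interpret A: csa A by fact
  interpret B: csa B by fact
  interpret G: group G by fact
  note a = H_familyD[OF assms(4)] and f = star_homsD[OF assms(5)]
  have s: "(\<Oplus>\<^bsub>B\<^esub>k\<in>{1..N}. f (x k)) = \<one>\<^bsub>B\<^esub>"
    if "\<And>k. k \<in> {1..N} \<Longrightarrow> x k \<in> carrier A" "(\<Oplus>\<^bsub>A\<^esub>k\<in>{1..N}. x k) = \<one>\<^bsub>A\<^esub>" for x
    using lin_maps_finsum[OF assms(1,2) f(1), of "{1..N}" x] that f(6) by auto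
  note z = lin_maps_zero[OF assms(1,2) f(1)]
  show ?thesis
  proof (rule H_familyI)
    fix i j k g h assume "i \<in> {1..N}" "j \<in> {1..N}" "k \<in> {1..N}" "g \<in> carrier G" "h \<in> carrier G"
    then show "f (a i j g) \<otimes>\<^bsub>B\<^esub> f (a i k h) = (if j = k then f (a i j (g \<otimes>\<^bsub>G\<^esub> h)) else \<zero>\<^bsub>B\<^esub>)"
      "f (a j i g) \<otimes>\<^bsub>B\<^esub> f (a k i h) = (if j = k then f (a j i (g \<otimes>\<^bsub>G\<^esub> h)) else \<zero>\<^bsub>B\<^esub>)"
      using a(3)[of i j k g h] a(4)[of i j k g h] a(1) z by (auto simp: f(5)[symmetric])
  next
    fix i j g assume "i \<in> {1..N}" "j \<in> {1..N}" "g \<in> carrier G"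
    then show "f (a i j g) \<in> carrier B" "star B (f (a i j g)) = f (a i j (inv\<^bsub>G\<^esub> g))"
      using a(1,2)[of i j g] f(2) f(7)[of "a i j g", symmetric] by auto
  next
    fix i assume i: "i \<in> {1..N}"
    show "(\<Oplus>\<^bsub>B\<^esub>k\<in>{1..N}. f (a i k \<one>\<^bsub>G\<^esub>)) = \<one>\<^bsub>B\<^esub>" "(\<Oplus>\<^bsub>B\<^esub>k\<in>{1..N}. f (a k i \<one>\<^bsub>G\<^esub>)) = \<one>\<^bsub>B\<^esub>"
      using i a by (intro s; simp)+
  qed
qed

text \<open>This family gives the coproduct. In a product of two entries of one row, the first legs
  force the inner indices to agree, after which the second legs force \<open>j = k\<close>. For two
  entries of one column the legs exchange roles.\<close>

lemma H_family_tensor: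
  assumes "csa A" "csa B" "group G" "H_family A N G a" "H_family B N G b"
  shows "H_family (tensor_alg A B) N G (\<lambda>i j g. \<Oplus>\<^bsub>tensor_alg A B\<^esub>k\<in>{1..N}. tens A B (a i k g) (b k j g))"
proof -
  interpret AB: csa_pair A B by (intro csa_pairI assms)
  interpret T: csa "tensor_alg A B" by (rule AB.csa_tensor)
  interpret G: group G by fact
  let ?T = "tensor_alg A B" and ?I = "{1..N}"
  let ?x = "\<lambda>i j g. \<Oplus>\<^bsub>?T\<^esub>k\<in>?I. tens A B (a i k g) (b k j g)"
  note a = H_familyD[OF assms(4)] and b = H_familyD[OF assms(5)]
  have tc [simp]: "tens A B (a i k g) (b l j h) \<in> carrier ?T"
    if "i \<in> ?I" "j \<in> ?I" "k \<in> ?I" "l \<in> ?I" "g \<in> carrier G" "h \<in> carrier G" for i j k l g h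
    using that a(1) b(1) by auto
  have sum_star: "star ?T (\<Oplus>\<^bsub>?T\<^esub>k\<in>S. x k) = (\<Oplus>\<^bsub>?T\<^esub>k\<in>S. star ?T (x k))"
    if "finite S" "x \<in> S \<rightarrow> carrier ?T" for x S
    using that by (induction S rule: finite_induct) (simp_all add: T.star_add Pi_iff)
  have tz: "tens A B \<zero>\<^bsub>A\<^esub> y = \<zero>\<^bsub>?T\<^esub>" if "y \<in> carrier B" for y using that by (rule AB.tens_zero_l)
  have tz': "tens A B y \<zero>\<^bsub>B\<^esub> = \<zero>\<^bsub>?T\<^esub>" if "y \<in> carrier A" for y using that by (rule AB.tens_zero_r)
  show ?thesis
  proof (rule H_familyI)
    fix i j g assume h: "i \<in> ?I" "j \<in> ?I" "g \<in> carrier G"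
    show "?x i j g \<in> carrier ?T" using h by (intro T.finsum_closed) auto
    have "star ?T (?x i j g) = (\<Oplus>\<^bsub>?T\<^esub>k\<in>?I. star ?T (tens A B (a i k g) (b k j g)))"
      using h by (intro sum_star) auto
    also have "\<dots> = ?x i j (inv\<^bsub>G\<^esub> g)"
      using h by (intro T.finsum_cong') (auto simp: AB.tens_star a b)
    finally show "star ?T (?x i j g) = ?x i j (inv\<^bsub>G\<^esub> g)" .
  next
    fix i j k g h assume h: "i \<in> ?I" "j \<in> ?I" "k \<in> ?I" "g \<in> carrier G" "h \<in> carrier G"
    have "?x i j g \<otimes>\<^bsub>?T\<^esub> ?x i k h =
        (\<Oplus>\<^bsub>?T\<^esub>m\<in>?I. \<Oplus>\<^bsub>?T\<^esub>n\<in>?I. tens A B (a i m g) (b m j g) \<otimes>\<^bsub>?T\<^esub> tens A B (a i n h) (b n k h))"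
      using h by (intro T.finsum_mult_finsum) auto
    also have "\<dots> = (\<Oplus>\<^bsub>?T\<^esub>m\<in>?I. \<Oplus>\<^bsub>?T\<^esub>n\<in>?I. if m = n then tens A B (a i m (g \<otimes>\<^bsub>G\<^esub> h)) (b m j g \<otimes>\<^bsub>B\<^esub> b n k h) else \<zero>\<^bsub>?T\<^esub>)"
      using h by (intro T.finsum_cong' T.finsum_closed) (auto simp: AB.tens_mult a b(1) tz)
    also have "\<dots> = (\<Oplus>\<^bsub>?T\<^esub>m\<in>?I. tens A B (a i m (g \<otimes>\<^bsub>G\<^esub> h)) (b m j g \<otimes>\<^bsub>B\<^esub> b m k h))"
      using h by (intro T.finsum_cong' T.finsum_delta') (auto simp: a b(1))
    also have "\<dots> = (\<Oplus>\<^bsub>?T\<^esub>m\<in>?I. if j = k then tens A B (a i m (g \<otimes>\<^bsub>G\<^esub> h)) (b m j (g \<otimes>\<^bsub>G\<^esub> h)) else \<zero>\<^bsub>?T\<^esub>)"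
      using h by (intro T.finsum_cong') (auto simp: a b tz')
    also have "\<dots> = (if j = k then ?x i j (g \<otimes>\<^bsub>G\<^esub> h) else \<zero>\<^bsub>?T\<^esub>)" by auto
    finally show "?x i j g \<otimes>\<^bsub>?T\<^esub> ?x i k h = (if j = k then ?x i j (g \<otimes>\<^bsub>G\<^esub> h) else \<zero>\<^bsub>?T\<^esub>)" .
    have "?x j i g \<otimes>\<^bsub>?T\<^esub> ?x k i h =
        (\<Oplus>\<^bsub>?T\<^esub>m\<in>?I. \<Oplus>\<^bsub>?T\<^esub>n\<in>?I. tens A B (a j m g) (b m i g) \<otimes>\<^bsub>?T\<^esub> tens A B (a k n h) (b n i h))"
      using h by (intro T.finsum_mult_finsum) auto
    also have "\<dots> = (\<Oplus>\<^bsub>?T\<^esub>m\<in>?I. \<Oplus>\<^bsub>?T\<^esub>n\<in>?I. if m = n then tens A B (a j m g \<otimes>\<^bsub>A\<^esub> a k n h) (b m i (g \<otimes>\<^bsub>G\<^esub> h)) else \<zero>\<^bsub>?T\<^esub>)"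
      using h by (intro T.finsum_cong' T.finsum_closed) (auto simp: AB.tens_mult a(1) b tz')
    also have "\<dots> = (\<Oplus>\<^bsub>?T\<^esub>m\<in>?I. tens A B (a j m g \<otimes>\<^bsub>A\<^esub> a k m h) (b m i (g \<otimes>\<^bsub>G\<^esub> h)))"
      using h by (intro T.finsum_cong' T.finsum_delta') (auto simp: a(1) b)
    also have "\<dots> = (\<Oplus>\<^bsub>?T\<^esub>m\<in>?I. if j = k then tens A B (a j m (g \<otimes>\<^bsub>G\<^esub> h)) (b m i (g \<otimes>\<^bsub>G\<^esub> h)) else \<zero>\<^bsub>?T\<^esub>)"
      using h by (intro T.finsum_cong') (auto simp: a b tz)
    also have "\<dots> = (if j = k then ?x j i (g \<otimes>\<^bsub>G\<^esub> h) else \<zero>\<^bsub>?T\<^esub>)" by auto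
    finally show "?x j i g \<otimes>\<^bsub>?T\<^esub> ?x k i h = (if j = k then ?x j i (g \<otimes>\<^bsub>G\<^esub> h) else \<zero>\<^bsub>?T\<^esub>)" .
  next
    fix i assume i: "i \<in> ?I"
    have "(\<Oplus>\<^bsub>?T\<^esub>j\<in>?I. ?x i j \<one>\<^bsub>G\<^esub>) = (\<Oplus>\<^bsub>?T\<^esub>k\<in>?I. \<Oplus>\<^bsub>?T\<^esub>j\<in>?I. tens A B (a i k \<one>\<^bsub>G\<^esub>) (b k j \<one>\<^bsub>G\<^esub>))"
      using i by (intro T.finsum_swap) auto
    also have "\<dots> = (\<Oplus>\<^bsub>?T\<^esub>k\<in>?I. tens A B (a i k \<one>\<^bsub>G\<^esub>) \<one>\<^bsub>B\<^esub>)"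
    proof (intro T.finsum_cong' refl)
      fix k assume k: "k \<in> ?I"
      show "(\<Oplus>\<^bsub>?T\<^esub>j\<in>?I. tens A B (a i k \<one>\<^bsub>G\<^esub>) (b k j \<one>\<^bsub>G\<^esub>)) = tens A B (a i k \<one>\<^bsub>G\<^esub>) \<one>\<^bsub>B\<^esub>"
        unfolding b(5)[OF k, symmetric]
        using i k a(1) b(1) by (intro lin_maps_finsum[OF assms(2) T.csa_axioms bilinD(1)[OF AB.tens_bilin], symmetric]) auto
    qed (use i a(1) in auto)
    also have "\<dots> = tens A B \<one>\<^bsub>A\<^esub> \<one>\<^bsub>B\<^esub>"
      unfolding a(5)[OF i, symmetric]
      using i a(1) by (intro lin_maps_finsum[OF assms(1) T.csa_axioms bilinD(2)[OF AB.tens_bilin], symmetric]) auto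
    finally show "(\<Oplus>\<^bsub>?T\<^esub>j\<in>?I. ?x i j \<one>\<^bsub>G\<^esub>) = \<one>\<^bsub>?T\<^esub>" by (simp add: AB.tens_one)
    have "(\<Oplus>\<^bsub>?T\<^esub>j\<in>?I. ?x j i \<one>\<^bsub>G\<^esub>) = (\<Oplus>\<^bsub>?T\<^esub>k\<in>?I. \<Oplus>\<^bsub>?T\<^esub>j\<in>?I. tens A B (a j k \<one>\<^bsub>G\<^esub>) (b k i \<one>\<^bsub>G\<^esub>))"
      using i by (intro T.finsum_swap) auto
    also have "\<dots> = (\<Oplus>\<^bsub>?T\<^esub>k\<in>?I. tens A B \<one>\<^bsub>A\<^esub> (b k i \<one>\<^bsub>G\<^esub>))"
    proof (intro T.finsum_cong' refl)
      fix k assume k: "k \<in> ?I"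
      show "(\<Oplus>\<^bsub>?T\<^esub>j\<in>?I. tens A B (a j k \<one>\<^bsub>G\<^esub>) (b k i \<one>\<^bsub>G\<^esub>)) = tens A B \<one>\<^bsub>A\<^esub> (b k i \<one>\<^bsub>G\<^esub>)"
        unfolding a(6)[OF k, symmetric]
        using i k a(1) b(1) by (intro lin_maps_finsum[OF assms(1) T.csa_axioms bilinD(2)[OF AB.tens_bilin], symmetric]) auto
    qed (use i b(1) in auto)
    also have "\<dots> = tens A B \<one>\<^bsub>A\<^esub> \<one>\<^bsub>B\<^esub>"
      unfolding b(6)[OF i, symmetric]
      using i b(1) by (intro lin_maps_finsum[OF assms(2) T.csa_axioms bilinD(1)[OF AB.tens_bilin], symmetric]) auto
    finally show "(\<Oplus>\<^bsub>?T\<^esub>j\<in>?I. ?x j i \<one>\<^bsub>G\<^esub>) = \<one>\<^bsub>?T\<^esub>" by (simp add: AB.tens_one)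
  qed
qed

text \<open>This family gives the antipode. Transposition exchanges the row and the column
  relations, and inversion of the group element compensates for the reversed product.\<close>

lemma H_family_op:
  assumes "csa A" "group G" "H_family A N G a"
  shows "H_family (op_alg A) N G (\<lambda>i j g. a j i (inv\<^bsub>G\<^esub> g))"
proof -
  interpret G: group G by fact
  note a = H_familyD[OF assms(3)]
  show ?thesis
    by (rule H_familyI) (simp_all add: a G.inv_mult_group del: One_nat_def)
qed

lemma finsum_complex_alg: "finite S \<Longrightarrow> (\<Oplus>\<^bsub>complex_alg\<^esub>i\<in>S. f i) = (\<Sum>i\<in>S. f i)"
proof -
  interpret csa complex_alg by (rule csa_complex_alg)
  show "finite S \<Longrightarrow> (\<Oplus>\<^bsub>complex_alg\<^esub>i\<in>S. f i) = (\<Sum>i\<in>S. f i)"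
    by (induction S rule: finite_induct) simp_all
qed

lemma H_family_counit:
  "H_family complex_alg N G (\<lambda>i j g. if i = j then 1 else 0)"
  by (rule H_familyI) (auto simp: finsum_complex_alg)

section \<open>Free star algebras\<close>

fun word_eval :: "('b, 'k) star_alg_scheme \<Rightarrow> ('x \<Rightarrow> 'b) \<Rightarrow> ('x \<times> bool) list \<Rightarrow> 'b" where
  "word_eval B b [] = \<one>\<^bsub>B\<^esub>"
| "word_eval B b ((x, t) # w) = (if t then star B (b x) else b x) \<otimes>\<^bsub>B\<^esub> word_eval B b w"

lemma star_monoid_word: "star_monoid (word_monoid V) (\<lambda>w. rev (map (apsnd Not) w))"
proof (intro star_monoid.intro star_monoid_axioms.intro)
  show "Group.monoid (word_monoid V)"
    by (rule monoidI) (auto simp: word_monoid_def)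
  show "rev (map (apsnd Not) w) \<in> carrier (word_monoid V)" if "w \<in> carrier (word_monoid V)" for w
    using that by (auto simp: word_monoid_def in_lists_conv_set)
  have "apsnd Not \<circ> apsnd Not = (\<lambda>x :: 'a \<times> bool. x)" by (auto simp: fun_eq_iff)
  then show "rev (map (apsnd Not) (rev (map (apsnd Not) w))) = w" for w :: "('a \<times> bool) list"
    by (simp add: rev_map)
qed (auto simp: word_monoid_def)

lemma csa_free: "csa (free_star_alg V)"
  unfolding free_star_alg_def by (rule star_monoid.csa_monoid_alg[OF star_monoid_word])

lemma letter_closed: "x \<in> V \<Longrightarrow> letter x \<in> carrier (free_star_alg V)"
  by (simp add: free_star_alg_def letter_def word_monoid_def)

lemma minus_free:
  "f \<in> carrier (free_star_alg V) \<Longrightarrow> g \<in> carrier (free_star_alg V) \<Longrightarrow> f \<ominus>\<^bsub>free_star_alg V\<^esub> g = f - g"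
  unfolding free_star_alg_def by (rule star_monoid.minus_monoid_alg[OF star_monoid_word]) auto

lemma zero_free: "\<zero>\<^bsub>free_star_alg V\<^esub> = 0"
  by (simp add: free_star_alg_def)

lemma finsum_free:
  assumes "finite S" "\<And>i. i \<in> S \<Longrightarrow> f i \<in> carrier (free_star_alg V)"
  shows "(\<Oplus>\<^bsub>free_star_alg V\<^esub>i\<in>S. f i) = (\<Sum>i\<in>S. f i)"
proof -
  interpret csa "free_star_alg V" by (rule csa_free)
  show ?thesis using assms
  proof (induction S rule: finite_induct)
    case (insert x F)
    then have "(\<Oplus>\<^bsub>free_star_alg V\<^esub>i\<in>insert x F. f i) = f x \<oplus>\<^bsub>free_star_alg V\<^esub> (\<Oplus>\<^bsub>free_star_alg V\<^esub>i\<in>F. f i)"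
      by (intro finsum_insert) auto
    then show ?case using insert by (simp add: free_star_alg_def)
  qed (simp add: zero_free)
qed

lemma word_eval_closed:
  assumes "csa B" "b \<in> V \<rightarrow> carrier B" "w \<in> lists (V \<times> UNIV)"
  shows "word_eval B b w \<in> carrier B"
proof -
  interpret B: csa B by fact
  show ?thesis using assms(3) by (induction w rule: lists.induct) (use assms(2) in \<open>auto simp: Pi_iff\<close>)
qed

lemma word_eval_append:
  assumes "csa B" "b \<in> V \<rightarrow> carrier B" "w \<in> lists (V \<times> UNIV)" "v \<in> lists (V \<times> UNIV)"
  shows "word_eval B b (w @ v) = word_eval B b w \<otimes>\<^bsub>B\<^esub> word_eval B b v"
proof -
  interpret B: csa B by fact
  note c = word_eval_closed[OF assms(1,2)]
  show ?thesis using assms(3)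
  proof (induction w rule: lists.induct)
    case (Cons a l)
    then show ?case using assms(2) c[OF Cons(2)] c[OF assms(4)] by (cases a) (auto simp: B.m_assoc Pi_iff)
  qed (use c assms(4) in auto)
qed

lemma word_eval_star:
  assumes "csa B" "b \<in> V \<rightarrow> carrier B" "w \<in> lists (V \<times> UNIV)"
  shows "word_eval B b (rev (map (apsnd Not) w)) = star B (word_eval B b w)"
proof -
  interpret B: csa B by fact
  note c = word_eval_closed[OF assms(1,2)]
  show ?thesis using assms(3)
  proof (induction w rule: lists.induct)
    case (Cons a l)
    obtain x t where a: "a = (x, t)" "x \<in> V" using Cons(1) by (cases a) auto
    have l: "rev (map (apsnd Not) l) \<in> lists (V \<times> UNIV)"
      using star_monoid.s_closed[OF star_monoid_word, of l V] Cons(2) by (simp add: word_monoid_def)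
    have "word_eval B b (rev (map (apsnd Not) (a # l))) =
        word_eval B b (rev (map (apsnd Not) l)) \<otimes>\<^bsub>B\<^esub> word_eval B b [(x, \<not> t)]"
      using a l by (simp add: word_eval_append[OF assms(1,2)])
    then show ?case using a Cons assms(2) c[OF Cons(2)] by (auto simp: B.star_mult Pi_iff)
  qed simp
qed

lemma free_star_alg_hom:
  assumes "csa B" "b \<in> V \<rightarrow> carrier B"
  shows "lin_ext B (word_eval B b) \<in> star_homs (free_star_alg V) B"
    and "x \<in> V \<Longrightarrow> lin_ext B (word_eval B b) (letter x) = b x"
proof -
  interpret B: csa B by fact
  show "lin_ext B (word_eval B b) \<in> star_homs (free_star_alg V) B"
    unfolding free_star_alg_def
    by (rule star_monoid.lin_ext_star_hom[OF star_monoid_word assms(1)])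
      (auto simp: word_monoid_def word_eval_closed[OF assms] word_eval_append[OF assms] word_eval_star[OF assms])
  show "x \<in> V \<Longrightarrow> lin_ext B (word_eval B b) (letter x) = b x"
    unfolding letter_def using assms(2) by (subst lin_ext_single[OF assms(1)]) (auto simp: Pi_iff)
qed

text \<open>The involution produces the adjoint letters and products produce the words, so the plain
  letters generate.\<close>

lemma generates_free: "generates (free_star_alg V) (letter ` V)"
  unfolding generates_def
proof (intro conjI allI impI)
  let ?F = "free_star_alg V"
  interpret F: csa ?F by (rule csa_free)
  show "letter ` V \<subseteq> carrier ?F" using letter_closed by auto
  fix T assume T: "star_subalgebra ?F T \<and> letter ` V \<subseteq> T"
  note T' = conjunct1[OF T, unfolded F.star_subalgebra_iff]
  have l: "Poly_Mapping.single [(x, t)] 1 \<in> T" if "x \<in> V" for x t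
  proof (cases t)
    case True
    have "star ?F (letter x) \<in> T" using that T T' by auto
    then show ?thesis using True by (simp add: free_star_alg_def letter_def)
  next
    case False
    then show ?thesis using that T by (auto simp: letter_def)
  qed
  have w: "Poly_Mapping.single w 1 \<in> T" if "w \<in> lists (V \<times> UNIV)" for w
    using that
  proof (induction w rule: lists.induct)
    case Nil
    have "\<one>\<^bsub>?F\<^esub> \<in> T" using T' by blast
    then show ?case by (simp add: free_star_alg_def word_monoid_def)
  next
    case (Cons a w)
    obtain x t where a: "a = (x, t)" "x \<in> V" using Cons(1) by (cases a) auto
    have "Poly_Mapping.single [(x, t)] 1 \<otimes>\<^bsub>?F\<^esub> Poly_Mapping.single w 1 \<in> T"
      using l[OF a(2)] Cons T' by blast
    then show ?case using a by (simp add: free_star_alg_def word_monoid_def)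
  qed
  show "carrier ?F \<subseteq> T"
  proof
    fix f assume "f \<in> carrier ?F"
    then have "Poly_Mapping.keys f \<subseteq> carrier (word_monoid V)" by (simp add: free_star_alg_def)
    then show "f \<in> T"
    proof (induction f rule: poly_mapping_carrier_induct)
      case zero
      show ?case using T' by (simp add: zero_free)
    next
      case (single w c)
      then have "c \<odot>\<^bsub>?F\<^esub> Poly_Mapping.single w 1 \<in> T" using w T' by (simp add: word_monoid_def)
      then show ?case by (simp add: free_star_alg_def)
    next
      case (add f g)
      then have "f \<oplus>\<^bsub>?F\<^esub> g \<in> T" using T' by blast
      then show ?case by (simp add: free_star_alg_def)
    qed
  qed
qed

section \<open>The algebra of the free wreath product\<close>

locale H_setup = group G for G :: "('g, 'm) monoid_scheme" (structure) +
  fixes N :: nat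
begin

abbreviation "F \<equiv> H_free N G"
abbreviation "gens \<equiv> {1..N} \<times> {1..N} \<times> carrier G"

lemma csa_F: "csa F"
  unfolding H_free_def by (rule csa_free)

lemma letter_F [simp]: "i \<in> {1..N} \<Longrightarrow> j \<in> {1..N} \<Longrightarrow> g \<in> carrier G \<Longrightarrow> letter (i, j, g) \<in> carrier F"
  unfolding H_free_def by (rule letter_closed) auto

lemma zero_F: "0 \<in> carrier F" "\<zero>\<^bsub>F\<^esub> = 0"
  by (simp_all add: H_free_def free_star_alg_def)

lemma minus_F: "f \<in> carrier F \<Longrightarrow> g \<in> carrier F \<Longrightarrow> f \<ominus>\<^bsub>F\<^esub> g = f - g"
  unfolding H_free_def by (rule minus_free)

lemma sum_F: "finite S \<Longrightarrow> (\<And>i. i \<in> S \<Longrightarrow> f i \<in> carrier F) \<Longrightarrow> (\<Oplus>\<^bsub>F\<^esub>i\<in>S. f i) = (\<Sum>i\<in>S. f i)"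
  unfolding H_free_def by (rule finsum_free)

text \<open>Keeps the two sides of each relation apart, a relator being their difference. A relation
  can then be used as an equation, both after projection to the quotient and after evaluation in a
  family.\<close>

inductive relation :: "(((nat \<times> nat \<times> 'g) \<times> bool) list \<Rightarrow>\<^sub>0 complex) \<Rightarrow>
    (((nat \<times> nat \<times> 'g) \<times> bool) list \<Rightarrow>\<^sub>0 complex) \<Rightarrow> bool" where
  star: "i \<in> {1..N} \<Longrightarrow> j \<in> {1..N} \<Longrightarrow> g \<in> carrier G \<Longrightarrow>
    relation (star F (letter (i, j, g))) (letter (i, j, inv g))"
| row: "i \<in> {1..N} \<Longrightarrow> j \<in> {1..N} \<Longrightarrow> k \<in> {1..N} \<Longrightarrow> g \<in> carrier G \<Longrightarrow> h \<in> carrier G \<Longrightarrow>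
    relation (letter (i, j, g) \<otimes>\<^bsub>F\<^esub> letter (i, k, h)) (if j = k then letter (i, j, g \<otimes> h) else 0)"
| col: "i \<in> {1..N} \<Longrightarrow> j \<in> {1..N} \<Longrightarrow> k \<in> {1..N} \<Longrightarrow> g \<in> carrier G \<Longrightarrow> h \<in> carrier G \<Longrightarrow>
    relation (letter (j, i, g) \<otimes>\<^bsub>F\<^esub> letter (k, i, h)) (if j = k then letter (j, i, g \<otimes> h) else 0)"
| row_sum: "i \<in> {1..N} \<Longrightarrow> relation (\<Sum>k\<in>{1..N}. letter (i, k, \<one>)) \<one>\<^bsub>F\<^esub>"
| col_sum: "j \<in> {1..N} \<Longrightarrow> relation (\<Sum>k\<in>{1..N}. letter (k, j, \<one>)) \<one>\<^bsub>F\<^esub>"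

lemma sum_letters:
  assumes "i \<in> {1..N}"
  shows "(\<Sum>k\<in>{1..N}. letter (i, k, \<one>)) = (\<Oplus>\<^bsub>F\<^esub>k\<in>{1..N}. letter (i, k, \<one>))"
    "(\<Sum>k\<in>{1..N}. letter (k, i, \<one>)) = (\<Oplus>\<^bsub>F\<^esub>k\<in>{1..N}. letter (k, i, \<one>))"
  using assms by (intro sum_F[symmetric]; simp)+

lemma relation_closed: "relation x y \<Longrightarrow> x \<in> carrier F \<and> y \<in> carrier F"
proof -
  interpret F: csa F by (rule csa_F)
  show "relation x y \<Longrightarrow> x \<in> carrier F \<and> y \<in> carrier F"
    by (induction rule: relation.induct) (auto simp: sum_letters zero_F simp del: One_nat_def intro!: F.finsum_closed)
qed

lemma H_relators_iff: "r \<in> H_relators N G \<longleftrightarrow> (\<exists>x y. relation x y \<and> r = x \<ominus>\<^bsub>F\<^esub> y)"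
proof
  assume r: "r \<in> H_relators N G"
  have I: "\<exists>x y. relation x y \<and> r = x \<ominus>\<^bsub>F\<^esub> y" if "relation x y" "r = x - y" for x y
    using that relation_closed[OF that(1)] minus_F[of x y] by (intro exI[of _ x] exI[of _ y]) simp
  show "\<exists>x y. relation x y \<and> r = x \<ominus>\<^bsub>F\<^esub> y"
    using r unfolding H_relators_def Let_def
    by (elim UnE CollectE exE conjE)
      (rule I[OF relation.star] I[OF relation.row] I[OF relation.col] I[OF relation.row_sum] I[OF relation.col_sum];
        assumption)+
next
  assume "\<exists>x y. relation x y \<and> r = x \<ominus>\<^bsub>F\<^esub> y"
  then obtain x y where xy: "relation x y" "r = x - y" using relation_closed by (auto simp: minus_F)
  show "r \<in> H_relators N G"
    using xy(1) unfolding xy(2) H_relators_def Let_def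
    by (cases rule: relation.cases) blast+
qed

lemma H_relators_closed: "H_relators N G \<subseteq> carrier F"
proof -
  interpret F: csa F by (rule csa_F)
  show ?thesis using relation_closed by (auto simp: H_relators_iff)
qed

lemma star_ideal_H: "star_ideal F (H_ideal N G)"
  unfolding H_ideal_def by (rule csa.star_ideal_star_ideal_gen[OF csa_F H_relators_closed])

interpretation FI: csa_ideal "H_free N G" "H_ideal N G"
  by (intro csa_ideal.intro csa_F csa_ideal_axioms.intro star_ideal_H)

abbreviation "A0 \<equiv> quot_alg F (H_ideal N G)"
abbreviation "a \<equiv> H_gen N G"

lemma csa_A0: "csa A0"
  by (rule FI.csa_quot)

lemma a_closed: "i \<in> {1..N} \<Longrightarrow> j \<in> {1..N} \<Longrightarrow> g \<in> carrier G \<Longrightarrow> a i j g \<in> carrier A0"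
  unfolding H_gen_def by (rule FI.coset_closed) simp

lemma relation_proj:
  assumes "relation x y"
  shows "H_ideal N G +>\<^bsub>F\<^esub> x = H_ideal N G +>\<^bsub>F\<^esub> y"
proof -
  have "x \<ominus>\<^bsub>F\<^esub> y \<in> H_ideal N G"
    using assms star_ideal_gen_superset[of "H_relators N G" F] H_relators_iff unfolding H_ideal_def by blast
  then show ?thesis using relation_closed[OF assms] by (simp add: FI.coset_eq_iff)
qed

lemma H_family_A0: "H_family A0 N G a"
proof (rule H_familyI)
  fix i j g assume h: "i \<in> {1..N}" "j \<in> {1..N}" "g \<in> carrier G"
  show "a i j g \<in> carrier A0" using h by (rule a_closed)
  show "star A0 (a i j g) = a i j (inv g)"
    using relation_proj[OF relation.star[OF h]] h unfolding H_gen_def by (simp add: FI.quot_star)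
next
  fix i j k g h assume h: "i \<in> {1..N}" "j \<in> {1..N}" "k \<in> {1..N}" "g \<in> carrier G" "h \<in> carrier G"
  show "a i j g \<otimes>\<^bsub>A0\<^esub> a i k h = (if j = k then a i j (g \<otimes> h) else \<zero>\<^bsub>A0\<^esub>)"
    using relation_proj[OF relation.row[OF h]] h unfolding H_gen_def
    by (simp add: FI.quot_mult FI.quot_zero zero_F del: atLeastAtMost_iff split: if_splits)
  show "a j i g \<otimes>\<^bsub>A0\<^esub> a k i h = (if j = k then a j i (g \<otimes> h) else \<zero>\<^bsub>A0\<^esub>)"
    using relation_proj[OF relation.col[OF h]] h unfolding H_gen_def
    by (simp add: FI.quot_mult FI.quot_zero zero_F del: atLeastAtMost_iff split: if_splits)
next
  note \<pi>lin = star_homsD(1)[OF FI.proj_star_hom]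
  fix i assume i: "i \<in> {1..N}"
  show "(\<Oplus>\<^bsub>A0\<^esub>k\<in>{1..N}. a i k \<one>) = \<one>\<^bsub>A0\<^esub>"
    using relation_proj[OF relation.row_sum[OF i]] i unfolding H_gen_def FI.quot_one sum_letters[OF i]
    by (subst lin_maps_finsum[OF csa_F csa_A0 \<pi>lin, symmetric]) auto
  show "(\<Oplus>\<^bsub>A0\<^esub>k\<in>{1..N}. a k i \<one>) = \<one>\<^bsub>A0\<^esub>"
    using relation_proj[OF relation.col_sum[OF i]] i unfolding H_gen_def FI.quot_one sum_letters[OF i]
    by (subst lin_maps_finsum[OF csa_F csa_A0 \<pi>lin, symmetric]) auto
qed

lemma generates_A0: "generates A0 {a i j g | g i j. g \<in> carrier G \<and> i \<in> {1..N} \<and> j \<in> {1..N}}"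
proof -
  have "generates F (letter ` gens)"
    unfolding H_free_def by (rule generates_free)
  from generates_image[OF csa_F csa_A0 this FI.proj_star_hom]
  have "generates A0 ((\<lambda>x. H_ideal N G +>\<^bsub>F\<^esub> x) ` letter ` gens)"
    by (simp add: FI.carrier_quot)
  moreover have "(\<lambda>x. H_ideal N G +>\<^bsub>F\<^esub> x) ` letter ` gens =
      {a i j g | g i j. g \<in> carrier G \<and> i \<in> {1..N} \<and> j \<in> {1..N}}"
    (is "?L = ?R")
  proof -
    have "?L = (\<lambda>(i, j, g). a i j g) ` gens"
      by (simp add: image_image H_gen_def case_prod_beta)
    also have "\<dots> = ?R"
    proof (intro equalityI subsetI)
      fix y assume "y \<in> ?R"
      then obtain i j g where y: "y = a i j g" "i \<in> {1..N}" "j \<in> {1..N}" "g \<in> carrier G" by blast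
      then show "y \<in> (\<lambda>(i, j, g). a i j g) ` gens" by (intro image_eqI[of _ _ "(i, j, g)"]) auto
    qed (clarify, blast)
    finally show ?thesis .
  qed
  ultimately show ?thesis by simp
qed

text \<open>Evaluation of words at the family respects each relation. Hence it vanishes on the
  relators, then on the star ideal generated by them, and descends to the quotient.\<close>

lemma H_universal:
  assumes B: "csa B" and b: "H_family B N G b"
  shows "\<exists>f \<in> star_homs A0 B. \<forall>i\<in>{1..N}. \<forall>j\<in>{1..N}. \<forall>g\<in>carrier G. f (a i j g) = b i j g"
proof -
  interpret B: csa B by (rule B)
  note D = H_familyD[OF b]
  let ?b = "\<lambda>(i, j, g). b i j g"
  have bc: "?b \<in> gens \<rightarrow> carrier B" using D(1) by auto
  define f where "f = lin_ext B (word_eval B ?b)"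
  have f: "f \<in> star_homs F B"
    unfolding f_def H_free_def by (rule free_star_alg_hom(1)[OF B bc])
  have fl: "f (letter (i, j, g)) = b i j g" if "i \<in> {1..N}" "j \<in> {1..N}" "g \<in> carrier G" for i j g
    unfolding f_def using free_star_alg_hom(2)[OF B bc, of "(i, j, g)"] that by simp
  note fh = star_homsD[OF f]
  have fz: "f \<zero>\<^bsub>F\<^esub> = \<zero>\<^bsub>B\<^esub>" by (rule lin_maps_zero[OF csa_F B fh(1)])
  have rel: "f x = f y" if xy: "relation x y" for x y
    using xy
  proof (cases rule: relation.cases)
    case (star i j g)
    then show ?thesis using fl D(2) fh(7)[OF letter_F] by simp
  next
    case (row i j k g h)
    then show ?thesis using fl D(3) fh(5)[OF letter_F letter_F] fz zero_F(2) by simp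
  next
    case (col i j k g h)
    then show ?thesis using fl D(4) fh(5)[OF letter_F letter_F] fz zero_F(2) by simp
  next
    case (row_sum i)
    have "f (\<Oplus>\<^bsub>F\<^esub>k\<in>{1..N}. letter (i, k, \<one>)) = (\<Oplus>\<^bsub>B\<^esub>k\<in>{1..N}. f (letter (i, k, \<one>)))"
      using row_sum by (intro lin_maps_finsum[OF csa_F B fh(1)]) auto
    also have "\<dots> = (\<Oplus>\<^bsub>B\<^esub>k\<in>{1..N}. b i k \<one>)"
      using row_sum by (intro B.finsum_cong') (auto simp: fl D(1))
    finally show ?thesis using row_sum D(5)[OF row_sum(3)] fh(6) sum_letters[OF row_sum(3)] by simp
  next
    case (col_sum i)
    have "f (\<Oplus>\<^bsub>F\<^esub>k\<in>{1..N}. letter (k, i, \<one>)) = (\<Oplus>\<^bsub>B\<^esub>k\<in>{1..N}. f (letter (k, i, \<one>)))"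
      using col_sum by (intro lin_maps_finsum[OF csa_F B fh(1)]) auto
    also have "\<dots> = (\<Oplus>\<^bsub>B\<^esub>k\<in>{1..N}. b k i \<one>)"
      using col_sum by (intro B.finsum_cong') (auto simp: fl D(1))
    finally show ?thesis using col_sum D(6)[OF col_sum(3)] fh(6) sum_letters[OF col_sum(3)] by simp
  qed
  have "H_ideal N G \<subseteq> {x \<in> carrier F. f x = \<zero>\<^bsub>B\<^esub>}"
    unfolding H_ideal_def
  proof (rule star_ideal_gen_least[OF star_homs_kernel[OF csa_F B f]])
    show "H_relators N G \<subseteq> {x \<in> carrier F. f x = \<zero>\<^bsub>B\<^esub>}"
    proof
      interpret F: csa F by (rule csa_F)
      fix r assume "r \<in> H_relators N G"
      then obtain x y where xy: "relation x y" "r = x \<ominus>\<^bsub>F\<^esub> y" unfolding H_relators_iff by blast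
      then show "r \<in> {x \<in> carrier F. f x = \<zero>\<^bsub>B\<^esub>}"
        using relation_closed[OF xy(1)] rel[OF xy(1)] fh(2)[of y]
        by (simp add: lin_maps_minus[OF csa_F B fh(1)])
    qed
  qed
  then have fI: "f x = \<zero>\<^bsub>B\<^esub>" if "x \<in> H_ideal N G" for x using that by blast
  show ?thesis
  proof (intro bexI ballI)
    show "(\<lambda>K. the_elem (f ` K)) \<in> star_homs A0 B" by (rule FI.quot_lift_star_hom[OF B f fI])
    show "the_elem (f ` a i j g) = b i j g" if "i \<in> {1..N}" "j \<in> {1..N}" "g \<in> carrier G" for i j g
      unfolding H_gen_def using that FI.quot_lift_eq[OF B fh(1) fI letter_F] fl by simp
  qed
qed

abbreviation "H \<equiv> H_plus N G"
abbreviation "T0 \<equiv> tensor_alg A0 A0"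

text \<open>The description in \<open>H_plus\<close> has a solution by the universal property
  applied to the tensor family. The solution is unique because the generators determine a
  homomorphism on the carrier and extensionality determines the rest.\<close>

lemma H_plus_comult:
  obtains \<Delta> where "H = with_comult A0 \<Delta>" "\<Delta> \<in> star_homs A0 T0"
    "\<And>i j g. i \<in> {1..N} \<Longrightarrow> j \<in> {1..N} \<Longrightarrow> g \<in> carrier G \<Longrightarrow>
      \<Delta> (a i j g) = (\<Oplus>\<^bsub>T0\<^esub>k\<in>{1..N}. tens A0 A0 (a i k g) (a k j g))"
proof -
  interpret AA: csa_pair A0 A0 by (intro csa_pairI csa_A0)
  let ?t = "\<lambda>i j g. \<Oplus>\<^bsub>T0\<^esub>k\<in>{1..N}. tens A0 A0 (a i k g) (a k j g)"
  let ?P = "\<lambda>\<Delta>. \<Delta> \<in> star_homs A0 T0 \<inter> extensional (carrier A0) \<and>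
      (\<forall>i\<in>{1..N}. \<forall>j\<in>{1..N}. \<forall>g\<in>carrier G. \<Delta> (a i j g) = ?t i j g)"
  obtain f where f: "f \<in> star_homs A0 T0" "\<forall>i\<in>{1..N}. \<forall>j\<in>{1..N}. \<forall>g\<in>carrier G. f (a i j g) = ?t i j g"
    using H_universal[OF AA.csa_tensor H_family_tensor[OF csa_A0 csa_A0 is_group H_family_A0 H_family_A0]] by blast
  interpret A0: csa A0 by (rule csa_A0)
  let ?f = "restrict f (carrier A0)"
  have f': "?f \<in> star_homs A0 T0"
    by (rule star_homsI) (auto intro!: lin_mapsI simp: star_homsD[OF f(1)])
  have P: "?P ?f" using f' f(2) a_closed by simp
  have "(THE \<Delta>. ?P \<Delta>) = ?f"
  proof (rule the_equality[of ?P, OF P])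
    fix \<Delta> assume \<Delta>: "?P \<Delta>"
    show "\<Delta> = ?f"
    proof (rule extensionalityI)
      show "\<Delta> x = ?f x" if x: "x \<in> carrier A0" for x
      proof (rule star_homs_generates_eq[OF csa_A0 AA.csa_tensor generates_A0 _ f' _ x])
        show "\<Delta> \<in> star_homs A0 T0" using \<Delta> by blast
        fix s assume "s \<in> {a i j g | g i j. g \<in> carrier G \<and> i \<in> {1..N} \<and> j \<in> {1..N}}"
        then obtain i j g where s: "s = a i j g" "i \<in> {1..N}" "j \<in> {1..N}" "g \<in> carrier G" by blast
        have "\<Delta> (a i j g) = ?t i j g" "?f (a i j g) = ?t i j g" using s(2-) \<Delta> P by blast+
        then show "\<Delta> s = ?f s" using s(1) by simp
      qed
    qed (use \<Delta> P in auto)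
  qed
  then have "H = with_comult A0 ?f" unfolding H_plus_def Let_def by simp
  then show ?thesis using that[of ?f] P by blast
qed

lemma csa_H: "csa H"
  by (rule H_plus_comult) (simp add: csa_with_comult csa_A0)

lemma H_family_with_comult: "H_family (with_comult B \<Delta>) M G' b \<longleftrightarrow> H_family B M G' b"
  by (simp add: H_family_def)

lemma H_family_H: "H_family H N G a"
  by (rule H_plus_comult) (simp add: H_family_with_comult H_family_A0)

lemma generates_H: "generates H {a i j g | g i j. g \<in> carrier G \<and> i \<in> {1..N} \<and> j \<in> {1..N}}"
proof -
  obtain \<Delta> where \<Delta>: "H = with_comult A0 \<Delta>" by (rule H_plus_comult)
  show ?thesis unfolding \<Delta> generates_with_comult[OF csa_A0] by (rule generates_A0)
qed

lemma H_universal_H: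
  assumes "csa B" "H_family B N G b"
  obtains f where "f \<in> star_homs H B"
    "\<And>i j g. i \<in> {1..N} \<Longrightarrow> j \<in> {1..N} \<Longrightarrow> g \<in> carrier G \<Longrightarrow> f (a i j g) = b i j g"
proof -
  have "star_homs H B = star_homs A0 B" by (rule H_plus_comult) simp
  then show ?thesis using H_universal[OF assms] that by auto
qed

lemma comult_H: "comult H \<in> star_homs H (tensor_alg H H)"
  "i \<in> {1..N} \<Longrightarrow> j \<in> {1..N} \<Longrightarrow> g \<in> carrier G \<Longrightarrow>
    comult H (a i j g) = (\<Oplus>\<^bsub>tensor_alg H H\<^esub>k\<in>{1..N}. tens H H (a i k g) (a k j g))"
  by (rule H_plus_comult; simp)+

text \<open>The product of \<open>b i k g\<close> with the adjoint of \<open>b j k g\<close> is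
  \<open>b i k \<one>\<close> if \<open>i = j\<close> and zero otherwise; the sum over
  \<open>k\<close> is then the unit. Columns are treated in the same way.\<close>

lemma H_family_unitary:
  assumes "csa B" "H_family B N G b" "i \<in> {1..N}" "j \<in> {1..N}" "g \<in> carrier G"
  shows "(\<Oplus>\<^bsub>B\<^esub>k\<in>{1..N}. b i k g \<otimes>\<^bsub>B\<^esub> star B (b j k g)) = (if i = j then \<one>\<^bsub>B\<^esub> else \<zero>\<^bsub>B\<^esub>)"
    "(\<Oplus>\<^bsub>B\<^esub>k\<in>{1..N}. star B (b k i g) \<otimes>\<^bsub>B\<^esub> b k j g) = (if i = j then \<one>\<^bsub>B\<^esub> else \<zero>\<^bsub>B\<^esub>)"
proof -
  interpret B: csa B by fact
  note D = H_familyD[OF assms(2)]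
  have "(\<Oplus>\<^bsub>B\<^esub>k\<in>{1..N}. b i k g \<otimes>\<^bsub>B\<^esub> star B (b j k g)) = (\<Oplus>\<^bsub>B\<^esub>k\<in>{1..N}. if i = j then b i k \<one> else \<zero>\<^bsub>B\<^esub>)"
    using assms(3-) by (intro B.finsum_cong') (auto simp: D(1-4))
  then show "(\<Oplus>\<^bsub>B\<^esub>k\<in>{1..N}. b i k g \<otimes>\<^bsub>B\<^esub> star B (b j k g)) = (if i = j then \<one>\<^bsub>B\<^esub> else \<zero>\<^bsub>B\<^esub>)"
    using D(5)[OF assms(3)] by (cases "i = j") auto
  have "(\<Oplus>\<^bsub>B\<^esub>k\<in>{1..N}. star B (b k i g) \<otimes>\<^bsub>B\<^esub> b k j g) = (\<Oplus>\<^bsub>B\<^esub>k\<in>{1..N}. if i = j then b k i \<one> else \<zero>\<^bsub>B\<^esub>)"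
    using assms(3-) by (intro B.finsum_cong') (auto simp: D(1-4))
  then show "(\<Oplus>\<^bsub>B\<^esub>k\<in>{1..N}. star B (b k i g) \<otimes>\<^bsub>B\<^esub> b k j g) = (if i = j then \<one>\<^bsub>B\<^esub> else \<zero>\<^bsub>B\<^esub>)"
    using D(6)[OF assms(3)] by (cases "i = j") auto
qed

text \<open>The counit comes from the family given by the identity matrix, the antipode from the
  transposed family in the opposite algebra.\<close>

lemma matrix_hopf_H: "\<exists>\<epsilon> S. matrix_hopf H N (carrier G) (\<lambda>g i j. a i j g) (m_inv G) \<epsilon> S"
proof -
  obtain \<epsilon> where \<epsilon>: "\<epsilon> \<in> star_homs H complex_alg"
    "\<And>i j g. i \<in> {1..N} \<Longrightarrow> j \<in> {1..N} \<Longrightarrow> g \<in> carrier G \<Longrightarrow> \<epsilon> (a i j g) = (if i = j then 1 else 0)"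
    using H_universal_H[OF csa_complex_alg H_family_counit] by blast
  obtain S where S: "S \<in> star_homs H (op_alg H)"
    "\<And>i j g. i \<in> {1..N} \<Longrightarrow> j \<in> {1..N} \<Longrightarrow> g \<in> carrier G \<Longrightarrow> S (a i j g) = a j i (inv g)"
    using H_universal_H[OF csa_op_alg[OF csa_H] H_family_op[OF csa_H is_group H_family_H]] by blast
  note D = H_familyD[OF H_family_H]
  have "matrix_hopf H N (carrier G) (\<lambda>g i j. a i j g) (m_inv G) \<epsilon> S"
    by (intro matrix_hopf.intro csa_H matrix_hopf_axioms.intro comult_H D(1) D(2) inv_closed
        H_family_unitary[OF csa_H H_family_H] generates_H \<epsilon> S(1); (assumption | simp add: S(2) D(2)))
  then show ?thesis by blast
qed

end

section \<open>Quotients of matrix Hopf algebras\<close>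

context csa_ideal
begin

abbreviation "tensor_ideal \<equiv> lin_span (tensor_alg A A)
       ({tens A A y z | y z. y \<in> I \<and> z \<in> carrier A} \<union> {tens A A y z | y z. y \<in> carrier A \<and> z \<in> I})"

text \<open>This is the subspace I \<otimes> A + A \<otimes> I. Multiplying an elementary tensor by
  another one, or taking its adjoint, keeps a leg that lies in the ideal there; the subspace
  \<open>?U\<close> extends this from spanning tensors to all elements.\<close>

lemma star_ideal_tensor: "star_ideal (tensor_alg A A) tensor_ideal"
proof -
  interpret AA: csa_pair A A by (intro csa_pairI csa_axioms)
  let ?T = "tensor_alg A A" and ?t = "tens A A"
  interpret T: csa ?T by (rule AA.csa_tensor)
  let ?S = "{?t y z | y z. y \<in> I \<and> z \<in> carrier A} \<union> {?t y z | y z. y \<in> carrier A \<and> z \<in> I}"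
  have Ic: "y \<in> I \<Longrightarrow> y \<in> carrier A" for y using a_subset by blast
  have S: "?S \<subseteq> carrier ?T" using Ic by auto
  note W = T.lin_span_submodule[OF S, unfolded T.submodule_iff]
  have SW: "?S \<subseteq> tensor_ideal" by (rule T.lin_span_superset)
  have l: "?t y z \<in> tensor_ideal" if "y \<in> I" "z \<in> carrier A" for y z using SW that by blast
  have r: "?t y z \<in> tensor_ideal" if "y \<in> carrier A" "z \<in> I" for y z using SW that by blast
  have st: "star A y \<in> I" if "y \<in> I" for y using that star_ideal by (simp add: star_ideal_def)
  let ?U = "{x \<in> carrier ?T. star ?T x \<in> tensor_ideal \<and>
      (\<forall>w\<in>carrier ?T. w \<otimes>\<^bsub>?T\<^esub> x \<in> tensor_ideal \<and> x \<otimes>\<^bsub>?T\<^esub> w \<in> tensor_ideal)}"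
  have "tensor_ideal \<subseteq> ?U"
  proof (rule T.lin_span_mono_submodule)
    show "submodule ?U CC ?T"
      unfolding T.submodule_iff using W
      by (auto simp: T.l_distr T.r_distr T.smult_mult_l T.smult_mult_r T.star_add T.star_smult)
    show "?S \<subseteq> ?U"
    proof
      fix x assume x: "x \<in> ?S"
      then obtain y z where yz: "x = ?t y z" "y \<in> carrier A" "z \<in> carrier A" "y \<in> I \<or> z \<in> I" using Ic by blast
      have "w \<otimes>\<^bsub>?T\<^esub> x \<in> tensor_ideal \<and> x \<otimes>\<^bsub>?T\<^esub> w \<in> tensor_ideal" if "w \<in> carrier ?T" for w
        using that
      proof (induction w rule: AA.tens_induct)
        case (tens c d)
        have "c \<otimes> y \<in> I \<or> d \<otimes> z \<in> I" "y \<otimes> c \<in> I \<or> z \<otimes> d \<in> I"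
          using yz(4) tens I_l_closed I_r_closed by auto
        then have "?t (c \<otimes> y) (d \<otimes> z) \<in> tensor_ideal" "?t (y \<otimes> c) (z \<otimes> d) \<in> tensor_ideal"
          using l[of "c \<otimes> y" "d \<otimes> z"] r[of "c \<otimes> y" "d \<otimes> z"] l[of "y \<otimes> c" "z \<otimes> d"] r[of "y \<otimes> c" "z \<otimes> d"]
            yz(2,3) tens by blast+
        then show ?case using yz(2,3) tens by (simp add: yz(1) AA.tens_mult)
      next
        case (add v w)
        then show ?case using W yz by (simp add: T.l_distr T.r_distr)
      qed
      moreover have "star ?T x \<in> tensor_ideal"
      proof -
        have "?t (star A y) (star A z) \<in> tensor_ideal"
          using yz(2-4) st l[of "star A y" "star A z"] r[of "star A y" "star A z"] by blast
        then show ?thesis using yz(2,3) by (simp add: yz(1) AA.tens_star)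
      qed
      ultimately show "x \<in> ?U" using yz by simp
    qed
  qed
  then show ?thesis
    unfolding T.star_ideal_iff using W by auto
qed

lemma tens_in_tensor_ideal:
  "y \<in> I \<Longrightarrow> z \<in> carrier A \<Longrightarrow> tens A A y z \<in> tensor_ideal"
  "y \<in> carrier A \<Longrightarrow> z \<in> I \<Longrightarrow> tens A A y z \<in> tensor_ideal"
  unfolding lin_span_def by auto

end

text \<open>The conditions of \<open>matrix_hopf\<close> are equations for the entries, generation,
  and homomorphism properties given here as hypotheses, so they survive a surjection compatible with
  the coproducts. The surjection is a quotient map in one use and an isomorphism in the
  other.\<close>

lemma (in matrix_hopf) matrix_hopf_image:
  fixes B :: "('b, 'k) hopf_alg_scheme"
  assumes B: "csa B" and \<phi>: "\<phi> \<in> star_homs A B" and surj: "\<phi> ` carrier A = carrier B"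
    and comult_B: "comult B \<in> star_homs B (tensor_alg B B)"
    and cm: "\<And>x. x \<in> carrier A \<Longrightarrow> comult B (\<phi> x) = tensor_map A A B B \<phi> \<phi> (comult A x)"
    and e: "e \<in> star_homs B complex_alg" "\<And>x. x \<in> carrier A \<Longrightarrow> e (\<phi> x) = \<epsilon> x"
    and s: "s \<in> star_homs B (op_alg B)" "\<And>x. x \<in> carrier A \<Longrightarrow> s (\<phi> x) = \<phi> (S x)"
  shows "matrix_hopf B N G (\<lambda>g i j. \<phi> (u g i j)) ginv e s"
proof -
  interpret B: csa B by fact
  interpret BB: csa_pair B B by (intro csa_pairI B)
  interpret TB: csa "tensor_alg B B" by (rule BB.csa_tensor)
  note c = csa_axioms
  let ?pp = "tensor_map A A B B \<phi> \<phi>"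
  note F = star_homsD[OF \<phi>]
  note ppl = tensor_map_lin[OF c c B B F(1) F(1)] and ppt = tensor_map_tens[OF c c B B F(1) F(1)]
  have fin: "(\<Oplus>\<^bsub>B\<^esub>k\<in>{1..N}. \<phi> (f k)) = \<phi> (\<Oplus>k\<in>{1..N}. f k)"
    if "\<And>k. k \<in> {1..N} \<Longrightarrow> f k \<in> carrier A" for f
    using that by (intro lin_maps_finsum[OF c B F(1), symmetric]) auto
  show ?thesis
  proof (rule matrix_hopf.intro[OF B], rule matrix_hopf_axioms.intro)
    show "comult B \<in> star_homs B (tensor_alg B B)" by (rule comult_B)
    show "e \<in> star_homs B complex_alg" by (rule e(1))
    show "s \<in> star_homs B (op_alg B)" by (rule s(1))
    show "ginv g \<in> G" if "g \<in> G" for g using that by (rule ginv)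
    show "generates B {\<phi> (u g i j) | g i j. g \<in> G \<and> i \<in> {1..N} \<and> j \<in> {1..N}}"
    proof -
      have "{\<phi> (u g i j) | g i j. g \<in> G \<and> i \<in> {1..N} \<and> j \<in> {1..N}} =
          \<phi> ` {u g i j | g i j. g \<in> G \<and> i \<in> {1..N} \<and> j \<in> {1..N}}" by blast
      then show ?thesis using generates_image[OF c B generates \<phi> surj] by simp
    qed
  next
    fix g i j assume h: "g \<in> G" "i \<in> {1..N}" "j \<in> {1..N}"
    show "\<phi> (u g i j) \<in> carrier B" using h F(2) by auto
    show "star B (\<phi> (u g i j)) = \<phi> (u (ginv g) i j)" using h F(7)[of "u g i j"] by (simp add: star_u)
    show "e (\<phi> (u g i j)) = (if i = j then 1 else 0)" using h by (simp add: e(2) \<epsilon>_u)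
    show "s (\<phi> (u g i j)) = star B (\<phi> (u g j i))" using h F(7)[of "u g j i"] by (simp add: s(2) S_u)
    have "comult B (\<phi> (u g i j)) = ?pp (\<Oplus>\<^bsub>TA\<^esub>k\<in>{1..N}. tA (u g i k) (u g k j))"
      using h by (simp add: cm comult_u)
    also have "\<dots> = (\<Oplus>\<^bsub>tensor_alg B B\<^esub>k\<in>{1..N}. ?pp (tA (u g i k) (u g k j)))"
      using h by (intro lin_maps_finsum[OF T.csa_axioms TB.csa_axioms ppl]) auto
    also have "\<dots> = (\<Oplus>\<^bsub>tensor_alg B B\<^esub>k\<in>{1..N}. tens B B (\<phi> (u g i k)) (\<phi> (u g k j)))"
      using h F(2) by (intro TB.finsum_cong') (auto simp: ppt)
    finally show "comult B (\<phi> (u g i j)) = (\<Oplus>\<^bsub>tensor_alg B B\<^esub>k\<in>{1..N}. tens B B (\<phi> (u g i k)) (\<phi> (u g k j)))" .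
    have "(\<Oplus>\<^bsub>B\<^esub>k\<in>{1..N}. \<phi> (u g i k) \<otimes>\<^bsub>B\<^esub> star B (\<phi> (u g j k))) = (\<Oplus>\<^bsub>B\<^esub>k\<in>{1..N}. \<phi> (u g i k \<otimes> star A (u g j k)))"
      using h by (intro B.finsum_cong') (auto simp: F)
    also have "\<dots> = \<phi> (if i = j then \<one> else \<zero>)"
      using h by (subst fin) (auto simp: unitary1 simp del: One_nat_def)
    finally show "(\<Oplus>\<^bsub>B\<^esub>k\<in>{1..N}. \<phi> (u g i k) \<otimes>\<^bsub>B\<^esub> star B (\<phi> (u g j k))) = (if i = j then \<one>\<^bsub>B\<^esub> else \<zero>\<^bsub>B\<^esub>)"
      by (simp add: F(6) lin_maps_zero[OF c B F(1)])
    have "(\<Oplus>\<^bsub>B\<^esub>k\<in>{1..N}. star B (\<phi> (u g k i)) \<otimes>\<^bsub>B\<^esub> \<phi> (u g k j)) = (\<Oplus>\<^bsub>B\<^esub>k\<in>{1..N}. \<phi> (star A (u g k i) \<otimes> u g k j))"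
      using h by (intro B.finsum_cong') (auto simp: F)
    also have "\<dots> = \<phi> (if i = j then \<one> else \<zero>)"
      using h by (subst fin) (auto simp: unitary2 simp del: One_nat_def)
    finally show "(\<Oplus>\<^bsub>B\<^esub>k\<in>{1..N}. star B (\<phi> (u g k i)) \<otimes>\<^bsub>B\<^esub> \<phi> (u g k j)) = (if i = j then \<one>\<^bsub>B\<^esub> else \<zero>\<^bsub>B\<^esub>)"
      by (simp add: F(6) lin_maps_zero[OF c B F(1)])
  qed
qed

text \<open>The Hopf ideal conditions are imposed on the relators only. Each of them says that a
  homomorphism maps into a star ideal or to zero, so it extends to the star ideal generated by the
  relators.\<close>

locale matrix_hopf_quot = matrix_hopf A N G u ginv \<epsilon> S
  for A :: "('a, 'm) hopf_alg_scheme" (structure) and N and G :: "'x set" and u ginv \<epsilon> S +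
  fixes R :: "'a set" and J
  defines "J \<equiv> star_ideal_gen A R"
  assumes R_closed: "R \<subseteq> carrier A"
    and comult_R: "r \<in> R \<Longrightarrow> comult A r \<in> lin_span (tensor_alg A A)
       ({tens A A y z | y z. y \<in> J \<and> z \<in> carrier A} \<union> {tens A A y z | y z. y \<in> carrier A \<and> z \<in> J})"
    and \<epsilon>_R: "r \<in> R \<Longrightarrow> \<epsilon> r = 0"
    and S_R: "r \<in> R \<Longrightarrow> S r \<in> J"

sublocale matrix_hopf_quot \<subseteq> JI: csa_ideal A J
  unfolding J_def
  by (intro csa_ideal.intro csa_axioms csa_ideal_axioms.intro star_ideal_star_ideal_gen R_closed)

context matrix_hopf_quot
begin

lemma J_least: "star_ideal A I \<Longrightarrow> R \<subseteq> I \<Longrightarrow> J \<subseteq> I"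
  unfolding J_def by (rule star_ideal_gen_least)

lemma comult_J: "x \<in> J \<Longrightarrow> comult A x \<in> JI.tensor_ideal"
  using J_least[OF star_homs_preimage[OF csa_axioms T.csa_axioms comult_hom JI.star_ideal_tensor]]
    R_closed comult_R by blast

lemma \<epsilon>_J: "x \<in> J \<Longrightarrow> \<epsilon> x = 0"
  using J_least[OF star_homs_kernel[OF csa_axioms csa_complex_alg \<epsilon>_hom]] R_closed \<epsilon>_R by auto

text \<open>A star ideal is two-sided, hence also a star ideal of the opposite algebra, into which
  \<open>S\<close> is a homomorphism.\<close>

lemma S_J: "x \<in> J \<Longrightarrow> S x \<in> J"
proof -
  have "star_ideal (op_alg A) J"
    using JI.star_ideal unfolding star_ideal_iff csa.star_ideal_iff[OF csa_op_alg[OF csa_axioms]] by simp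
  from J_least[OF star_homs_preimage[OF csa_axioms csa_op_alg[OF csa_axioms] S_hom this]]
  show "x \<in> J \<Longrightarrow> S x \<in> J" using R_closed S_R by blast
qed

lemma J_closed: "x \<in> J \<Longrightarrow> x \<in> carrier A"
  using JI.a_subset by blast

lemma hopf_star_ideal_J: "hopf_star_ideal A J"
  unfolding hopf_star_ideal_def
  using JI.star_ideal comult_J \<epsilon>_J S_J J_closed by (simp add: counit_eq antipode_eq \<epsilon>'_def S'_def)

text \<open>\<open>J\<close> lies in every star ideal containing \<open>R\<close> and is itself a
  Hopf star ideal, so it is one of the sets in the intersection and the least of them.\<close>

lemma hopf_star_ideal_gen_eq: "hopf_star_ideal_gen A R = J"
proof
  have "R \<subseteq> J" unfolding J_def by (rule star_ideal_gen_superset)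
  then show "hopf_star_ideal_gen A R \<subseteq> J"
    unfolding hopf_star_ideal_gen_def using hopf_star_ideal_J by blast
  show "J \<subseteq> hopf_star_ideal_gen A R"
    unfolding hopf_star_ideal_gen_def using J_least by (auto simp: hopf_star_ideal_def)
qed

abbreviation "pr \<equiv> (\<lambda>x. J +> x)"

lemma matrix_hopf_quot: "matrix_hopf (hopf_quot A J) N G (\<lambda>g i j. pr (u g i j)) ginv
    (\<lambda>K. the_elem (\<epsilon> ` K)) (\<lambda>K. the_elem ((\<lambda>x. pr (S x)) ` K))"
proof -
  let ?Q = "JI.Q"
  note Q = JI.csa_quot and pi = JI.proj_star_hom
  note pil = star_homsD(1)[OF pi]
  interpret Q: csa ?Q by (rule Q)
  interpret QQ: csa_pair ?Q ?Q by (intro csa_pairI Q)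
  interpret TQ: csa "tensor_alg ?Q ?Q" by (rule QQ.csa_tensor)
  let ?TQ = "tensor_alg ?Q ?Q"
  note c = csa_axioms
  let ?pp = "tensor_map A A ?Q ?Q pr pr"
  let ?D = "\<lambda>x. ?pp (comult A x)"
  have pp: "?pp \<in> star_homs TA ?TQ" by (rule tensor_map_star_hom[OF c c Q Q pi pi])
  note ppt = tensor_map_tens[OF c c Q Q pil pil]
  have D: "?D \<in> star_homs A ?TQ" by (rule star_homs_comp[OF comult_hom pp])
  \<comment> \<open>The projected coproduct will vanish on \<open>J\<close>: a tensor with one leg
    in \<open>J\<close> is sent to a tensor with a zero leg.\<close>
  have ppW: "JI.tensor_ideal \<subseteq> {x \<in> carrier TA. ?pp x = \<zero>\<^bsub>?TQ\<^esub>}"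
  proof (rule T.lin_span_mono_submodule)
    show "submodule {x \<in> carrier TA. ?pp x = \<zero>\<^bsub>?TQ\<^esub>} CC TA"
      unfolding T.submodule_iff
      by (auto simp: star_homsD(2-4)[OF pp] lin_maps_zero[OF T.csa_axioms QQ.csa_tensor star_homsD(1)[OF pp]])
    have "pr y = \<zero>\<^bsub>?Q\<^esub>" if "y \<in> J" for y using that JI.proj_zero_iff J_closed by blast
    then show "{tA y z | y z. y \<in> J \<and> z \<in> carrier A} \<union> {tA y z | y z. y \<in> carrier A \<and> z \<in> J} \<subseteq>
        {x \<in> carrier TA. ?pp x = \<zero>\<^bsub>?TQ\<^esub>}"
      using J_closed by (auto simp: ppt QQ.tens_zero_l QQ.tens_zero_r)
  qed
  have D0: "?D x = \<zero>\<^bsub>?TQ\<^esub>" if "x \<in> J" for x using comult_J[OF that] ppW by blast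
  define \<Delta> where "\<Delta> = (\<lambda>K. the_elem (?D ` K))"
  have hq: "hopf_quot A J = with_comult ?Q \<Delta>"
    unfolding hopf_quot_def Let_def \<Delta>_def ..
  have \<Delta>: "\<Delta> \<in> star_homs ?Q ?TQ" unfolding \<Delta>_def by (rule JI.quot_lift_star_hom[OF QQ.csa_tensor D D0])
  have \<Delta>e: "\<Delta> (pr x) = ?D x" if "x \<in> carrier A" for x
    unfolding \<Delta>_def by (rule JI.quot_lift_eq[OF QQ.csa_tensor star_homsD(1)[OF D] D0 that])
  note \<epsilon>q = JI.quot_lift_star_hom[OF csa_complex_alg \<epsilon>_hom]
    and \<epsilon>qe = JI.quot_lift_eq[OF csa_complex_alg star_homsD(1)[OF \<epsilon>_hom]]
  have piop: "pr \<in> star_homs (op_alg A) (op_alg ?Q)"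
    using star_homsD[OF pi] by (intro star_homsI) auto
  note So = star_homs_comp[OF S_hom piop]
  have S0: "pr (S x) = \<zero>\<^bsub>op_alg ?Q\<^esub>" if "x \<in> J" for x
    using S_J[OF that] JI.proj_zero_iff[of "S x"] J_closed by simp
  note Sq = JI.quot_lift_star_hom[OF csa_op_alg[OF Q] So S0]
    and Sqe = JI.quot_lift_eq[OF csa_op_alg[OF Q] star_homsD(1)[OF So] S0]
  show ?thesis
    unfolding hq
  proof (rule matrix_hopf_image[OF csa_with_comult[OF Q], where \<phi> = pr], unfold with_comult_simps star_homs_with_comult
      tensor_alg_with_comult tensor_map_with_comult star_homs_op_with_comult)
    show "pr \<in> star_homs A ?Q" by (rule pi)
    show "pr ` carrier A = carrier ?Q" by (simp add: JI.carrier_quot)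
    show "\<Delta> \<in> star_homs ?Q ?TQ" by (rule \<Delta>)
    show "\<Delta> (pr x) = ?D x" if "x \<in> carrier A" for x using that by (rule \<Delta>e)
    show "(\<lambda>K. the_elem (\<epsilon> ` K)) \<in> star_homs ?Q complex_alg" using \<epsilon>_J by (intro \<epsilon>q) auto
    show "the_elem (\<epsilon> ` pr x) = \<epsilon> x" if "x \<in> carrier A" for x using that \<epsilon>_J by (intro \<epsilon>qe) auto
    show "(\<lambda>K. the_elem ((\<lambda>x. pr (S x)) ` K)) \<in> star_homs ?Q (op_alg ?Q)" by (rule Sq)
    show "the_elem ((\<lambda>x. pr (S x)) ` pr x) = pr (S x)" if "x \<in> carrier A" for x using that by (subst Sqe) auto
  qed
qed

end

section \<open>Transport along an isomorphism\<close>

lemma star_homs_cong: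
  assumes "csa A" "f \<in> star_homs A B" "\<And>x. x \<in> carrier A \<Longrightarrow> h x = f x"
  shows "h \<in> star_homs A B"
proof -
  interpret A: csa A by fact
  show ?thesis by (rule star_homsI) (auto intro!: lin_mapsI simp: assms(3) star_homsD[OF assms(2)])
qed

text \<open>Compatibility with the coproduct is enough. The transported counit and antipode satisfy
  the axioms on \<open>B\<close>, and by uniqueness they are the counit and antipode of
  \<open>B\<close>. That the coproduct of \<open>B\<close> is a homomorphism follows because it
  agrees with the transported one.\<close>

lemma (in matrix_hopf) transport:
  fixes B :: "('b, 'k) hopf_alg_scheme"
  assumes B: "csa B" and \<phi>: "\<phi> \<in> star_homs A B" and \<psi>: "\<psi> \<in> star_homs B A"
    and \<psi>\<phi>: "\<And>x. x \<in> carrier A \<Longrightarrow> \<psi> (\<phi> x) = x" and \<phi>\<psi>: "\<And>y. y \<in> carrier B \<Longrightarrow> \<phi> (\<psi> y) = y"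
    and cm: "\<And>x. x \<in> carrier A \<Longrightarrow> comult B (\<phi> x) = tensor_map A A B B \<phi> \<phi> (comult A x)"
  shows "cqg_algebra B" "hopf_star_iso A B \<phi>"
proof -
  interpret B: csa B by fact
  note c = csa_axioms
  let ?pp = "tensor_map A A B B \<phi> \<phi>"
  have pp: "?pp \<in> star_homs TA (tensor_alg B B)" by (rule tensor_map_star_hom[OF c c B B \<phi> \<phi>])
  note F = star_homsD[OF \<phi>] and P = star_homsD[OF \<psi>]
  have op: "\<phi> \<in> star_homs (op_alg A) (op_alg B)" using F by (intro star_homsI) auto
  have surj: "\<phi> ` carrier A = carrier B"
  proof
    show "carrier B \<subseteq> \<phi> ` carrier A" using \<phi>\<psi> P(2) by (metis image_eqI subsetI)
  qed (use F(2) in auto)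
  have comult_B: "comult B \<in> star_homs B (tensor_alg B B)"
  proof (rule star_homs_cong[OF B star_homs_comp[OF \<psi> star_homs_comp[OF comult_hom pp]]])
    show "comult B y = ?pp (comult A (\<psi> y))" if "y \<in> carrier B" for y
      using cm[OF P(2)[OF that]] \<phi>\<psi>[OF that] by simp
  qed
  interpret MB: matrix_hopf B N G "\<lambda>g i j. \<phi> (u g i j)" ginv "\<lambda>y. \<epsilon> (\<psi> y)" "\<lambda>y. \<phi> (S (\<psi> y))"
    by (rule matrix_hopf_image[OF B \<phi> surj comult_B cm star_homs_comp[OF \<psi> \<epsilon>_hom] _
          star_homs_comp[OF \<psi> star_homs_comp[OF S_hom op]]]) (simp_all add: \<psi>\<phi>)
  show "cqg_algebra B" by (rule MB.cqg)
  have "bij_betw \<phi> (carrier A) (carrier B)"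
    unfolding bij_betw_def using surj \<psi>\<phi> by (metis inj_onI)
  moreover have "S x \<in> carrier A" if "x \<in> carrier A" for x using star_homsD(2)[OF S_hom that] by simp
  ultimately show "hopf_star_iso A B \<phi>"
    unfolding hopf_star_iso_def MB.counit_eq counit_eq MB.antipode_eq antipode_eq
    using \<phi> cm F(2) \<psi>\<phi> by (auto simp: \<epsilon>'_def S'_def MB.\<epsilon>'_def MB.S'_def)
qed

section \<open>Subalgebras and restricted coproducts\<close>

lemma star_subalgebra_image:
  assumes "csa A" "csa B" "f \<in> star_homs A B"
  shows "star_subalgebra B (f ` carrier A)"
proof -
  interpret A: csa A by fact
  interpret B: csa B by fact
  note f = star_homsD[OF assms(3)]
  show ?thesis
    unfolding B.star_subalgebra_iff
  proof (intro conjI ballI allI)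
    show "\<zero>\<^bsub>B\<^esub> \<in> f ` carrier A"
      using lin_maps_zero[OF assms(1,2) f(1)] by (metis A.zero_closed image_eqI)
    show "\<one>\<^bsub>B\<^esub> \<in> f ` carrier A" using f(6) by (metis A.one_closed image_eqI)
  qed (use f(2) in \<open>auto simp: f(3-5,7)[symmetric]\<close>)
qed

text \<open>One inclusion holds because the image is a star subalgebra, the other because preimages
  of star subalgebras are star subalgebras.\<close>

lemma star_subalgebra_gen_image:
  assumes "csa A" "csa B" "f \<in> star_homs A B" "generates A S"
  shows "star_subalgebra_gen B (f ` S) = f ` carrier A"
proof
  interpret A: csa A by fact
  interpret B: csa B by fact
  have S: "S \<subseteq> carrier A" using assms(4) by (simp add: generates_def)
  show "star_subalgebra_gen B (f ` S) \<subseteq> f ` carrier A"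
    unfolding star_subalgebra_gen_def using star_subalgebra_image[OF assms(1-3)] S by blast
  show "f ` carrier A \<subseteq> star_subalgebra_gen B (f ` S)"
    unfolding star_subalgebra_gen_def
  proof (intro Inter_greatest)
    fix T assume T: "T \<in> {T. star_subalgebra B T \<and> f ` S \<subseteq> T}"
    then have T': "star_subalgebra B T" "f ` S \<subseteq> T" by auto
    note T'' = T'(1)[unfolded B.star_subalgebra_iff]
    have "star_subalgebra A {x \<in> carrier A. f x \<in> T}"
      unfolding A.star_subalgebra_iff using T''
      by (auto simp: star_homsD(2-)[OF assms(3)] lin_maps_zero[OF assms(1,2) star_homsD(1)[OF assms(3)]])
    then have "carrier A \<subseteq> {x \<in> carrier A. f x \<in> T}"
      using assms(4) T'(2) S unfolding generates_def by blast
    then show "f ` carrier A \<subseteq> T" by blast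
  qed
qed

text \<open>
  A linear retraction of the ambient algebra onto the subalgebra makes the map between the tensor
  squares injective, so that the restricted coproduct is determined.
\<close>

lemma hopf_sub_comult:
  fixes E :: "('a, 'm) hopf_alg_scheme"
  defines "B \<equiv> \<lambda>T. E\<lparr>carrier := T\<rparr>"
  assumes E: "csa E" and T: "star_subalgebra E T"
    and r: "r \<in> lin_maps E (B T)" "\<And>y. y \<in> T \<Longrightarrow> r y = y"
    and t: "t \<in> carrier (tensor_alg (B T) (B T))"
      "tensor_map (B T) (B T) E E (\<lambda>y. y) (\<lambda>y. y) t = comult E x"
  shows "comult (hopf_sub E T) x = t"
proof -
  have B: "csa (B T)" unfolding B_def by (rule csa_subalgebra[OF E T])
  interpret E: csa E by (rule E)
  interpret BB: csa_pair "B T" "B T" by (intro csa_pairI B)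
  have TE: "T \<subseteq> carrier E" using T[unfolded E.star_subalgebra_iff] by blast
  have \<iota>: "(\<lambda>y. y) \<in> lin_maps (B T) E"
    using TE by (intro lin_mapsI) (auto simp: B_def)
  let ?i = "tensor_map (B T) (B T) E E (\<lambda>y. y) (\<lambda>y. y)" and ?r = "tensor_map E E (B T) (B T) r r"
  note i = tensor_map_lin[OF B B E E \<iota> \<iota>] and it = tensor_map_tens[OF B B E E \<iota> \<iota>]
  note rl = tensor_map_lin[OF E E B B r(1) r(1)] and rt = tensor_map_tens[OF E E B B r(1) r(1)]
  \<comment> \<open>The tensor square of the retraction is a left inverse of the tensor square of
    the inclusion.\<close>
  have ri: "?r (?i s) = s" if "s \<in> carrier (tensor_alg (B T) (B T))" for s
  proof (rule BB.lin_maps_tens_eq[OF BB.csa_tensor lin_maps_comp[OF i rl] lin_maps_id _ that])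
    fix y z assume yz: "y \<in> carrier (B T)" "z \<in> carrier (B T)"
    then have "y \<in> T" "z \<in> T" by (simp_all add: B_def)
    then show "?r (?i (tens (B T) (B T) y z)) = tens (B T) (B T) y z"
      using it[OF yz] rt[of y z] TE r(2) by auto
  qed
  have "comult (hopf_sub E T) x = (THE t. t \<in> carrier (tensor_alg (B T) (B T)) \<and> ?i t = comult E x)"
    unfolding hopf_sub_def Let_def B_def by simp
  also have "\<dots> = t"
  proof (rule the_equality)
    show "t \<in> carrier (tensor_alg (B T) (B T)) \<and> ?i t = comult E x" using t by simp
    fix s assume "s \<in> carrier (tensor_alg (B T) (B T)) \<and> ?i s = comult E x"
    then show "s = t" using ri[of s] ri[of t] t by simp
  qed
  finally show ?thesis .
qed

lemma middle_swap_with_comult [simp]: "middle_swap A (with_comult B \<Delta>) = middle_swap A B"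
  unfolding middle_swap_def by (simp add: Let_def)

section \<open>Families with equal row sums over a subgroup\<close>

text \<open>The relations of O(H_N^+(G, L)) in an arbitrary star algebra. The consequences for row
  sums are proved once and used in the bare quotient of \<open>H_plus\<close>, to verify the Hopf
  ideal conditions, and again in the resulting Hopf algebra.\<close>

locale rel_family = csa B + comm_group G + L: subgroup L G
  for B :: "('b, 'k) star_alg_scheme" and G :: "('g, 'm) monoid_scheme" (structure) and L +
  fixes N :: nat and b :: "nat \<Rightarrow> nat \<Rightarrow> 'g \<Rightarrow> 'b"
  assumes N: "N \<ge> 1" and fam: "H_family B N G b"
    and rows: "i \<in> {1..N} \<Longrightarrow> j \<in> {1..N} \<Longrightarrow> g \<in> L \<Longrightarrow>
      (\<Oplus>\<^bsub>B\<^esub>k\<in>{1..N}. b i k g) = (\<Oplus>\<^bsub>B\<^esub>k\<in>{1..N}. b j k g)"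
begin

lemmas D = H_familyD[OF fam]

text \<open>Row 1 exists because \<open>N \<ge> 1\<close>; for \<open>g \<in> L\<close> every other
  row has the same sum.\<close>

definition "row g = (\<Oplus>\<^bsub>B\<^esub>k\<in>{1..N}. b 1 k g)"

lemma row_eq: "i \<in> {1..N} \<Longrightarrow> g \<in> L \<Longrightarrow> row g = (\<Oplus>\<^bsub>B\<^esub>k\<in>{1..N}. b i k g)"
  unfolding row_def using N by (intro rows) auto

lemma row_closed: "g \<in> carrier G \<Longrightarrow> row g \<in> carrier B"
  unfolding row_def using N D(1) by (intro finsum_closed) auto

text \<open>If the sum is taken along row \<open>j\<close>, the row of the other factor, only the
  term with column \<open>l\<close> survives. The second identity also uses that the group is
  commutative.\<close>

lemma row_mult_b:
  assumes "g \<in> L" "j \<in> {1..N}" "l \<in> {1..N}" "h \<in> carrier G"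
  shows "row g \<otimes>\<^bsub>B\<^esub> b j l h = b j l (g \<otimes> h)" "b j l h \<otimes>\<^bsub>B\<^esub> row g = b j l (g \<otimes> h)"
proof -
  have g: "g \<in> carrier G" using assms(1) by (rule L.mem_carrier)
  have "row g \<otimes>\<^bsub>B\<^esub> b j l h = (\<Oplus>\<^bsub>B\<^esub>k\<in>{1..N}. b j k g \<otimes>\<^bsub>B\<^esub> b j l h)"
    unfolding row_eq[OF assms(2,1)] using assms g D(1) by (intro finsum_ldistr) auto
  also have "\<dots> = (\<Oplus>\<^bsub>B\<^esub>k\<in>{1..N}. if k = l then b j k (g \<otimes> h) else \<zero>\<^bsub>B\<^esub>)"
    using assms g D(1) by (intro finsum_cong') (auto simp: D(3))
  also have "\<dots> = b j l (g \<otimes> h)" using assms g D(1) by (intro finsum_delta) auto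
  finally show "row g \<otimes>\<^bsub>B\<^esub> b j l h = b j l (g \<otimes> h)" .
  have "b j l h \<otimes>\<^bsub>B\<^esub> row g = (\<Oplus>\<^bsub>B\<^esub>k\<in>{1..N}. b j l h \<otimes>\<^bsub>B\<^esub> b j k g)"
    unfolding row_eq[OF assms(2,1)] using assms g D(1) by (intro finsum_rdistr) auto
  also have "\<dots> = (\<Oplus>\<^bsub>B\<^esub>k\<in>{1..N}. if l = k then b j k (g \<otimes> h) else \<zero>\<^bsub>B\<^esub>)"
    using assms g D(1) by (intro finsum_cong') (auto simp: D(3) m_comm)
  also have "\<dots> = b j l (g \<otimes> h)" using assms g D(1) by (intro finsum_delta') auto
  finally show "b j l h \<otimes>\<^bsub>B\<^esub> row g = b j l (g \<otimes> h)" .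
qed

text \<open>Multiply \<open>row g\<close> by the column sum at the identity, which is the unit. This
  is needed because the antipode turns row sums into column sums.\<close>

lemma col_sum:
  assumes "i \<in> {1..N}" "g \<in> L"
  shows "(\<Oplus>\<^bsub>B\<^esub>k\<in>{1..N}. b k i g) = row g"
proof -
  have g: "g \<in> carrier G" using assms(2) by (rule L.mem_carrier)
  have "row g = row g \<otimes>\<^bsub>B\<^esub> (\<Oplus>\<^bsub>B\<^esub>k\<in>{1..N}. b k i \<one>)" using D(6)[OF assms(1)] row_closed[OF g] by simp
  also have "\<dots> = (\<Oplus>\<^bsub>B\<^esub>k\<in>{1..N}. row g \<otimes>\<^bsub>B\<^esub> b k i \<one>)"
    using assms g D(1) row_closed by (intro finsum_rdistr) auto
  also have "\<dots> = (\<Oplus>\<^bsub>B\<^esub>k\<in>{1..N}. b k i g)"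
    using assms g D(1) by (intro finsum_cong') (auto simp: row_mult_b)
  finally show ?thesis ..
qed

lemma row_mult:
  assumes "g \<in> L" "h \<in> L"
  shows "row g \<otimes>\<^bsub>B\<^esub> row h = row (g \<otimes> h)"
proof -
  have gh: "g \<in> carrier G" "h \<in> carrier G" using assms L.mem_carrier by auto
  have "row g \<otimes>\<^bsub>B\<^esub> row h = (\<Oplus>\<^bsub>B\<^esub>k\<in>{1..N}. row g \<otimes>\<^bsub>B\<^esub> b 1 k h)"
    unfolding row_def[of h] using gh D(1) row_closed N by (intro finsum_rdistr) auto
  also have "\<dots> = row (g \<otimes> h)"
    unfolding row_def[of "g \<otimes> h"] using assms gh D(1) N by (intro finsum_cong') (auto simp: row_mult_b)
  finally show ?thesis .
qed

lemma row_one: "row \<one> = \<one>\<^bsub>B\<^esub>"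
  unfolding row_def using N by (intro D(5)) auto

lemma row_star:
  assumes "g \<in> carrier G"
  shows "star B (row g) = row (inv g)"
proof -
  have "star B (\<Oplus>\<^bsub>B\<^esub>k\<in>S. f k) = (\<Oplus>\<^bsub>B\<^esub>k\<in>S. star B (f k))"
    if "finite S" "f \<in> S \<rightarrow> carrier B" for f and S :: "nat set"
    using that by (induction S rule: finite_induct) (simp_all add: star_add Pi_iff)
  then have "star B (row g) = (\<Oplus>\<^bsub>B\<^esub>k\<in>{1..N}. star B (b 1 k g))"
    unfolding row_def using assms D(1) N by auto
  also have "\<dots> = row (inv g)"
    unfolding row_def using assms D(1) N by (intro finsum_cong') (auto simp: D(2))
  finally show ?thesis .
qed

end

section \<open>The Hopf algebra O(H_N^+(G, L)) as a quotient\<close>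

locale H_rel = H_setup G N + comm_group G + L: subgroup L G
  for G :: "('g, 'm) monoid_scheme" (structure) and N :: nat and L :: "'g set" +
  assumes N: "N \<ge> 1"
begin

definition "R = {(\<Oplus>\<^bsub>H\<^esub>k\<in>{1..N}. a i k g) \<ominus>\<^bsub>H\<^esub> (\<Oplus>\<^bsub>H\<^esub>k\<in>{1..N}. a j k g) | i j g.
    i \<in> {1..N} \<and> j \<in> {1..N} \<and> g \<in> L}"

definition "J = star_ideal_gen H R"

lemma R_J: "r \<in> R \<Longrightarrow> r \<in> J"
  unfolding J_def by (rule subsetD[OF star_ideal_gen_superset])

lemma aH_closed [simp]: "i \<in> {1..N} \<Longrightarrow> j \<in> {1..N} \<Longrightarrow> g \<in> carrier G \<Longrightarrow> a i j g \<in> carrier H"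
  by (rule H_familyD(1)[OF H_family_H])

lemma sum_closed: "i \<in> {1..N} \<Longrightarrow> g \<in> carrier G \<Longrightarrow> (\<Oplus>\<^bsub>H\<^esub>k\<in>{1..N}. a i k g) \<in> carrier H"
proof -
  interpret H: csa H by (rule csa_H)
  show "i \<in> {1..N} \<Longrightarrow> g \<in> carrier G \<Longrightarrow> (\<Oplus>\<^bsub>H\<^esub>k\<in>{1..N}. a i k g) \<in> carrier H"
    by (intro H.finsum_closed) auto
qed

lemma R_closed: "R \<subseteq> carrier H"
proof -
  interpret H: csa H by (rule csa_H)
  show ?thesis unfolding R_def using sum_closed L.mem_carrier by auto
qed

interpretation HJ: csa_ideal "H_plus N G" J
  unfolding J_def
  by (intro csa_ideal.intro csa_H csa_ideal_axioms.intro csa.star_ideal_star_ideal_gen R_closed)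

abbreviation "ab \<equiv> (\<lambda>i j g. J +>\<^bsub>H\<^esub> a i j g)"

lemma rel_family_quot: "rel_family HJ.Q G L N ab"
proof (intro rel_family.intro HJ.csa_quot comm_group_axioms L.subgroup_axioms rel_family_axioms.intro)
  show "1 \<le> N" by (rule N)
  show "H_family HJ.Q N G ab"
    by (rule H_family_image[OF csa_H HJ.csa_quot is_group H_family_H HJ.proj_star_hom])
  fix i j g assume h: "i \<in> {1..N}" "j \<in> {1..N}" "g \<in> L"
  have g: "g \<in> carrier G" using h(3) by (rule L.mem_carrier)
  have fin: "(\<Oplus>\<^bsub>HJ.Q\<^esub>k\<in>{1..N}. ab i k g) = J +>\<^bsub>H\<^esub> (\<Oplus>\<^bsub>H\<^esub>k\<in>{1..N}. a i k g)" if "i \<in> {1..N}" for i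
    using that g by (intro lin_maps_finsum[OF csa_H HJ.csa_quot star_homsD(1)[OF HJ.proj_star_hom], symmetric]) auto
  have "(\<Oplus>\<^bsub>H\<^esub>k\<in>{1..N}. a i k g) \<ominus>\<^bsub>H\<^esub> (\<Oplus>\<^bsub>H\<^esub>k\<in>{1..N}. a j k g) \<in> R"
    unfolding R_def using h by blast
  then have "(\<Oplus>\<^bsub>H\<^esub>k\<in>{1..N}. a i k g) \<ominus>\<^bsub>H\<^esub> (\<Oplus>\<^bsub>H\<^esub>k\<in>{1..N}. a j k g) \<in> J"
    by (rule R_J)
  then show "(\<Oplus>\<^bsub>HJ.Q\<^esub>k\<in>{1..N}. ab i k g) = (\<Oplus>\<^bsub>HJ.Q\<^esub>k\<in>{1..N}. ab j k g)"
    unfolding fin[OF h(1)] fin[OF h(2)] using h g by (subst HJ.coset_eq_iff) (auto intro: sum_closed)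
qed

text \<open>Write \<open>s i\<close> for the sum of row \<open>i\<close>. Its coproduct is the sum
  over \<open>l\<close> of the tensors of \<open>a i l g\<close> with \<open>s l\<close>. Modulo the
  tensor ideal each \<open>s l\<close> may be replaced by \<open>s 1\<close>; this gives the tensor
  of \<open>s i\<close> with \<open>s 1\<close>, hence that of \<open>s 1\<close> with itself, which
  no longer depends on \<open>i\<close>.\<close>

lemma comult_R:
  assumes "r \<in> R"
  shows "comult H r \<in> HJ.tensor_ideal"
proof -
  interpret HH: csa_pair H H by (intro csa_pairI csa_H)
  let ?T = "tensor_alg H H" and ?t = "tens H H"
  \<comment> \<open>Congruence modulo the tensor ideal is handled as equality in the quotient by
    it.\<close>
  interpret W: csa_ideal ?T HJ.tensor_ideal
    by (intro csa_ideal.intro HH.csa_tensor csa_ideal_axioms.intro HJ.star_ideal_tensor)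
  let ?\<rho> = "\<lambda>x. HJ.tensor_ideal +>\<^bsub>?T\<^esub> x"
  note \<rho> = star_homsD(1)[OF W.proj_star_hom]
  interpret TQ: csa W.Q by (rule W.csa_quot)
  note lc = star_homsD(1)[OF comult_H(1)]
  obtain i j g where r: "r = (\<Oplus>\<^bsub>H\<^esub>k\<in>{1..N}. a i k g) \<ominus>\<^bsub>H\<^esub> (\<Oplus>\<^bsub>H\<^esub>k\<in>{1..N}. a j k g)"
    "i \<in> {1..N}" "j \<in> {1..N}" "g \<in> L" using assms unfolding R_def by blast
  have g: "g \<in> carrier G" using r(4) by (rule L.mem_carrier)
  define s where "s = (\<lambda>i. \<Oplus>\<^bsub>H\<^esub>k\<in>{1..N}. a i k g)"
  have s_eq: "s i = (\<Oplus>\<^bsub>H\<^esub>k\<in>{1..N}. a i k g)" for i by (simp add: s_def)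
  have sc: "s i \<in> carrier H" if "i \<in> {1..N}" for i unfolding s_def using that g by (rule sum_closed)
  have one: "1 \<in> {1..N}" using N by simp
  have sJ: "s i \<ominus>\<^bsub>H\<^esub> s j \<in> J" if "i \<in> {1..N}" "j \<in> {1..N}" for i j
  proof (rule R_J)
    show "s i \<ominus>\<^bsub>H\<^esub> s j \<in> R" unfolding R_def s_def using that r(4) by blast
  qed
  have l: "?\<rho> (?t x y) = ?\<rho> (?t x' y)" if "x \<in> carrier H" "x' \<in> carrier H" "y \<in> carrier H" "x \<ominus>\<^bsub>H\<^esub> x' \<in> J" for x x' y
  proof -
    have "?t (x \<ominus>\<^bsub>H\<^esub> x') y \<in> HJ.tensor_ideal"
      using that(4,3) by (rule HJ.tens_in_tensor_ideal(1))
    then show ?thesis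
      using that lin_maps_minus[OF csa_H HH.csa_tensor bilinD(2)[OF HH.tens_bilin that(3)], of x x']
      by (subst W.coset_eq_iff) auto
  qed
  have rr: "?\<rho> (?t x y) = ?\<rho> (?t x y')" if "x \<in> carrier H" "y \<in> carrier H" "y' \<in> carrier H" "y \<ominus>\<^bsub>H\<^esub> y' \<in> J" for x y y'
  proof -
    have "?t x (y \<ominus>\<^bsub>H\<^esub> y') \<in> HJ.tensor_ideal"
      using that(1,4) by (rule HJ.tens_in_tensor_ideal(2))
    then show ?thesis
      using that lin_maps_minus[OF csa_H HH.csa_tensor bilinD(1)[OF HH.tens_bilin that(1)], of y y']
      by (subst W.coset_eq_iff) auto
  qed
  have main: "?\<rho> (comult H (s i)) = ?\<rho> (?t (s 1) (s 1))" if i: "i \<in> {1..N}" for i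
  proof -
    have "comult H (s i) = (\<Oplus>\<^bsub>?T\<^esub>k\<in>{1..N}. comult H (a i k g))"
      unfolding s_def using i g by (intro lin_maps_finsum[OF csa_H HH.csa_tensor lc]) auto
    also have "\<dots> = (\<Oplus>\<^bsub>?T\<^esub>k\<in>{1..N}. \<Oplus>\<^bsub>?T\<^esub>l\<in>{1..N}. ?t (a i l g) (a l k g))"
      using i g by (intro W.finsum_cong') (auto simp: comult_H(2) intro!: W.finsum_closed)
    also have "\<dots> = (\<Oplus>\<^bsub>?T\<^esub>l\<in>{1..N}. \<Oplus>\<^bsub>?T\<^esub>k\<in>{1..N}. ?t (a i l g) (a l k g))"
      using i g by (intro W.finsum_swap) auto
    also have "\<dots> = (\<Oplus>\<^bsub>?T\<^esub>l\<in>{1..N}. ?t (a i l g) (s l))"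
    proof (intro W.finsum_cong' refl)
      fix l assume l: "l \<in> {1..N}"
      show "(\<Oplus>\<^bsub>?T\<^esub>k\<in>{1..N}. ?t (a i l g) (a l k g)) = ?t (a i l g) (s l)"
        unfolding s_def using i l g
        by (intro lin_maps_finsum[OF csa_H HH.csa_tensor bilinD(1)[OF HH.tens_bilin], symmetric]) auto
    qed (use i g sc in auto)
    finally have "?\<rho> (comult H (s i)) = (\<Oplus>\<^bsub>W.Q\<^esub>l\<in>{1..N}. ?\<rho> (?t (a i l g) (s l)))"
      using i g sc lin_maps_finsum[OF HH.csa_tensor W.csa_quot \<rho>, of "{1..N}" "\<lambda>l. ?t (a i l g) (s l)"] by simp
    also have "\<dots> = (\<Oplus>\<^bsub>W.Q\<^esub>l\<in>{1..N}. ?\<rho> (?t (a i l g) (s 1)))"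
      using i g sc one sJ by (intro TQ.finsum_cong' rr) auto
    also have "\<dots> = ?\<rho> (\<Oplus>\<^bsub>?T\<^esub>l\<in>{1..N}. ?t (a i l g) (s 1))"
      using i g sc one by (intro lin_maps_finsum[OF HH.csa_tensor W.csa_quot \<rho>, symmetric]) auto
    also have "(\<Oplus>\<^bsub>?T\<^esub>l\<in>{1..N}. ?t (a i l g) (s 1)) = ?t (s i) (s 1)"
      unfolding s_eq[of i] using i g sc one
      by (intro lin_maps_finsum[OF csa_H HH.csa_tensor bilinD(2)[OF HH.tens_bilin], symmetric]) auto
    also have "?\<rho> \<dots> = ?\<rho> (?t (s 1) (s 1))"
      using i sc one sJ by (intro l) auto
    finally show ?thesis .
  qed
  have c: "comult H (s i) \<in> carrier ?T" if "i \<in> {1..N}" for i using that sc lin_mapsD(1)[OF lc] by blast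
  have "comult H (s i) \<ominus>\<^bsub>?T\<^esub> comult H (s j) \<in> HJ.tensor_ideal"
    using main[OF r(2)] main[OF r(3)] W.coset_eq_iff[OF c[OF r(2)] c[OF r(3)]] by simp
  then show ?thesis
    unfolding r(1) s_eq[symmetric] using lin_maps_minus[OF csa_H HH.csa_tensor lc sc[OF r(2)] sc[OF r(3)]] by simp
qed

text \<open>The counit is 1 on every row sum for \<open>g \<in> L\<close>, so it kills the relators.
  The antipode sends the row sum of \<open>g\<close> to the column sum of \<open>inv g\<close>; in
  the quotient by \<open>J\<close> this is the row sum of \<open>inv g\<close>, which is the same
  for all indices, so differences are sent into \<open>J\<close>.\<close>

lemma matrix_hopf_rel:
  shows "H_plus_rel N G L = hopf_quot H J"
    and "\<exists>\<epsilon> S. matrix_hopf (hopf_quot H J) N (carrier G) (\<lambda>g i j. ab i j g) (m_inv G) \<epsilon> S"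
proof -
  obtain \<epsilon> S where "matrix_hopf H N (carrier G) (\<lambda>g i j. a i j g) (m_inv G) \<epsilon> S"
    using matrix_hopf_H by blast
  then interpret MH: matrix_hopf H N "carrier G" "\<lambda>g i j. a i j g" "m_inv G" \<epsilon> S .
  interpret Q: rel_family HJ.Q G L N ab by (rule rel_family_quot)
  interpret MQ: matrix_hopf_quot H N "carrier G" "\<lambda>g i j. a i j g" "m_inv G" \<epsilon> S R J
  proof (unfold_locales, fold J_def)
    show "R \<subseteq> carrier H" by (rule R_closed)
    show "comult H r \<in> HJ.tensor_ideal" if "r \<in> R" for r using that by (rule comult_R)
    fix r assume "r \<in> R"
    then obtain i j g where r: "r = (\<Oplus>\<^bsub>H\<^esub>k\<in>{1..N}. a i k g) \<ominus>\<^bsub>H\<^esub> (\<Oplus>\<^bsub>H\<^esub>k\<in>{1..N}. a j k g)"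
      "i \<in> {1..N}" "j \<in> {1..N}" "g \<in> L" unfolding R_def by blast
    have g: "g \<in> carrier G" using r(4) by (rule L.mem_carrier)
    note s = sum_closed[OF r(2) g] sum_closed[OF r(3) g]
    have e: "\<epsilon> (\<Oplus>\<^bsub>H\<^esub>k\<in>{1..N}. a i k g) = 1" if i: "i \<in> {1..N}" for i
    proof -
      have "\<epsilon> (\<Oplus>\<^bsub>H\<^esub>k\<in>{1..N}. a i k g) = (\<Oplus>\<^bsub>complex_alg\<^esub>k\<in>{1..N}. \<epsilon> (a i k g))"
        using i g by (intro lin_maps_finsum[OF csa_H csa_complex_alg star_homsD(1)[OF MH.\<epsilon>_hom]]) auto
      also have "\<dots> = (\<Sum>k\<in>{1..N}. if i = k then 1 else 0)"
        unfolding finsum_complex_alg[OF finite_atLeastAtMost] using i g by (intro sum.cong) (auto simp: MH.\<epsilon>_u)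
      finally show ?thesis using i by simp
    qed
    show "\<epsilon> r = 0"
      unfolding r(1) using lin_maps_minus[OF csa_H csa_complex_alg star_homsD(1)[OF MH.\<epsilon>_hom] s] e[OF r(2)] e[OF r(3)]
        csa.uminus_smult[OF csa_complex_alg, of 1]
      by (simp add: a_minus_def)
    have Sl: "S \<in> lin_maps H H" using star_homsD(1)[OF MH.S_hom] by simp
    have Ss: "J +>\<^bsub>H\<^esub> S (\<Oplus>\<^bsub>H\<^esub>k\<in>{1..N}. a i k g) = Q.row (inv g)" if i: "i \<in> {1..N}" for i
    proof -
      have "J +>\<^bsub>H\<^esub> S (\<Oplus>\<^bsub>H\<^esub>k\<in>{1..N}. a i k g) = (\<Oplus>\<^bsub>HJ.Q\<^esub>k\<in>{1..N}. J +>\<^bsub>H\<^esub> S (a i k g))"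
        using i g
        by (intro lin_maps_finsum[OF csa_H HJ.csa_quot lin_maps_comp[OF Sl star_homsD(1)[OF HJ.proj_star_hom]]]) auto
      also have "\<dots> = (\<Oplus>\<^bsub>HJ.Q\<^esub>k\<in>{1..N}. ab k i (inv g))"
        using i g by (intro Q.finsum_cong') (auto simp: MH.S_u MH.star_u)
      also have "\<dots> = Q.row (inv g)" using i r(4) by (intro Q.col_sum) auto
      finally show ?thesis .
    qed
    show "S r \<in> J"
      unfolding r(1) lin_maps_minus[OF csa_H csa_H Sl s]
      using Ss[OF r(2)] Ss[OF r(3)] HJ.coset_eq_iff[OF lin_mapsD(1)[OF Sl s(1)] lin_mapsD(1)[OF Sl s(2)]] by simp
  qed
  show "H_plus_rel N G L = hopf_quot H J"
    unfolding H_plus_rel_def Let_def R_def[symmetric] MQ.hopf_star_ideal_gen_eq ..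
  show "\<exists>\<epsilon> S. matrix_hopf (hopf_quot H J) N (carrier G) (\<lambda>g i j. ab i j g) (m_inv G) \<epsilon> S"
    using MQ.matrix_hopf_quot by blast
qed

abbreviation "A \<equiv> H_plus_rel N G L"

lemma A_with_comult: "\<exists>\<Delta>. A = with_comult HJ.Q \<Delta>"
  unfolding matrix_hopf_rel(1) hopf_quot_def Let_def by blast

lemma rel_family_A: "rel_family A G L N ab"
proof -
  obtain \<Delta> where \<Delta>: "A = with_comult HJ.Q \<Delta>" using A_with_comult by blast
  interpret Q: rel_family HJ.Q G L N ab by (rule rel_family_quot)
  show ?thesis
    unfolding \<Delta>
  proof (intro rel_family.intro csa_with_comult HJ.csa_quot comm_group_axioms L.subgroup_axioms rel_family_axioms.intro)
    show "1 \<le> N" by (rule N)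
    show "H_family (with_comult HJ.Q \<Delta>) N G ab" unfolding H_family_with_comult by (rule Q.fam)
    show "(\<Oplus>\<^bsub>with_comult HJ.Q \<Delta>\<^esub>k\<in>{1..N}. ab i k g) = (\<Oplus>\<^bsub>with_comult HJ.Q \<Delta>\<^esub>k\<in>{1..N}. ab j k g)"
      if "i \<in> {1..N}" "j \<in> {1..N}" "g \<in> L" for i j g
      using Q.rows[OF that] by simp
  qed
qed

text \<open>The homomorphism defined on \<open>H\<close> gives equal values to any two row sums over
  \<open>L\<close>, so it vanishes on \<open>J\<close> and descends.\<close>

lemma A_universal:
  assumes "rel_family B G L N b"
  obtains f where "f \<in> star_homs A B"
    "\<And>i j g. i \<in> {1..N} \<Longrightarrow> j \<in> {1..N} \<Longrightarrow> g \<in> carrier G \<Longrightarrow> f (ab i j g) = b i j g"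
proof -
  interpret B: rel_family B G L N b by fact
  note csaB = B.csa_axioms
  obtain f where f: "f \<in> star_homs H B"
    "\<And>i j g. i \<in> {1..N} \<Longrightarrow> j \<in> {1..N} \<Longrightarrow> g \<in> carrier G \<Longrightarrow> f (a i j g) = b i j g"
    using H_universal_H[OF csaB B.fam] by blast
  have "J \<subseteq> {x \<in> carrier H. f x = \<zero>\<^bsub>B\<^esub>}"
    unfolding J_def
  proof (rule star_ideal_gen_least[OF star_homs_kernel[OF csa_H csaB f(1)]], rule subsetI)
    fix r assume "r \<in> R"
    then obtain i j g where r: "r = (\<Oplus>\<^bsub>H\<^esub>k\<in>{1..N}. a i k g) \<ominus>\<^bsub>H\<^esub> (\<Oplus>\<^bsub>H\<^esub>k\<in>{1..N}. a j k g)"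
      "i \<in> {1..N}" "j \<in> {1..N}" "g \<in> L" unfolding R_def by blast
    have g: "g \<in> carrier G" using r(4) by (rule L.mem_carrier)
    have fs: "f (\<Oplus>\<^bsub>H\<^esub>k\<in>{1..N}. a i k g) = (\<Oplus>\<^bsub>B\<^esub>k\<in>{1..N}. b i k g)" if i: "i \<in> {1..N}" for i
    proof -
      have "f (\<Oplus>\<^bsub>H\<^esub>k\<in>{1..N}. a i k g) = (\<Oplus>\<^bsub>B\<^esub>k\<in>{1..N}. f (a i k g))"
        using i g by (intro lin_maps_finsum[OF csa_H csaB star_homsD(1)[OF f(1)]]) auto
      also have "\<dots> = (\<Oplus>\<^bsub>B\<^esub>k\<in>{1..N}. b i k g)"
        using i g by (intro B.finsum_cong') (auto simp: f(2) B.D(1))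
      finally show ?thesis .
    qed
    have "f (\<Oplus>\<^bsub>H\<^esub>k\<in>{1..N}. a i k g) = f (\<Oplus>\<^bsub>H\<^esub>k\<in>{1..N}. a j k g)"
      unfolding fs[OF r(2)] fs[OF r(3)] using r by (intro B.rows) auto
    then have "f r = \<zero>\<^bsub>B\<^esub>"
      unfolding r(1) lin_maps_minus[OF csa_H csaB star_homsD(1)[OF f(1)] sum_closed[OF r(2) g] sum_closed[OF r(3) g]]
      using star_homsD(2)[OF f(1) sum_closed[OF r(3) g]] by simp
    then show "r \<in> {x \<in> carrier H. f x = \<zero>\<^bsub>B\<^esub>}" using R_closed \<open>r \<in> R\<close> by blast
  qed
  then have fJ: "f x = \<zero>\<^bsub>B\<^esub>" if "x \<in> J" for x using that by blast
  let ?f = "\<lambda>K. the_elem (f ` K)"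
  obtain \<Delta> where \<Delta>: "A = with_comult HJ.Q \<Delta>" using A_with_comult by blast
  have "?f \<in> star_homs A B" unfolding \<Delta> star_homs_with_comult by (rule HJ.quot_lift_star_hom[OF csaB f(1) fJ])
  moreover have "?f (ab i j g) = b i j g" if "i \<in> {1..N}" "j \<in> {1..N}" "g \<in> carrier G" for i j g
    using that HJ.quot_lift_eq[OF csaB star_homsD(1)[OF f(1)] fJ, of "a i j g"] f(2) by simp
  ultimately show ?thesis using that by blast
qed

section \<open>The glued direct product\<close>

lemma star_monoid_inv: "star_monoid G (m_inv G)"
  by (intro star_monoid.intro star_monoid_axioms.intro) (simp_all add: is_monoid inv_mult_group)

abbreviation "q \<equiv> (\<lambda>g. L #> g)"
abbreviation "G' \<equiv> G Mod L"
abbreviation "C0 \<equiv> monoid_alg G (m_inv G)"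
abbreviation "sg \<equiv> (\<lambda>g. Poly_Mapping.single g (1::complex))"

lemma normal_L: "L \<lhd> G"
  by (rule subgroup_imp_normal) (rule L.subgroup_axioms)

lemma group_G': "group G'"
  by (rule normal.factorgroup_is_group[OF normal_L])

lemma q_closed: "g \<in> carrier G \<Longrightarrow> q g \<in> carrier G'"
  by (simp add: carrier_FactGroup)

lemma q_mult: "g \<in> carrier G \<Longrightarrow> h \<in> carrier G \<Longrightarrow> q g \<otimes>\<^bsub>G'\<^esub> q h = q (g \<otimes> h)"
  by (simp add: normal.rcos_sum[OF normal_L])

lemma q_inv: "g \<in> carrier G \<Longrightarrow> inv\<^bsub>G'\<^esub> (q g) = q (inv g)"
  using normal.inv_FactGroup[OF normal_L q_closed] normal.rcos_inv[OF normal_L] by simp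

lemma q_L: "g \<in> L \<Longrightarrow> q g = \<one>\<^bsub>G'\<^esub>"
  using coset_join2[OF _ L.subgroup_axioms] L.mem_carrier by simp

lemma q_one: "q \<one> = \<one>\<^bsub>G'\<^esub>"
  by (rule q_L) simp

lemma q_eq_D:
  assumes "g \<in> carrier G" "h \<in> carrier G" "q g = q h"
  shows "g \<otimes> inv h \<in> L"
  using rcos_self[OF assms(1) L.subgroup_axioms] assms L.rcos_module[OF is_group assms(2,1)] by simp

lemma csa_C0: "csa C0"
  by (rule star_monoid.csa_monoid_alg[OF star_monoid_inv])

lemma sg_closed [simp]: "g \<in> carrier G \<Longrightarrow> sg g \<in> carrier C0"
  by simp

lemma sg_mult: "sg g \<otimes>\<^bsub>C0\<^esub> sg h = sg (g \<otimes> h)"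
  by simp

lemma C0_induct [consumes 1, case_names sg add smult]:
  assumes c: "c \<in> carrier C0" and s: "\<And>g. g \<in> carrier G \<Longrightarrow> Pr (sg g)"
    and add: "\<And>c d. c \<in> carrier C0 \<Longrightarrow> d \<in> carrier C0 \<Longrightarrow> Pr c \<Longrightarrow> Pr d \<Longrightarrow> Pr (c \<oplus>\<^bsub>C0\<^esub> d)"
    and smult: "\<And>k c. c \<in> carrier C0 \<Longrightarrow> Pr c \<Longrightarrow> Pr (k \<odot>\<^bsub>C0\<^esub> c)"
  shows "Pr c"
proof -
  have "Poly_Mapping.keys c \<subseteq> carrier G" using c by simp
  then show ?thesis
  proof (induction c rule: poly_mapping_carrier_induct)
    case zero
    have "Pr (0 \<odot>\<^bsub>C0\<^esub> sg \<one>)" by (intro smult s) simp_all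
    then show ?case by (simp add: map_mult_0)
  next
    case (single g k)
    then have "Pr (k \<odot>\<^bsub>C0\<^esub> sg g)" by (intro smult s) simp_all
    then show ?case by simp
  next
    case (add c d)
    then have "Pr (c \<oplus>\<^bsub>C0\<^esub> d)" by (intro assms(3)) simp_all
    then show ?case by simp
  qed
qed

lemma C0_comm:
  assumes "c \<in> carrier C0" "d \<in> carrier C0"
  shows "c \<otimes>\<^bsub>C0\<^esub> d = d \<otimes>\<^bsub>C0\<^esub> c"
proof -
  interpret C0: csa C0 by (rule csa_C0)
  have 1: "sg g \<otimes>\<^bsub>C0\<^esub> d = d \<otimes>\<^bsub>C0\<^esub> sg g" if g: "g \<in> carrier G" for g
    using assms(2)
  proof (induction d rule: C0_induct)
    case (sg h)
    then show ?case using g by (simp add: m_comm)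
  next
    case (add c d)
    then show ?case using C0.r_distr[OF add(1,2) sg_closed[OF g]] C0.l_distr[OF add(1,2) sg_closed[OF g]] by simp
  next
    case (smult k c)
    then show ?case using C0.smult_mult_r[OF sg_closed[OF g] smult(1)] C0.smult_mult_l[OF smult(1) sg_closed[OF g]] by simp
  qed
  show ?thesis using assms(1)
  proof (induction c rule: C0_induct)
    case (sg g)
    then show ?case by (rule 1)
  next
    case (add c e)
    then show ?case using C0.r_distr[OF add(1,2) assms(2)] C0.l_distr[OF add(1,2) assms(2)] by simp
  next
    case (smult k c)
    then show ?case using C0.smult_mult_l[OF smult(1) assms(2)] C0.smult_mult_r[OF assms(2) smult(1)] by simp
  qed
qed

section \<open>Central row sums and the quotient of A \<otimes> C[G] that identifies them with group
  elements\<close>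

interpretation RA: rel_family "H_plus_rel N G L" G L N "\<lambda>i j g. J +>\<^bsub>H_plus N G\<^esub> a i j g"
  by (rule rel_family_A)

interpretation C0: csa "monoid_alg G (m_inv G)"
  by (rule csa_C0)

interpretation AC: csa_pair "H_plus_rel N G L" "monoid_alg G (m_inv G)"
  by (intro csa_pairI RA.csa_axioms csa_C0)

lemma ab_closed: "i \<in> {1..N} \<Longrightarrow> j \<in> {1..N} \<Longrightarrow> g \<in> carrier G \<Longrightarrow> ab i j g \<in> carrier A"
  by (rule RA.D(1))

lemma generates_A: "generates A {ab i j g | g i j. g \<in> carrier G \<and> i \<in> {1..N} \<and> j \<in> {1..N}}"
proof -
  obtain \<epsilon> S where "matrix_hopf A N (carrier G) (\<lambda>g i j. ab i j g) (m_inv G) \<epsilon> S"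
    using matrix_hopf_rel by auto
  then show ?thesis by (rule matrix_hopf.generates)
qed

text \<open>The commutant of all row sums over \<open>L\<close> is a star subalgebra and contains
  the generators by \<open>row_mult_b\<close>. All of \<open>L\<close> is taken at once because
  adjoints turn commuting with \<open>row (inv g)\<close> into commuting with
  \<open>row g\<close>.\<close>

lemma row_central:
  assumes g: "g \<in> L" and x: "x \<in> carrier A"
  shows "RA.row g \<otimes>\<^bsub>A\<^esub> x = x \<otimes>\<^bsub>A\<^esub> RA.row g"
proof -
  let ?Z = "{x \<in> carrier A. \<forall>g\<in>L. RA.row g \<otimes>\<^bsub>A\<^esub> x = x \<otimes>\<^bsub>A\<^esub> RA.row g}"
  have rc: "RA.row g \<in> carrier A" if "g \<in> L" for g using that L.mem_carrier RA.row_closed by blast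
  have "star_subalgebra A ?Z"
    unfolding RA.star_subalgebra_iff
  proof (intro conjI ballI allI)
    fix x y assume xy: "x \<in> ?Z" "y \<in> ?Z"
    show "x \<oplus>\<^bsub>A\<^esub> y \<in> ?Z" using xy rc by (auto simp: RA.l_distr RA.r_distr)
    have "RA.row g \<otimes>\<^bsub>A\<^esub> (x \<otimes>\<^bsub>A\<^esub> y) = x \<otimes>\<^bsub>A\<^esub> y \<otimes>\<^bsub>A\<^esub> RA.row g" if g: "g \<in> L" for g
    proof -
      have "RA.row g \<otimes>\<^bsub>A\<^esub> (x \<otimes>\<^bsub>A\<^esub> y) = (RA.row g \<otimes>\<^bsub>A\<^esub> x) \<otimes>\<^bsub>A\<^esub> y" using xy rc[OF g] by (simp add: RA.m_assoc)
      also have "\<dots> = x \<otimes>\<^bsub>A\<^esub> (RA.row g \<otimes>\<^bsub>A\<^esub> y)" using xy rc[OF g] g by (simp add: RA.m_assoc)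
      also have "\<dots> = x \<otimes>\<^bsub>A\<^esub> y \<otimes>\<^bsub>A\<^esub> RA.row g" using xy rc[OF g] g by (simp add: RA.m_assoc)
      finally show ?thesis .
    qed
    then show "x \<otimes>\<^bsub>A\<^esub> y \<in> ?Z" using xy by simp
  next
    fix x assume x: "x \<in> ?Z"
    have "RA.row g \<otimes>\<^bsub>A\<^esub> star A x = star A x \<otimes>\<^bsub>A\<^esub> RA.row g" if g: "g \<in> L" for g
    proof -
      have gi: "inv g \<in> L" "g \<in> carrier G" using g L.mem_carrier by auto
      have r: "star A (RA.row (inv g)) = RA.row g" using gi RA.row_star[of "inv g"] by simp
      have "star A (RA.row (inv g) \<otimes>\<^bsub>A\<^esub> x) = star A (x \<otimes>\<^bsub>A\<^esub> RA.row (inv g))" using x gi by simp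
      then show ?thesis using x rc[OF gi(1)] r by (simp add: RA.star_mult)
    qed
    then show "star A x \<in> ?Z" using x by simp
  qed (use rc in \<open>auto simp: RA.smult_mult_l RA.smult_mult_r\<close>)
  moreover have "{ab i j g | g i j. g \<in> carrier G \<and> i \<in> {1..N} \<and> j \<in> {1..N}} \<subseteq> ?Z"
    using RA.row_mult_b ab_closed by fastforce
  ultimately have "carrier A \<subseteq> ?Z" using generates_A unfolding generates_def by blast
  then show ?thesis using g x by blast
qed

text \<open>The conditional expectation from C[G] onto C[L], which discards the group elements
  outside \<open>L\<close>, followed by the representation by row sums. It is a module map over
  C[L], as expressed by \<open>\<chi>_shift\<close>, and in general not a ring homomorphism.\<close>

definition "\<chi> = lin_ext A (\<lambda>g. if g \<in> L then RA.row g else \<zero>\<^bsub>A\<^esub>)"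

lemma \<chi>_lin: "\<chi> \<in> lin_maps C0 A"
  unfolding \<chi>_def by (rule lin_ext_lin[OF RA.csa_axioms]) (auto simp: RA.row_closed)

lemmas \<chi>_closed = lin_mapsD(1)[OF \<chi>_lin]

lemma \<chi>_sg: "g \<in> carrier G \<Longrightarrow> \<chi> (sg g) = (if g \<in> L then RA.row g else \<zero>\<^bsub>A\<^esub>)"
  unfolding \<chi>_def by (subst lin_ext_single[OF RA.csa_axioms]) (auto simp: RA.row_closed)

lemma \<chi>_central:
  assumes "c \<in> carrier C0" and x: "x \<in> carrier A"
  shows "\<chi> c \<otimes>\<^bsub>A\<^esub> x = x \<otimes>\<^bsub>A\<^esub> \<chi> c"
  using assms(1)
proof (induction c rule: C0_induct)
  case (sg g)
  then show ?case using x by (simp add: \<chi>_sg row_central)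
next
  case (add c d)
  then show ?case
    unfolding lin_mapsD(2)[OF \<chi>_lin add(1,2)]
    using x \<chi>_closed[OF add(1)] \<chi>_closed[OF add(2)] by (simp add: RA.l_distr RA.r_distr)
next
  case (smult k c)
  then show ?case
    unfolding lin_mapsD(3)[OF \<chi>_lin smult(1)]
    using x \<chi>_closed[OF smult(1)] by (simp add: RA.smult_mult_l RA.smult_mult_r)
qed

lemma \<chi>_star:
  assumes "c \<in> carrier C0"
  shows "\<chi> (star C0 c) = star A (\<chi> c)"
  using assms
proof (induction c rule: C0_induct)
  case (sg g)
  have "inv g \<in> L \<longleftrightarrow> g \<in> L" using sg L.m_inv_closed[of "inv g"] L.m_inv_closed[of g] by auto
  then show ?case using sg by (simp add: \<chi>_sg RA.row_star)
next
  case (add c d)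
  then show ?case
    unfolding C0.star_add[OF add(1,2)] lin_mapsD(2)[OF \<chi>_lin add(1,2)]
      lin_mapsD(2)[OF \<chi>_lin C0.star_closed[OF add(1)] C0.star_closed[OF add(2)]]
    using \<chi>_closed[OF add(1)] \<chi>_closed[OF add(2)] by (simp add: RA.star_add)
next
  case (smult k c)
  then show ?case
    unfolding C0.star_smult[OF smult(1)] lin_mapsD(3)[OF \<chi>_lin smult(1)]
      lin_mapsD(3)[OF \<chi>_lin C0.star_closed[OF smult(1)]]
    using \<chi>_closed[OF smult(1)] by (simp add: RA.star_smult)
qed

text \<open>Translation by an element of \<open>L\<close> preserves both \<open>L\<close> and its
  complement, and on \<open>L\<close> the row sums are multiplicative. This identity lets
  \<open>row g\<close> in one leg cancel against \<open>inv g\<close> in the other.\<close>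

lemma \<chi>_shift:
  assumes g: "g \<in> L" and c: "c \<in> carrier C0"
  shows "RA.row g \<otimes>\<^bsub>A\<^esub> \<chi> (sg (inv g) \<otimes>\<^bsub>C0\<^esub> c) = \<chi> c"
  using c
proof (induction c rule: C0_induct)
  have gG: "g \<in> carrier G" using g by (rule L.mem_carrier)
  note rc = RA.row_closed[OF gG] and ig = sg_closed[OF inv_closed[OF gG]]
  {
    case (sg h)
    have "inv g \<otimes> h \<in> L \<longleftrightarrow> h \<in> L"
    proof
      assume "inv g \<otimes> h \<in> L"
      then have "g \<otimes> (inv g \<otimes> h) \<in> L" using g by simp
      then show "h \<in> L" using gG sg by (simp add: m_assoc[symmetric])
    qed (use g in simp)
    moreover have "RA.row g \<otimes>\<^bsub>A\<^esub> RA.row (inv g \<otimes> h) = RA.row h" if "h \<in> L"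
      using g gG sg that by (simp add: RA.row_mult m_assoc[symmetric])
    ultimately show ?case using sg gG rc by (simp add: \<chi>_sg)
  next
    case (add c d)
    show ?case
      unfolding C0.r_distr[OF add(1,2) ig] lin_mapsD(2)[OF \<chi>_lin C0.m_closed[OF ig add(1)] C0.m_closed[OF ig add(2)]]
        RA.r_distr[OF \<chi>_closed[OF C0.m_closed[OF ig add(1)]] \<chi>_closed[OF C0.m_closed[OF ig add(2)]] rc]
        add(3,4) lin_mapsD(2)[OF \<chi>_lin add(1,2)] ..
  next
    case (smult k c)
    show ?case
      unfolding C0.smult_mult_r[OF ig smult(1)] lin_mapsD(3)[OF \<chi>_lin C0.m_closed[OF ig smult(1)]]
        RA.smult_mult_r[OF rc \<chi>_closed[OF C0.m_closed[OF ig smult(1)]]] smult(2) lin_mapsD(3)[OF \<chi>_lin smult(1)] ..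
  }
qed

abbreviation "M \<equiv> tensor_alg A C0"
abbreviation "tM \<equiv> tens A C0"

interpretation M: csa "tensor_alg (H_plus_rel N G L) (monoid_alg G (m_inv G))"
  by (rule AC.csa_tensor)

definition "T0' = tensor_lift A C0 A (\<lambda>x c. x \<otimes>\<^bsub>A\<^esub> \<chi> c)"

lemma bilin_T0: "bilin A C0 A (\<lambda>x c. x \<otimes>\<^bsub>A\<^esub> \<chi> c)"
  using bilin_comp[OF RA.bilin_mult lin_maps_id \<chi>_lin lin_maps_id] .

lemmas T0_lin = AC.tensor_lift(1)[OF RA.csa_axioms bilin_T0, folded T0'_def]
lemmas T0_tens = AC.tensor_lift(2)[OF RA.csa_axioms bilin_T0, folded T0'_def]
lemmas T0_closed = lin_mapsD(1)[OF T0_lin]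
lemmas T0_zero = lin_maps_zero[OF M.csa_axioms RA.csa_axioms T0_lin]

text \<open>The adjoint reverses the factors \<open>x\<close> and \<open>\<chi> c\<close>, and
  centrality of \<open>\<chi> c\<close> restores their order. Closure of \<open>K0\<close> under the
  involution rests on this.\<close>

lemma T0_star:
  assumes "z \<in> carrier M"
  shows "T0' (star M z) = star A (T0' z)"
  using assms
proof (induction z rule: AC.tens_induct)
  case (tens x c)
  then show ?case using \<chi>_closed[OF tens(2)]
    by (simp add: AC.tens_star[OF tens] T0_tens[OF RA.star_closed[OF tens(1)] C0.star_closed[OF tens(2)]]
        T0_tens[OF tens] \<chi>_star[OF tens(2)] RA.star_mult \<chi>_central[OF C0.star_closed[OF tens(2)] RA.star_closed[OF tens(1)], unfolded \<chi>_star[OF tens(2)]])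
next
  case (add x y)
  then show ?case by (simp add: M.star_add RA.star_add lin_mapsD(2)[OF T0_lin] T0_closed)
qed

text \<open>The largest ideal in the kernel of \<^term>\<open>T0'\<close>: in the quotient, \<open>row g\<close> is identified with \<open>g\<close> for \<open>g \<in> L\<close>.\<close>

definition "K0 = {z \<in> carrier M. \<forall>v\<in>carrier M. \<forall>w\<in>carrier M. T0' (v \<otimes>\<^bsub>M\<^esub> z \<otimes>\<^bsub>M\<^esub> w) = \<zero>\<^bsub>A\<^esub>}"

text \<open>The free factors on both sides in the definition of \<open>K0\<close> absorb any
  multiplier, and the involution exchanges the two sides.\<close>

lemma star_ideal_K0: "star_ideal M K0"
  unfolding M.star_ideal_iff
proof (intro conjI ballI allI)
  show "K0 \<subseteq> carrier M" unfolding K0_def by blast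
  show "\<zero>\<^bsub>M\<^esub> \<in> K0" unfolding K0_def using T0_zero by simp
next
  fix x y assume "x \<in> K0" "y \<in> K0"
  then show "x \<oplus>\<^bsub>M\<^esub> y \<in> K0" unfolding K0_def by (auto simp: M.l_distr M.r_distr lin_mapsD(2)[OF T0_lin])
next
  fix c x assume "x \<in> K0"
  then show "c \<odot>\<^bsub>M\<^esub> x \<in> K0" unfolding K0_def by (auto simp: M.smult_mult_l M.smult_mult_r lin_mapsD(3)[OF T0_lin])
next
  fix x y assume x: "x \<in> K0" and y: "y \<in> carrier M"
  have xc: "x \<in> carrier M" and x0: "\<And>v w. v \<in> carrier M \<Longrightarrow> w \<in> carrier M \<Longrightarrow> T0' (v \<otimes>\<^bsub>M\<^esub> x \<otimes>\<^bsub>M\<^esub> w) = \<zero>\<^bsub>A\<^esub>"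
    using x unfolding K0_def by auto
  have "T0' (v \<otimes>\<^bsub>M\<^esub> (y \<otimes>\<^bsub>M\<^esub> x) \<otimes>\<^bsub>M\<^esub> w) = \<zero>\<^bsub>A\<^esub>" if "v \<in> carrier M" "w \<in> carrier M" for v w
    using x0[of "v \<otimes>\<^bsub>M\<^esub> y" w] that xc y by (simp add: M.m_assoc)
  then show "y \<otimes>\<^bsub>M\<^esub> x \<in> K0" unfolding K0_def using xc y by simp
  have "T0' (v \<otimes>\<^bsub>M\<^esub> (x \<otimes>\<^bsub>M\<^esub> y) \<otimes>\<^bsub>M\<^esub> w) = \<zero>\<^bsub>A\<^esub>" if "v \<in> carrier M" "w \<in> carrier M" for v w
    using x0[of v "y \<otimes>\<^bsub>M\<^esub> w"] that xc y by (simp add: M.m_assoc)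
  then show "x \<otimes>\<^bsub>M\<^esub> y \<in> K0" unfolding K0_def using xc y by simp
next
  fix x assume x: "x \<in> K0"
  have xc: "x \<in> carrier M" and x0: "\<And>v w. v \<in> carrier M \<Longrightarrow> w \<in> carrier M \<Longrightarrow> T0' (v \<otimes>\<^bsub>M\<^esub> x \<otimes>\<^bsub>M\<^esub> w) = \<zero>\<^bsub>A\<^esub>"
    using x unfolding K0_def by auto
  have "T0' (v \<otimes>\<^bsub>M\<^esub> star M x \<otimes>\<^bsub>M\<^esub> w) = \<zero>\<^bsub>A\<^esub>" if vw: "v \<in> carrier M" "w \<in> carrier M" for v w
  proof -
    have "v \<otimes>\<^bsub>M\<^esub> star M x \<otimes>\<^bsub>M\<^esub> w = star M (star M w \<otimes>\<^bsub>M\<^esub> x \<otimes>\<^bsub>M\<^esub> star M v)"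
      using vw xc by (simp add: M.star_mult M.m_assoc)
    then show ?thesis using x0[of "star M w" "star M v"] vw xc by (simp add: T0_star)
  qed
  then show "star M x \<in> K0" unfolding K0_def using xc by simp
qed

interpretation KI: csa_ideal "tensor_alg (H_plus_rel N G L) (monoid_alg G (m_inv G))" K0
  by (intro csa_ideal.intro M.csa_axioms csa_ideal_axioms.intro star_ideal_K0)

interpretation KQ: csa "quot_alg (tensor_alg (H_plus_rel N G L) (monoid_alg G (m_inv G))) K0"
  by (rule KI.csa_quot)

abbreviation "\<rho> \<equiv> (\<lambda>z. K0 +>\<^bsub>M\<^esub> z)"
definition "T1 = (\<lambda>Y. the_elem (T0' ` Y))"

text \<open>Take the unit for both outer factors. Hence \<open>T0'\<close> descends to the quotient
  by \<open>K0\<close> without a list of relations to check.\<close>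

lemma T0_K0:
  assumes "z \<in> K0"
  shows "T0' z = \<zero>\<^bsub>A\<^esub>"
proof -
  have z: "z \<in> carrier M" "T0' (\<one>\<^bsub>M\<^esub> \<otimes>\<^bsub>M\<^esub> z \<otimes>\<^bsub>M\<^esub> \<one>\<^bsub>M\<^esub>) = \<zero>\<^bsub>A\<^esub>"
    using assms M.one_closed unfolding K0_def by blast+
  then show ?thesis by simp
qed

lemma T1_lin: "T1 \<in> lin_maps KI.Q A"
  unfolding T1_def by (rule KI.quot_lift_lin[OF RA.csa_axioms T0_lin T0_K0])

lemma T1_\<rho>: "z \<in> carrier M \<Longrightarrow> T1 (\<rho> z) = T0' z"
  unfolding T1_def by (rule KI.quot_lift_eq[OF RA.csa_axioms T0_lin T0_K0])

lemma \<rho>_hom: "\<rho> \<in> star_homs M KI.Q"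
  by (rule KI.proj_star_hom)

text \<open>Inserting \<open>row g\<close> \<otimes> \<open>inv g\<close> between two elementary
  tensors leaves \<open>T0'\<close> unchanged: the row sum is central, the group algebra is
  commutative, and \<open>\<chi>_shift\<close> cancels the pair. By linearity the difference from
  the unit lies in \<open>K0\<close>.\<close>

lemma row_identified:
  assumes g: "g \<in> L"
  shows "\<rho> (tM (RA.row g) (sg (inv g))) = \<one>\<^bsub>KI.Q\<^esub>"
proof -
  have gG: "g \<in> carrier G" using g by (rule L.mem_carrier)
  note rc = RA.row_closed[OF gG] and ig = sg_closed[OF inv_closed[OF gG]]
  let ?w = "tM (RA.row g) (sg (inv g))"
  have wc: "?w \<in> carrier M" by (rule AC.tens_closed[OF rc ig])
  have tt: "T0' (tM x c \<otimes>\<^bsub>M\<^esub> ?w \<otimes>\<^bsub>M\<^esub> tM y d) = T0' (tM x c \<otimes>\<^bsub>M\<^esub> tM y d)"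
    if h: "x \<in> carrier A" "c \<in> carrier C0" "y \<in> carrier A" "d \<in> carrier C0" for x c y d
  proof -
    note cd = C0.m_closed[OF h(2,4)]
    have e1: "x \<otimes>\<^bsub>A\<^esub> RA.row g \<otimes>\<^bsub>A\<^esub> y = (x \<otimes>\<^bsub>A\<^esub> y) \<otimes>\<^bsub>A\<^esub> RA.row g"
      using h rc by (simp add: RA.m_assoc row_central[OF g h(3)])
    have e2: "c \<otimes>\<^bsub>C0\<^esub> sg (inv g) \<otimes>\<^bsub>C0\<^esub> d = sg (inv g) \<otimes>\<^bsub>C0\<^esub> (c \<otimes>\<^bsub>C0\<^esub> d)"
      unfolding C0_comm[OF h(2) ig] by (rule C0.m_assoc[OF ig h(2,4)])
    have m: "tM x c \<otimes>\<^bsub>M\<^esub> ?w \<otimes>\<^bsub>M\<^esub> tM y d =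
        tM ((x \<otimes>\<^bsub>A\<^esub> y) \<otimes>\<^bsub>A\<^esub> RA.row g) (sg (inv g) \<otimes>\<^bsub>C0\<^esub> (c \<otimes>\<^bsub>C0\<^esub> d))"
      unfolding AC.tens_mult[OF h(1,2) rc ig]
        AC.tens_mult[OF RA.m_closed[OF h(1) rc] C0.m_closed[OF h(2) ig] h(3,4)] e1 e2 ..
    have "T0' (tM x c \<otimes>\<^bsub>M\<^esub> ?w \<otimes>\<^bsub>M\<^esub> tM y d) = (x \<otimes>\<^bsub>A\<^esub> y) \<otimes>\<^bsub>A\<^esub> RA.row g \<otimes>\<^bsub>A\<^esub> \<chi> (sg (inv g) \<otimes>\<^bsub>C0\<^esub> (c \<otimes>\<^bsub>C0\<^esub> d))"
      unfolding m by (rule T0_tens[OF RA.m_closed[OF RA.m_closed[OF h(1,3)] rc] C0.m_closed[OF ig cd]])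
    also have "\<dots> = (x \<otimes>\<^bsub>A\<^esub> y) \<otimes>\<^bsub>A\<^esub> \<chi> (c \<otimes>\<^bsub>C0\<^esub> d)"
      by (subst RA.m_assoc[OF RA.m_closed[OF h(1,3)] rc \<chi>_closed[OF C0.m_closed[OF ig cd]]], subst \<chi>_shift[OF g cd], rule refl)
    also have "\<dots> = T0' (tM x c \<otimes>\<^bsub>M\<^esub> tM y d)"
      by (subst AC.tens_mult[OF h], subst T0_tens[OF RA.m_closed[OF h(1,3)] cd], rule refl)
    finally show ?thesis .
  qed
  have tw: "T0' (tM x c \<otimes>\<^bsub>M\<^esub> ?w \<otimes>\<^bsub>M\<^esub> w) = T0' (tM x c \<otimes>\<^bsub>M\<^esub> w)"
    if h: "x \<in> carrier A" "c \<in> carrier C0" and w: "w \<in> carrier M" for x c w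
    using w
  proof (induction w rule: AC.tens_induct)
    case (tens y d)
    then show ?case by (rule tt[OF h])
  next
    case (add y z)
    then show ?case using AC.tens_closed[OF h] wc by (simp add: M.r_distr lin_mapsD(2)[OF T0_lin])
  qed
  have vw: "T0' (v \<otimes>\<^bsub>M\<^esub> ?w \<otimes>\<^bsub>M\<^esub> w) = T0' (v \<otimes>\<^bsub>M\<^esub> w)" if v: "v \<in> carrier M" and w: "w \<in> carrier M" for v w
    using v
  proof (induction v rule: AC.tens_induct)
    case (tens y d)
    then show ?case by (rule tw[OF _ _ w])
  next
    case (add y z)
    then show ?case using wc w by (simp add: M.l_distr lin_mapsD(2)[OF T0_lin])
  qed
  have "?w \<ominus>\<^bsub>M\<^esub> \<one>\<^bsub>M\<^esub> \<in> K0"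
    unfolding K0_def
  proof (intro CollectI conjI ballI)
    show "?w \<ominus>\<^bsub>M\<^esub> \<one>\<^bsub>M\<^esub> \<in> carrier M" using wc by simp
    fix v w assume v: "v \<in> carrier M" and w: "w \<in> carrier M"
    have "v \<otimes>\<^bsub>M\<^esub> (?w \<ominus>\<^bsub>M\<^esub> \<one>\<^bsub>M\<^esub>) \<otimes>\<^bsub>M\<^esub> w = (v \<otimes>\<^bsub>M\<^esub> ?w \<otimes>\<^bsub>M\<^esub> w) \<ominus>\<^bsub>M\<^esub> (v \<otimes>\<^bsub>M\<^esub> w)"
      using v w wc by (simp add: a_minus_def M.l_distr M.r_distr M.l_minus M.r_minus)
    then show "T0' (v \<otimes>\<^bsub>M\<^esub> (?w \<ominus>\<^bsub>M\<^esub> \<one>\<^bsub>M\<^esub>) \<otimes>\<^bsub>M\<^esub> w) = \<zero>\<^bsub>A\<^esub>"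
      using v w wc vw[OF v w] lin_maps_minus[OF M.csa_axioms RA.csa_axioms T0_lin, of "v \<otimes>\<^bsub>M\<^esub> ?w \<otimes>\<^bsub>M\<^esub> w" "v \<otimes>\<^bsub>M\<^esub> w"] T0_closed
      by simp
  qed
  then show ?thesis
    unfolding KI.quot_one using wc by (subst KI.coset_eq_iff) auto
qed

interpretation H': H_setup "G Mod L" N
  by (intro H_setup.intro group_G')

abbreviation "HQ \<equiv> H_plus N G'"
abbreviation "a' \<equiv> H_gen N G'"
abbreviation "E0 \<equiv> tensor_alg HQ C0"
abbreviation "tE \<equiv> tens HQ C0"

lemma a'_closed [simp]: "i \<in> {1..N} \<Longrightarrow> j \<in> {1..N} \<Longrightarrow> X' \<in> carrier G' \<Longrightarrow> a' i j X' \<in> carrier HQ"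
  by (rule H_familyD(1)[OF H'.H_family_H])

subsection \<open>The representation of the quotient group algebra\<close>

text \<open>The second leg \<open>inv g\<close> compensates for the dependence of
  \<open>ab i j g\<close> on the choice of \<open>g\<close> within its coset.\<close>

definition "d i j g = \<rho> (tM (ab i j g) (sg (inv g)))"

lemma tM_closed: "i \<in> {1..N} \<Longrightarrow> j \<in> {1..N} \<Longrightarrow> g \<in> carrier G \<Longrightarrow> h \<in> carrier G \<Longrightarrow> tM (ab i j g) (sg h) \<in> carrier M"
  by (intro AC.tens_closed ab_closed sg_closed)

lemma d_closed: "i \<in> {1..N} \<Longrightarrow> j \<in> {1..N} \<Longrightarrow> g \<in> carrier G \<Longrightarrow> d i j g \<in> carrier KI.Q"
  unfolding d_def by (intro KI.coset_closed tM_closed inv_closed)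

lemma \<rho>_mult_tens:
  assumes "x \<in> carrier A" "c \<in> carrier C0" "y \<in> carrier A" "e \<in> carrier C0"
  shows "\<rho> (tM x c) \<otimes>\<^bsub>KI.Q\<^esub> \<rho> (tM y e) = \<rho> (tM (x \<otimes>\<^bsub>A\<^esub> y) (c \<otimes>\<^bsub>C0\<^esub> e))"
  using KI.quot_mult[OF AC.tens_closed[OF assms(1,2)] AC.tens_closed[OF assms(3,4)]] AC.tens_mult[OF assms] by simp

text \<open>The element for \<open>g \<otimes> h\<close> is the element for \<open>h\<close>
  multiplied by the image of \<open>row g\<close> \<otimes> \<open>inv g\<close>, which is the
  unit.\<close>

lemma d_L:
  assumes g: "g \<in> L" and h: "h \<in> carrier G" "i \<in> {1..N}" "j \<in> {1..N}"
  shows "d i j (g \<otimes> h) = d i j h"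
proof -
  have gG: "g \<in> carrier G" using g by (rule L.mem_carrier)
  have "d i j (g \<otimes> h) = \<rho> (tM (RA.row g \<otimes>\<^bsub>A\<^esub> ab i j h) (sg (inv g) \<otimes>\<^bsub>C0\<^esub> sg (inv h)))"
    unfolding d_def using RA.row_mult_b(1)[OF g h(2,3,1)] gG h(1) by (simp add: inv_mult)
  also have "\<dots> = \<rho> (tM (RA.row g) (sg (inv g))) \<otimes>\<^bsub>KI.Q\<^esub> d i j h"
    unfolding d_def
    by (rule \<rho>_mult_tens[symmetric])
      (use gG h ab_closed RA.row_closed in \<open>simp_all del: carrier_monoid_alg add: sg_closed\<close>)
  also have "\<dots> = d i j h" using d_closed[OF h(2,3,1)] row_identified[OF g] by simp
  finally show ?thesis .
qed

definition "d' i j X' = d i j (SOME g. g \<in> carrier G \<and> q g = X')"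

text \<open>The representative chosen by \<open>SOME\<close> differs from \<open>g\<close> by an
  element of \<open>L\<close>, to which \<open>d\<close> is insensitive by
  \<open>d_L\<close>.\<close>

lemma d'_q:
  assumes g: "g \<in> carrier G" and ij: "i \<in> {1..N}" "j \<in> {1..N}"
  shows "d' i j (q g) = d i j g"
proof -
  define h where "h = (SOME h. h \<in> carrier G \<and> q h = q g)"
  have h: "h \<in> carrier G" "q h = q g" using someI[of "\<lambda>h. h \<in> carrier G \<and> q h = q g" g] g unfolding h_def by auto
  have "h \<otimes> inv g \<in> L" using h g by (intro q_eq_D) auto
  from d_L[OF this g ij] have "d i j h = d i j g" using h g by (simp add: m_assoc)
  then show ?thesis unfolding d'_def h_def .
qed

lemma d_one: "\<rho> (tM \<one>\<^bsub>A\<^esub> (sg \<one>)) = \<one>\<^bsub>KI.Q\<^esub>"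
  unfolding KI.quot_one AC.tens_one by simp

lemma G'_E: "X' \<in> carrier G' \<Longrightarrow> \<exists>g\<in>carrier G. X' = q g"
  by (auto simp: carrier_FactGroup)

lemma H_family_d': "H_family KI.Q N G' d'"
proof (rule H_familyI)
  fix i j X' assume h: "i \<in> {1..N}" "j \<in> {1..N}" "X' \<in> carrier G'"
  obtain g where g: "g \<in> carrier G" "X' = q g" using G'_E[OF h(3)] by blast
  show "d' i j X' \<in> carrier KI.Q" unfolding g(2) d'_q[OF g(1) h(1,2)] by (rule d_closed[OF h(1,2) g(1)])
  have "star KI.Q (d i j g) = \<rho> (tM (star A (ab i j g)) (star C0 (sg (inv g))))"
    unfolding d_def using h g
    by (simp only: KI.quot_star[OF tM_closed[OF h(1,2) g(1) inv_closed[OF g(1)]]]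
        AC.tens_star[OF ab_closed[OF h(1,2) g(1)] sg_closed[OF inv_closed[OF g(1)]]])
  also have "\<dots> = d i j (inv g)"
    unfolding d_def using RA.D(2)[OF h(1,2) g(1)] g by simp
  finally show "star KI.Q (d' i j X') = d' i j (inv\<^bsub>G'\<^esub> X')"
    unfolding g(2) q_inv[OF g(1)] d'_q[OF g(1) h(1,2)] d'_q[OF inv_closed[OF g(1)] h(1,2)] .
next
  fix i j k X' Y' assume h: "i \<in> {1..N}" "j \<in> {1..N}" "k \<in> {1..N}" "X' \<in> carrier G'" "Y' \<in> carrier G'"
  obtain g where g: "g \<in> carrier G" "X' = q g" using G'_E[OF h(4)] by blast
  obtain f where f: "f \<in> carrier G" "Y' = q f" using G'_E[OF h(5)] by blast
  have gf: "g \<otimes> f \<in> carrier G" using g f by simp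
  \<comment> \<open>Inversion reverses products, so commutativity of the group is what makes the
    second legs multiply in the same order as the first legs.\<close>
  have s: "sg (inv g) \<otimes>\<^bsub>C0\<^esub> sg (inv f) = sg (inv (g \<otimes> f))" using g f by (simp add: inv_mult)
  have sc: "sg (inv (g \<otimes> f)) \<in> carrier C0" using gf by (intro sg_closed inv_closed)
  have z: "\<rho> (tM \<zero>\<^bsub>A\<^esub> (sg (inv (g \<otimes> f)))) = \<zero>\<^bsub>KI.Q\<^esub>"
    unfolding AC.tens_zero_l[OF sc] KI.quot_zero ..
  have "d i j g \<otimes>\<^bsub>KI.Q\<^esub> d i k f = \<rho> (tM (ab i j g \<otimes>\<^bsub>A\<^esub> ab i k f) (sg (inv g) \<otimes>\<^bsub>C0\<^esub> sg (inv f)))"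
    unfolding d_def using h g f by (intro \<rho>_mult_tens ab_closed sg_closed inv_closed)
  also have "\<dots> = (if j = k then d i j (g \<otimes> f) else \<zero>\<^bsub>KI.Q\<^esub>)"
    unfolding s RA.D(3)[OF h(1-3) g(1) f(1)] d_def using z by simp
  finally show "d' i j X' \<otimes>\<^bsub>KI.Q\<^esub> d' i k Y' = (if j = k then d' i j (X' \<otimes>\<^bsub>G'\<^esub> Y') else \<zero>\<^bsub>KI.Q\<^esub>)"
    unfolding g(2) f(2) q_mult[OF g(1) f(1)] d'_q[OF g(1) h(1,2)] d'_q[OF f(1) h(1,3)] d'_q[OF gf h(1,2)] .
  have "d j i g \<otimes>\<^bsub>KI.Q\<^esub> d k i f = \<rho> (tM (ab j i g \<otimes>\<^bsub>A\<^esub> ab k i f) (sg (inv g) \<otimes>\<^bsub>C0\<^esub> sg (inv f)))"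
    unfolding d_def using h g f by (intro \<rho>_mult_tens ab_closed sg_closed inv_closed)
  also have "\<dots> = (if j = k then d j i (g \<otimes> f) else \<zero>\<^bsub>KI.Q\<^esub>)"
    unfolding s RA.D(4)[OF h(1-3) g(1) f(1)] d_def using z by simp
  finally show "d' j i X' \<otimes>\<^bsub>KI.Q\<^esub> d' k i Y' = (if j = k then d' j i (X' \<otimes>\<^bsub>G'\<^esub> Y') else \<zero>\<^bsub>KI.Q\<^esub>)"
    unfolding g(2) f(2) q_mult[OF g(1) f(1)] d'_q[OF g(1) h(2,1)] d'_q[OF f(1) h(3,1)] d'_q[OF gf h(2,1)] .
next
  fix i assume i: "i \<in> {1..N}"
  have sum: "(\<Oplus>\<^bsub>KI.Q\<^esub>k\<in>{1..N}. \<rho> (tM (x k) (sg \<one>))) = \<one>\<^bsub>KI.Q\<^esub>"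
    if x: "\<And>k. k \<in> {1..N} \<Longrightarrow> x k \<in> carrier A" "(\<Oplus>\<^bsub>A\<^esub>k\<in>{1..N}. x k) = \<one>\<^bsub>A\<^esub>" for x :: "nat \<Rightarrow> _"
  proof -
    have "\<rho> (tM (\<Oplus>\<^bsub>A\<^esub>k\<in>{1..N}. x k) (sg \<one>)) = (\<Oplus>\<^bsub>KI.Q\<^esub>k\<in>{1..N}. \<rho> (tM (x k) (sg \<one>)))"
      by (rule lin_maps_finsum[OF RA.csa_axioms KQ.csa_axioms
            lin_maps_comp[OF bilinD(2)[OF AC.tens_bilin sg_closed[OF one_closed]] star_homsD(1)[OF \<rho>_hom]]])
        (use x in auto)
    then show ?thesis unfolding x(2) d_one ..
  qed
  have e: "d' k l \<one>\<^bsub>G'\<^esub> = \<rho> (tM (ab k l \<one>) (sg \<one>))" if "k \<in> {1..N}" "l \<in> {1..N}" for k l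
    unfolding q_one[symmetric] d'_q[OF one_closed that] d_def by simp
  have "(\<Oplus>\<^bsub>KI.Q\<^esub>k\<in>{1..N}. d' i k \<one>\<^bsub>G'\<^esub>) = (\<Oplus>\<^bsub>KI.Q\<^esub>k\<in>{1..N}. \<rho> (tM (ab i k \<one>) (sg \<one>)))"
    using i by (intro KQ.finsum_cong' e) (auto intro!: KI.coset_closed tM_closed)
  also have "\<dots> = \<one>\<^bsub>KI.Q\<^esub>" using RA.D(5)[OF i] i by (intro sum ab_closed) auto
  finally show "(\<Oplus>\<^bsub>KI.Q\<^esub>k\<in>{1..N}. d' i k \<one>\<^bsub>G'\<^esub>) = \<one>\<^bsub>KI.Q\<^esub>" .
  have "(\<Oplus>\<^bsub>KI.Q\<^esub>k\<in>{1..N}. d' k i \<one>\<^bsub>G'\<^esub>) = (\<Oplus>\<^bsub>KI.Q\<^esub>k\<in>{1..N}. \<rho> (tM (ab k i \<one>) (sg \<one>)))"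
    using i by (intro KQ.finsum_cong' e) (auto intro!: KI.coset_closed tM_closed)
  also have "\<dots> = \<one>\<^bsub>KI.Q\<^esub>" using RA.D(6)[OF i] i by (intro sum ab_closed) auto
  finally show "(\<Oplus>\<^bsub>KI.Q\<^esub>k\<in>{1..N}. d' k i \<one>\<^bsub>G'\<^esub>) = \<one>\<^bsub>KI.Q\<^esub>" .
qed

definition "\<theta> = (SOME f. f \<in> star_homs HQ KI.Q \<and>
  (\<forall>i\<in>{1..N}. \<forall>j\<in>{1..N}. \<forall>X'\<in>carrier G'. f (a' i j X') = d' i j X'))"

lemma \<theta>: "\<theta> \<in> star_homs HQ KI.Q"
  "i \<in> {1..N} \<Longrightarrow> j \<in> {1..N} \<Longrightarrow> g \<in> carrier G \<Longrightarrow> \<theta> (a' i j (q g)) = d i j g"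
proof -
  obtain f where "f \<in> star_homs HQ KI.Q"
    "\<And>i j X'. i \<in> {1..N} \<Longrightarrow> j \<in> {1..N} \<Longrightarrow> X' \<in> carrier G' \<Longrightarrow> f (a' i j X') = d' i j X'"
    using H'.H_universal_H[OF KQ.csa_axioms H_family_d'] by blast
  then have "\<exists>f. f \<in> star_homs HQ KI.Q \<and>
    (\<forall>i\<in>{1..N}. \<forall>j\<in>{1..N}. \<forall>X'\<in>carrier G'. f (a' i j X') = d' i j X')" by blast
  from someI_ex[OF this, folded \<theta>_def] have 1: "\<theta> \<in> star_homs HQ KI.Q"
    "\<And>i j X'. i \<in> {1..N} \<Longrightarrow> j \<in> {1..N} \<Longrightarrow> X' \<in> carrier G' \<Longrightarrow> \<theta> (a' i j X') = d' i j X'" by blast+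
  show "\<theta> \<in> star_homs HQ KI.Q" by (rule 1(1))
  show "\<theta> (a' i j (q g)) = d i j g" if "i \<in> {1..N}" "j \<in> {1..N}" "g \<in> carrier G"
    using 1(2)[OF that(1,2) q_closed[OF that(3)]] d'_q[OF that(3,1,2)] by simp
qed

subsection \<open>The homomorphism to the glued product and its left inverse\<close>

definition "e i j g = tE (a' i j (q g)) (sg g)"

interpretation HQ: csa "H_plus N (G Mod L)"
  by (rule H'.csa_H)

interpretation EC: csa_pair "H_plus N (G Mod L)" "monoid_alg G (m_inv G)"
  by (intro csa_pairI HQ.csa_axioms csa_C0)

interpretation E0: csa "tensor_alg (H_plus N (G Mod L)) (monoid_alg G (m_inv G))"
  by (rule EC.csa_tensor)

text \<open>For \<open>g \<in> L\<close> the class of \<open>g\<close> is trivial, so each row sum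
  is the unit tensored with \<open>g\<close>, whatever the row. The identity element is a special
  case and gives the normalization of the rows.\<close>

lemma rel_family_E0: "rel_family E0 G L N e"
proof (intro rel_family.intro E0.csa_axioms comm_group_axioms L.subgroup_axioms rel_family_axioms.intro)
  note D' = H_familyD[OF H'.H_family_H]
  have ac: "a' i j (q g) \<in> carrier HQ" if "i \<in> {1..N}" "j \<in> {1..N}" "g \<in> carrier G" for i j g
    using that q_closed by (intro D'(1))
  have sum: "(\<Oplus>\<^bsub>E0\<^esub>k\<in>{1..N}. tE (x k) (sg g)) = tE \<one>\<^bsub>HQ\<^esub> (sg g)"
    if x: "\<And>k. k \<in> {1..N} \<Longrightarrow> x k \<in> carrier HQ" "(\<Oplus>\<^bsub>HQ\<^esub>k\<in>{1..N}. x k) = \<one>\<^bsub>HQ\<^esub>" and g: "g \<in> carrier G" for g x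
  proof -
    have "tE (\<Oplus>\<^bsub>HQ\<^esub>k\<in>{1..N}. x k) (sg g) = (\<Oplus>\<^bsub>E0\<^esub>k\<in>{1..N}. tE (x k) (sg g))"
      by (rule lin_maps_finsum[OF HQ.csa_axioms E0.csa_axioms bilinD(2)[OF EC.tens_bilin sg_closed[OF g]]])
        (use x in auto)
    then show ?thesis unfolding x(2) ..
  qed
  show "1 \<le> N" by (rule N)
  have rowL: "(\<Oplus>\<^bsub>E0\<^esub>k\<in>{1..N}. e i k g) = tE \<one>\<^bsub>HQ\<^esub> (sg g)" if "i \<in> {1..N}" "g \<in> L" for i g
    unfolding e_def using that D'(5)[OF that(1)] L.mem_carrier q_L[OF that(2)]
    by (intro sum) (auto intro!: D'(1) simp del: one_FactGroup)
  show "(\<Oplus>\<^bsub>E0\<^esub>k\<in>{1..N}. e i k g) = (\<Oplus>\<^bsub>E0\<^esub>k\<in>{1..N}. e j k g)"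
    if "i \<in> {1..N}" "j \<in> {1..N}" "g \<in> L" for i j g
    using rowL[OF that(1,3)] rowL[OF that(2,3)] by simp
  show "H_family E0 N G e"
  proof (rule H_familyI)
    fix i j g assume h: "i \<in> {1..N}" "j \<in> {1..N}" "g \<in> carrier G"
    show "e i j g \<in> carrier E0" unfolding e_def by (intro EC.tens_closed ac[OF h] sg_closed h(3))
    show "star E0 (e i j g) = e i j (inv g)"
      unfolding e_def EC.tens_star[OF ac[OF h] sg_closed[OF h(3)]] D'(2)[OF h(1,2) q_closed[OF h(3)]] q_inv[OF h(3)]
      by simp
  next
    fix i j k g f assume h: "i \<in> {1..N}" "j \<in> {1..N}" "k \<in> {1..N}" "g \<in> carrier G" "f \<in> carrier G"
    have z: "tE \<zero>\<^bsub>HQ\<^esub> (sg (g \<otimes> f)) = \<zero>\<^bsub>E0\<^esub>" using h(4,5) by (intro EC.tens_zero_l sg_closed m_closed)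
    show "e i j g \<otimes>\<^bsub>E0\<^esub> e i k f = (if j = k then e i j (g \<otimes> f) else \<zero>\<^bsub>E0\<^esub>)"
      unfolding e_def EC.tens_mult[OF ac[OF h(1,2,4)] sg_closed[OF h(4)] ac[OF h(1,3,5)] sg_closed[OF h(5)]]
        D'(3)[OF h(1-3) q_closed[OF h(4)] q_closed[OF h(5)]] q_mult[OF h(4,5)] sg_mult
      using z by simp
    show "e j i g \<otimes>\<^bsub>E0\<^esub> e k i f = (if j = k then e j i (g \<otimes> f) else \<zero>\<^bsub>E0\<^esub>)"
      unfolding e_def EC.tens_mult[OF ac[OF h(2,1,4)] sg_closed[OF h(4)] ac[OF h(3,1,5)] sg_closed[OF h(5)]]
        D'(4)[OF h(1-3) q_closed[OF h(4)] q_closed[OF h(5)]] q_mult[OF h(4,5)] sg_mult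
      using z by simp
  next
    fix i assume i: "i \<in> {1..N}"
    have one: "tE \<one>\<^bsub>HQ\<^esub> (sg \<one>) = \<one>\<^bsub>E0\<^esub>" by (simp add: EC.tens_one)
    show "(\<Oplus>\<^bsub>E0\<^esub>k\<in>{1..N}. e i k \<one>) = \<one>\<^bsub>E0\<^esub>"
      using rowL[OF i L.one_closed] one by simp
    have "(\<Oplus>\<^bsub>E0\<^esub>k\<in>{1..N}. e k i \<one>) = tE \<one>\<^bsub>HQ\<^esub> (sg \<one>)"
      unfolding e_def q_one using D'(6)[OF i] i H'.one_closed
      by (intro sum) (auto intro!: D'(1) simp del: one_FactGroup)
    then show "(\<Oplus>\<^bsub>E0\<^esub>k\<in>{1..N}. e k i \<one>) = \<one>\<^bsub>E0\<^esub>" unfolding one .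
  qed
qed

definition "\<phi> = (SOME f. f \<in> star_homs A E0 \<and>
  (\<forall>i\<in>{1..N}. \<forall>j\<in>{1..N}. \<forall>g\<in>carrier G. f (ab i j g) = e i j g))"

lemma \<phi>: "\<phi> \<in> star_homs A E0"
  "i \<in> {1..N} \<Longrightarrow> j \<in> {1..N} \<Longrightarrow> g \<in> carrier G \<Longrightarrow> \<phi> (ab i j g) = e i j g"
proof -
  obtain f where "f \<in> star_homs A E0"
    "\<And>i j g. i \<in> {1..N} \<Longrightarrow> j \<in> {1..N} \<Longrightarrow> g \<in> carrier G \<Longrightarrow> f (ab i j g) = e i j g"
    using A_universal[OF rel_family_E0] by blast
  then have "\<exists>f. f \<in> star_homs A E0 \<and>
    (\<forall>i\<in>{1..N}. \<forall>j\<in>{1..N}. \<forall>g\<in>carrier G. f (ab i j g) = e i j g)" by blast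
  from someI_ex[OF this, folded \<phi>_def] show "\<phi> \<in> star_homs A E0"
    "i \<in> {1..N} \<Longrightarrow> j \<in> {1..N} \<Longrightarrow> g \<in> carrier G \<Longrightarrow> \<phi> (ab i j g) = e i j g" by blast+
qed

section \<open>Values on matrix entries and the linear left inverse\<close>

abbreviation "UA \<equiv> mat A N (\<lambda>g i j. ab i j g)"
abbreviation "UQ \<equiv> mat HQ N (\<lambda>X' i j. a' i j X')"
abbreviation "gprod gs \<equiv> foldr (\<otimes>) gs \<one>"

lemma gprod_closed [simp]: "set gs \<subseteq> carrier G \<Longrightarrow> gprod gs \<in> carrier G"
  by (induction gs) auto

lemma matrix_hopf_A: "\<exists>\<epsilon> S. matrix_hopf A N (carrier G) (\<lambda>g i j. ab i j g) (m_inv G) \<epsilon> S"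
  using matrix_hopf_rel by auto

lemma UA_closed: "set gs \<subseteq> carrier G \<Longrightarrow> p < N ^ length gs \<Longrightarrow> r < N ^ length gs \<Longrightarrow> UA gs p r \<in> carrier A"
  using matrix_hopf_A matrix_hopf.U_closed by blast

lemma UQ_closed:
  assumes "set gs \<subseteq> carrier G" "p < N ^ length gs" "r < N ^ length gs"
  shows "UQ (map q gs) p r \<in> carrier HQ"
proof -
  obtain \<epsilon> S where "matrix_hopf HQ N (carrier G') (\<lambda>X' i j. a' i j X') (m_inv G') \<epsilon> S"
    using H'.matrix_hopf_H by blast
  from matrix_hopf.U_closed[OF this, of "map q gs" p r] show ?thesis
    using assms q_closed by (auto simp: subset_iff simp del: carrier_FactGroup)
qed

text \<open>All entries of one matrix carry the same group element, the product of the list, so an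
  entry is mapped to a single elementary tensor.\<close>

lemma \<phi>_UA:
  "set gs \<subseteq> carrier G \<Longrightarrow> p < N ^ length gs \<Longrightarrow> r < N ^ length gs \<Longrightarrow>
    \<phi> (UA gs p r) = tE (UQ (map q gs) p r) (sg (gprod gs))"
proof (induction gs arbitrary: p r)
  case Nil
  then show ?case using star_homsD(6)[OF \<phi>(1)] by (simp add: EC.tens_one)
next
  case (Cons g gs)
  let ?n = "N ^ length gs"
  have pq: "p < N * ?n" "r < N * ?n" "g \<in> carrier G" "set gs \<subseteq> carrier G" using Cons.prems by auto
  note p = div_mod_less[OF pq(1)] and r = div_mod_less[OF pq(2)]
  have "\<phi> (UA (g # gs) p r) = e (p div ?n + 1) (r div ?n + 1) g \<otimes>\<^bsub>E0\<^esub> tE (UQ (map q gs) (p mod ?n) (r mod ?n)) (sg (gprod gs))"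
    using star_homsD(5)[OF \<phi>(1) ab_closed[OF p(1) r(1) pq(3)] UA_closed[OF pq(4) p(2) r(2)]]
      \<phi>(2)[OF p(1) r(1) pq(3)] Cons.IH[OF pq(4) p(2) r(2)] by simp
  also have "\<dots> = tE (UQ (map q (g # gs)) p r) (sg (gprod (g # gs)))"
    unfolding e_def
      EC.tens_mult[OF a'_closed[OF p(1) r(1) q_closed[OF pq(3)]] sg_closed[OF pq(3)] UQ_closed[OF pq(4) p(2) r(2)] sg_closed[OF gprod_closed[OF pq(4)]]]
    by simp
  finally show ?case .
qed

text \<open>The inverses in the second leg multiply to the inverse of \<open>gprod gs\<close>
  because the group is commutative.\<close>

lemma \<theta>_UQ:
  "set gs \<subseteq> carrier G \<Longrightarrow> p < N ^ length gs \<Longrightarrow> r < N ^ length gs \<Longrightarrow>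
    \<theta> (UQ (map q gs) p r) = \<rho> (tM (UA gs p r) (sg (inv (gprod gs))))"
proof (induction gs arbitrary: p r)
  case Nil
  then show ?case using star_homsD(6)[OF \<theta>(1)] d_one by simp
next
  case (Cons g gs)
  let ?n = "N ^ length gs"
  have pq: "p < N * ?n" "r < N * ?n" "g \<in> carrier G" "set gs \<subseteq> carrier G" using Cons.prems by auto
  note p = div_mod_less[OF pq(1)] and r = div_mod_less[OF pq(2)]
  have "\<theta> (UQ (map q (g # gs)) p r) = d (p div ?n + 1) (r div ?n + 1) g \<otimes>\<^bsub>KI.Q\<^esub> \<rho> (tM (UA gs (p mod ?n) (r mod ?n)) (sg (inv (gprod gs))))"
    using star_homsD(5)[OF \<theta>(1) a'_closed[OF p(1) r(1) q_closed[OF pq(3)]] UQ_closed[OF pq(4) p(2) r(2)]]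
      \<theta>(2)[OF p(1) r(1) pq(3)] Cons.IH[OF pq(4) p(2) r(2)] by simp
  also have "\<dots> = \<rho> (tM (UA (g # gs) p r) (sg (inv (gprod (g # gs)))))"
    unfolding d_def
      \<rho>_mult_tens[OF ab_closed[OF p(1) r(1) pq(3)] sg_closed[OF inv_closed[OF pq(3)]] UA_closed[OF pq(4) p(2) r(2)] sg_closed[OF inv_closed[OF gprod_closed[OF pq(4)]]]]
    using pq(3,4) by (simp add: inv_mult)
  finally show ?case .
qed

text \<open>\<open>\<theta>\<close> puts inverses of group elements into the second leg.
  Multiplication by \<open>c\<close> in that leg compensates for them before \<open>T1\<close>
  evaluates. The map is built as a linear one only, since \<open>T1\<close> is only known to be
  linear.\<close>

definition "S0 = tensor_lift HQ C0 A (\<lambda>x c. T1 (\<theta> x \<otimes>\<^bsub>KI.Q\<^esub> \<rho> (tM \<one>\<^bsub>A\<^esub> c)))"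

lemma bilin_S0: "bilin HQ C0 A (\<lambda>x c. T1 (\<theta> x \<otimes>\<^bsub>KI.Q\<^esub> \<rho> (tM \<one>\<^bsub>A\<^esub> c)))"
  using bilin_comp[OF KQ.bilin_mult star_homsD(1)[OF \<theta>(1)]
      lin_maps_comp[OF bilinD(1)[OF AC.tens_bilin RA.one_closed] star_homsD(1)[OF \<rho>_hom]] T1_lin] .

lemmas S0_lin = EC.tensor_lift(1)[OF RA.csa_axioms bilin_S0, folded S0_def]
lemmas S0_tens = EC.tensor_lift(2)[OF RA.csa_axioms bilin_S0, folded S0_def]

text \<open>On an entry, \<open>\<theta>\<close> contributes the inverse of the group element that
  \<open>\<phi>\<close> placed in the second leg. The entry tensored with the identity remains, and
  \<open>\<chi>\<close> takes the identity to the unit.\<close>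

lemma S0_\<phi>:
  assumes "x \<in> carrier A"
  shows "S0 (\<phi> x) = x"
proof -
  obtain \<epsilon> S where MA: "matrix_hopf A N (carrier G) (\<lambda>g i j. ab i j g) (m_inv G) \<epsilon> S"
    using matrix_hopf_A by blast
  show ?thesis
  proof (rule matrix_hopf.lin_maps_entries_eq[OF MA RA.csa_axioms lin_maps_comp[OF star_homsD(1)[OF \<phi>(1)] S0_lin] lin_maps_id _ assms])
    fix gs p r assume gs: "set gs \<subseteq> carrier G" "p < N ^ length gs" "r < N ^ length gs"
    let ?P = "gprod gs"
    have P: "?P \<in> carrier G" using gs(1) by (rule gprod_closed)
    note Uc = UA_closed[OF gs]
    have "S0 (\<phi> (UA gs p r)) = T1 (\<theta> (UQ (map q gs) p r) \<otimes>\<^bsub>KI.Q\<^esub> \<rho> (tM \<one>\<^bsub>A\<^esub> (sg ?P)))"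
      unfolding \<phi>_UA[OF gs] by (rule S0_tens[OF UQ_closed[OF gs] sg_closed[OF P]])
    also have "\<theta> (UQ (map q gs) p r) \<otimes>\<^bsub>KI.Q\<^esub> \<rho> (tM \<one>\<^bsub>A\<^esub> (sg ?P)) = \<rho> (tM (UA gs p r) (sg \<one>))"
      unfolding \<theta>_UQ[OF gs] \<rho>_mult_tens[OF Uc sg_closed[OF inv_closed[OF P]] RA.one_closed sg_closed[OF P]]
      using Uc P by simp
    also have "T1 (\<rho> (tM (UA gs p r) (sg \<one>))) = UA gs p r \<otimes>\<^bsub>A\<^esub> \<chi> (sg \<one>)"
      unfolding T1_\<rho>[OF AC.tens_closed[OF Uc sg_closed[OF one_closed]]] by (rule T0_tens[OF Uc sg_closed[OF one_closed]])
    also have "\<dots> = UA gs p r" using Uc by (simp add: \<chi>_sg RA.row_one)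
    finally show "S0 (\<phi> (UA gs p r)) = UA gs p r" .
  qed
qed

section \<open>The coproduct of the ambient tensor product on the image\<close>

abbreviation "CC0 \<equiv> tensor_alg C0 C0"
abbreviation "QQ0 \<equiv> tensor_alg HQ HQ"
abbreviation "EE0 \<equiv> tensor_alg E0 E0"

definition "\<Delta>C = lin_ext CC0 (\<lambda>g. tens C0 C0 (sg g) (sg g))"

lemma dual_hopf_eq: "dual_hopf G = with_comult C0 \<Delta>C"
  unfolding dual_hopf_def Let_def \<Delta>C_def lin_ext_def ..

definition "\<Delta>E = (\<lambda>z. middle_swap HQ C0 (tensor_map HQ C0 QQ0 CC0 (comult HQ) \<Delta>C z))"

lemma hopf_tensor_eq: "hopf_tensor HQ (dual_hopf G) = with_comult E0 \<Delta>E"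
  unfolding hopf_tensor_def dual_hopf_eq \<Delta>E_def by simp

lemma csa_CC0: "csa CC0"
  by (intro csa_pair.csa_tensor csa_pairI csa_C0)

lemma csa_QQ0: "csa QQ0"
  by (intro csa_pair.csa_tensor csa_pairI HQ.csa_axioms)

lemma csa_EE0: "csa EE0"
  by (intro csa_pair.csa_tensor csa_pairI E0.csa_axioms)

lemma \<Delta>C_lin: "\<Delta>C \<in> lin_maps C0 CC0"
  unfolding \<Delta>C_def
  by (rule lin_ext_lin[OF csa_CC0]) (auto intro!: csa_pair.tens_closed csa_pairI csa_C0 simp del: carrier_monoid_alg)

lemma \<Delta>C_sg:
  assumes "g \<in> carrier G"
  shows "\<Delta>C (sg g) = tens C0 C0 (sg g) (sg g)"
proof -
  interpret CC: csa_pair C0 C0 by (intro csa_pairI csa_C0)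
  interpret CC0: csa CC0 by (rule csa_CC0)
  have "tens C0 C0 (sg g) (sg g) \<in> carrier CC0" using assms by (intro CC.tens_closed sg_closed)
  then show ?thesis unfolding \<Delta>C_def by (subst lin_ext_single[OF csa_CC0]) simp_all
qed

lemma \<Delta>E_lin: "\<Delta>E \<in> lin_maps E0 EE0"
  unfolding \<Delta>E_def
  by (rule lin_maps_comp[OF tensor_map_lin[OF HQ.csa_axioms csa_C0 csa_QQ0 csa_CC0 star_homsD(1)[OF H'.comult_H(1)] \<Delta>C_lin]
        middle_swap_lin[OF HQ.csa_axioms csa_C0]])

text \<open>The second leg of the image of an entry is group-like. The middle swap attaches one copy
  of it to each factor of the matrix coproduct, so every summand is again a tensor of two images
  under \<open>\<phi>\<close>.\<close>

lemma \<Delta>E_\<phi>_UA: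
  assumes gs: "set gs \<subseteq> carrier G" "p < N ^ length gs" "r < N ^ length gs"
  shows "\<Delta>E (\<phi> (UA gs p r)) = (\<Oplus>\<^bsub>EE0\<^esub>k\<in>{..<N ^ length gs}. tens E0 E0 (\<phi> (UA gs p k)) (\<phi> (UA gs k r)))"
proof -
  interpret HH: csa_pair HQ HQ by (intro csa_pairI HQ.csa_axioms)
  interpret QC: csa_pair QQ0 CC0 by (intro csa_pairI csa_QQ0 csa_CC0)
  interpret EE0: csa EE0 by (rule csa_EE0)
  interpret EE: csa_pair E0 E0 by (intro csa_pairI E0.csa_axioms)
  interpret CC: csa_pair C0 C0 by (intro csa_pairI csa_C0)
  let ?D = "{..<N ^ length gs}" and ?P = "sg (gprod gs)"
  let ?U = "UQ (map q gs)"
  have P: "?P \<in> carrier C0" using gs(1) by (intro sg_closed gprod_closed)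
  have PP: "tens C0 C0 ?P ?P \<in> carrier CC0" using P by (intro CC.tens_closed)
  obtain \<epsilon> S where MQ: "matrix_hopf HQ N (carrier G') (\<lambda>X' i j. a' i j X') (m_inv G') \<epsilon> S"
    using H'.matrix_hopf_H by blast
  have qs: "set (map q gs) \<subseteq> carrier G'" using gs(1) q_closed by (auto simp: subset_iff simp del: carrier_FactGroup)
  have c: "comult HQ (?U p r) = (\<Oplus>\<^bsub>QQ0\<^esub>k\<in>?D. tens HQ HQ (?U p k) (?U k r))"
    using matrix_hopf.comult_U[OF MQ qs, of p r] gs(2,3) by simp
  have Uc: "?U k l \<in> carrier HQ" if "k \<in> ?D" "l \<in> ?D" for k l
    using UQ_closed[OF gs(1)] that by simp
  note tm = tensor_map_tens[OF HQ.csa_axioms csa_C0 csa_QQ0 csa_CC0 star_homsD(1)[OF H'.comult_H(1)] \<Delta>C_lin]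
  note ml = middle_swap_lin[OF HQ.csa_axioms csa_C0] and mt = middle_swap_tens[OF HQ.csa_axioms csa_C0]
  have pr: "p \<in> ?D" "r \<in> ?D" using gs by auto
  have "\<Delta>E (\<phi> (UA gs p r)) = middle_swap HQ C0 (tens QQ0 CC0 (comult HQ (?U p r)) (tens C0 C0 ?P ?P))"
    unfolding \<Delta>E_def \<phi>_UA[OF gs] using tm[OF Uc[OF pr] P] \<Delta>C_sg[OF gprod_closed[OF gs(1)]] by simp
  also have "\<dots> = (\<Oplus>\<^bsub>EE0\<^esub>k\<in>?D. middle_swap HQ C0 (tens QQ0 CC0 (tens HQ HQ (?U p k) (?U k r)) (tens C0 C0 ?P ?P)))"
    unfolding c
    by (rule lin_maps_finsum[OF csa_QQ0 csa_EE0 lin_maps_comp[OF bilinD(2)[OF QC.tens_bilin PP] ml]])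
      (use Uc pr in auto)
  also have "\<dots> = (\<Oplus>\<^bsub>EE0\<^esub>k\<in>?D. tens E0 E0 (\<phi> (UA gs p k)) (\<phi> (UA gs k r)))"
  proof (intro EE0.finsum_cong' refl)
    show "(\<lambda>k. tens E0 E0 (\<phi> (UA gs p k)) (\<phi> (UA gs k r))) \<in> ?D \<rightarrow> carrier EE0"
      using gs by (intro funcsetI EE.tens_closed star_homsD(2)[OF \<phi>(1)] UA_closed) auto
    fix k assume k: "k \<in> ?D"
    then have kl: "k < N ^ length gs" by simp
    show "middle_swap HQ C0 (tens QQ0 CC0 (tens HQ HQ (?U p k) (?U k r)) (tens C0 C0 ?P ?P)) =
        tens E0 E0 (\<phi> (UA gs p k)) (\<phi> (UA gs k r))"
      unfolding \<phi>_UA[OF gs(1,2) kl] \<phi>_UA[OF gs(1) kl gs(3)] by (rule mt[OF Uc[OF pr(1) k] Uc[OF k pr(2)] P P])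
  qed
  finally show ?thesis .
qed

abbreviation "E \<equiv> hopf_tensor HQ (dual_hopf G)"
abbreviation "TE \<equiv> \<phi> ` carrier A"

lemma csa_E: "csa E"
  unfolding hopf_tensor_eq by (rule csa_with_comult[OF E0.csa_axioms])

lemma \<phi>_E: "\<phi> \<in> star_homs A E"
  unfolding hopf_tensor_eq star_homs_with_comult by (rule \<phi>(1))

text \<open>The generators of the glued product are the images of the generators of
  \<open>A\<close>, so the subalgebra generated by them is the image of \<open>A\<close>.\<close>

lemma glued_product_eq: "glued_product N G L = hopf_sub E TE"
proof -
  have "{tens HQ (dual_hopf G) (a' i j (q g)) (sg g) | i j g. i \<in> {1..N} \<and> j \<in> {1..N} \<and> g \<in> carrier G} =
      \<phi> ` {ab i j g | g i j. g \<in> carrier G \<and> i \<in> {1..N} \<and> j \<in> {1..N}}" (is "?L = ?R")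
  proof (intro equalityI subsetI)
    fix y assume "y \<in> ?L"
    then obtain i j g where y: "y = tens HQ (dual_hopf G) (a' i j (q g)) (sg g)"
      and h: "i \<in> {1..N}" "j \<in> {1..N}" "g \<in> carrier G" by blast
    have "y = \<phi> (ab i j g)" unfolding \<phi>(2)[OF h] e_def y dual_hopf_eq by simp
    then show "y \<in> ?R" using h by blast
  next
    fix y assume "y \<in> ?R"
    then obtain i j g where y: "y = \<phi> (ab i j g)"
      and h: "i \<in> {1..N}" "j \<in> {1..N}" "g \<in> carrier G" by blast
    have "y = tens HQ (dual_hopf G) (a' i j (q g)) (sg g)"
      unfolding y \<phi>(2)[OF h] e_def dual_hopf_eq by simp
    then show "y \<in> ?L" using h by blast
  qed
  then show ?thesis
    unfolding glued_product_def Let_def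
    using star_subalgebra_gen_image[OF RA.csa_axioms csa_E \<phi>_E generates_A] by simp
qed

text \<open>\<open>\<phi>\<close> and \<open>S0\<close> are mutually inverse between
  \<open>A\<close> and the image, so \<open>transport\<close> only asks for compatibility with the
  coproducts. This is verified in the ambient tensor square and pulled back to the subalgebra by
  \<open>hopf_sub_comult\<close>.\<close>

theorem cqg_isomorphic: "A \<cong>\<^sub>C\<^sub>Q\<^sub>G glued_product N G L"
proof -
  let ?B1 = "E\<lparr>carrier := TE\<rparr>"
  let ?B = "hopf_sub E TE"
  note cA = RA.csa_axioms
  have TE: "star_subalgebra E TE" by (rule star_subalgebra_image[OF cA csa_E \<phi>_E])
  have B1: "csa ?B1" by (rule csa_subalgebra[OF csa_E TE])
  have Beq: "\<exists>\<Delta>. ?B = with_comult ?B1 \<Delta>" unfolding hopf_sub_def Let_def by blast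
  have B: "csa ?B" using Beq csa_with_comult[OF B1] by auto
  note F = star_homsD[OF \<phi>_E]
  have \<phi>B1: "\<phi> \<in> star_homs A ?B1"
    by (rule star_homsI) (auto intro!: lin_mapsI simp: F)
  \<comment> \<open>On the image of \<open>\<phi>\<close> the map \<open>S0\<close> inverts a star
    homomorphism and is therefore one itself, although on all of \<open>E\<close> it is only used as
    a linear map.\<close>
  have S0B1: "S0 \<in> star_homs ?B1 A"
    by (rule star_homsI)
      (auto intro!: lin_mapsI simp: F(3-5,7)[symmetric] F(6)[symmetric] S0_\<phi>)
  have hB: "\<phi> \<in> star_homs A ?B" "S0 \<in> star_homs ?B A"
    using Beq \<phi>B1 S0B1 by auto
  have S0E: "S0 \<in> lin_maps E A" unfolding hopf_tensor_eq lin_maps_with_comult by (rule S0_lin)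
  \<comment> \<open>Since \<open>S0\<close> is defined on all of \<open>E\<close>, this is a linear
    retraction onto the image, as needed to determine the restricted coproduct.\<close>
  have retr: "(\<lambda>y. \<phi> (S0 y)) \<in> lin_maps E ?B1"
    by (rule lin_maps_comp[OF S0E star_homsD(1)[OF \<phi>B1]])
  obtain \<epsilon> S where "matrix_hopf A N (carrier G) (\<lambda>g i j. ab i j g) (m_inv G) \<epsilon> S"
    using matrix_hopf_A by blast
  then interpret MA: matrix_hopf A N "carrier G" "\<lambda>g i j. ab i j g" "m_inv G" \<epsilon> S .
  interpret BB1: csa_pair ?B1 ?B1 by (intro csa_pairI B1)
  let ?ff = "tensor_map A A ?B1 ?B1 \<phi> \<phi>" and ?i = "tensor_map ?B1 ?B1 E E (\<lambda>y. y) (\<lambda>y. y)"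
  have \<iota>: "(\<lambda>y. y) \<in> lin_maps ?B1 E"
    using F(2) by (intro lin_mapsI) auto
  note ffl = tensor_map_lin[OF cA cA B1 B1 star_homsD(1)[OF \<phi>B1] star_homsD(1)[OF \<phi>B1]]
    and fft = tensor_map_tens[OF cA cA B1 B1 star_homsD(1)[OF \<phi>B1] star_homsD(1)[OF \<phi>B1]]
  note il = tensor_map_lin[OF B1 B1 csa_E csa_E \<iota> \<iota>] and it = tensor_map_tens[OF B1 B1 csa_E csa_E \<iota> \<iota>]
  have EE: "tensor_alg E E = EE0" "tens E E = tens E0 E0" "comult E = \<Delta>E"
    unfolding hopf_tensor_eq by simp_all
  interpret EE0: csa EE0 by (rule csa_EE0)
  interpret E2: csa_pair E0 E0 by (intro csa_pairI E0.csa_axioms)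
  \<comment> \<open>In the ambient tensor square the coproduct has an explicit formula, and both
    sides are linear in \<open>x\<close>, so entries suffice.\<close>
  have main: "?i (?ff (comult A x)) = comult E (\<phi> x)" if x: "x \<in> carrier A" for x
  proof (rule MA.lin_maps_entries_eq[OF csa_EE0 _ _ _ x])
    show "(\<lambda>x. ?i (?ff (comult A x))) \<in> lin_maps A EE0"
      using lin_maps_comp[OF MA.comult_lin lin_maps_comp[OF ffl il]] unfolding EE .
    show "(\<lambda>x. comult E (\<phi> x)) \<in> lin_maps A EE0"
      unfolding EE by (rule lin_maps_comp[OF star_homsD(1)[OF \<phi>(1)] \<Delta>E_lin])
    fix gs p r assume gs: "set gs \<subseteq> carrier G" "p < N ^ length gs" "r < N ^ length gs"
    have "?i (?ff (comult A (UA gs p r))) = (\<Oplus>\<^bsub>EE0\<^esub>k\<in>{..<N ^ length gs}. ?i (?ff (tens A A (UA gs p k) (UA gs k r))))"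
      unfolding MA.comult_U[OF gs]
      using gs by (intro lin_maps_finsum[OF MA.T.csa_axioms csa_EE0 lin_maps_comp[OF ffl il[unfolded EE]]]) (auto intro!: MA.AA.tens_closed UA_closed)
    also have "\<dots> = (\<Oplus>\<^bsub>EE0\<^esub>k\<in>{..<N ^ length gs}. tens E0 E0 (\<phi> (UA gs p k)) (\<phi> (UA gs k r)))"
    proof (intro EE0.finsum_cong' refl)
      show "(\<lambda>k. tens E0 E0 (\<phi> (UA gs p k)) (\<phi> (UA gs k r))) \<in> {..<N ^ length gs} \<rightarrow> carrier EE0"
        using gs by (intro funcsetI E2.tens_closed star_homsD(2)[OF \<phi>(1)] UA_closed) auto
      fix k assume "k \<in> {..<N ^ length gs}"
      then have k: "k < N ^ length gs" by simp
      note U = UA_closed[OF gs(1,2) k] UA_closed[OF gs(1) k gs(3)]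
      show "?i (?ff (tens A A (UA gs p k) (UA gs k r))) = tens E0 E0 (\<phi> (UA gs p k)) (\<phi> (UA gs k r))"
        unfolding fft[OF U]
        using it[OF star_homsD(2)[OF \<phi>B1 U(1)] star_homsD(2)[OF \<phi>B1 U(2)]] unfolding EE .
    qed
    also have "\<dots> = comult E (\<phi> (UA gs p r))" unfolding EE \<Delta>E_\<phi>_UA[OF gs] ..
    finally show "?i (?ff (comult A (UA gs p r))) = comult E (\<phi> (UA gs p r))" .
  qed
  have cm: "comult ?B (\<phi> x) = ?ff (comult A x)" if x: "x \<in> carrier A" for x
  proof (rule hopf_sub_comult[OF csa_E TE retr])
    show "\<phi> (S0 y) = y" if "y \<in> TE" for y using that S0_\<phi> by auto
    show "?ff (comult A x) \<in> carrier (tensor_alg ?B1 ?B1)"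
      by (rule lin_mapsD(1)[OF ffl lin_mapsD(1)[OF MA.comult_lin x]])
    show "?i (?ff (comult A x)) = comult E (\<phi> x)" by (rule main[OF x])
  qed
  have "comult ?B (\<phi> x) = tensor_map A A ?B ?B \<phi> \<phi> (comult A x)" if x: "x \<in> carrier A" for x
  proof -
    have "tensor_map A A ?B ?B \<phi> \<phi> = ?ff" using Beq by auto
    then show ?thesis using cm[OF x] by simp
  qed
  note tr = MA.transport[OF B hB S0_\<phi> _ this]
  have "\<phi> (S0 y) = y" if "y \<in> carrier ?B" for y
    using that Beq S0_\<phi> by auto
  note tr' = tr[OF _ this]
  show ?thesis
    unfolding cqg_isomorphic_def glued_product_eq using MA.cqg tr' by blast
qed

end

theorem theorem3p10:
  fixes N :: nat and \<Gamma> :: "('g, 'm) monoid_scheme" and \<Lambda> :: "'g set"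
  assumes "N \<ge> 1"
    and "comm_group \<Gamma>"
    and "subgroup \<Lambda> \<Gamma>"
  shows "H_plus_rel N \<Gamma> \<Lambda> \<cong>\<^sub>C\<^sub>Q\<^sub>G glued_product N \<Gamma> \<Lambda>"
proof -
  interpret comm_group \<Gamma> by fact
  interpret H_rel \<Gamma> N \<Lambda>
    by (intro H_rel.intro H_setup.intro H_rel_axioms.intro assms is_group)
  show ?thesis by (rule cqg_isomorphic)
qed

end
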